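(* Assume (A1)--(A6), and let $v_\infty$ be the critical point of $f$ described in the context. Then for any $r>0$ there exists a positive integer $N$ such that for any positive integer $k$ and any $P=(p_1,\dots,p_k)\in\mathcal{P}(k,N)$, one has $\mathcal{C}\cap\mathcal{B}^P_r(v_\infty)\neq\emptyset$.
   Context: **Equation and assumptions.** Fix $n\ge 1$; $\langle\cdot,\cdot\rangle$, $|\cdot|$ are the Euclidean inner product and norm on $\mathbb{R}^n$; $\Delta x(t-1)=x(t)-x(t-1)$, $\Delta^2x(t-1)=\Delta(\Delta x(t-1))=x(t+1)-2x(t)+x(t-1)$. For each $t\in\mathbb{Z}$, $L(t)$ is a real $n\times n$ matrix, $V(t,\cdot)\in C^1(\mathbb{R}^n,\mathbb{R})$ with gradient $V'_x(t,\cdot)$ and $V'_x(t,0)=0$. The equation is $\Delta^2x(t-1)-L(t)x(t)+V'_x(t,x(t))=0$, $t\in\mathbb{Z}$. (A1) There is a positive integer $T$ with $L(t+T)=L(t)$, $V(t+T,\cdot)=V(t,\cdot)$ for all $t\in\mathbb{Z}$. (A2) $L(t)$ is symmetric and positive definite for all $t\in\mathbb{Z}$. (A3) $V(t,0)=0$ and $|V'_x(t,x)|=o(|x|)$ as $x\to0$. (A4) There are constants $\beta>2$ and $0<\alpha<\beta/2-1$ with $\beta V(t,x)-\langle V'_x(t,x),x\rangle\le\alpha\langle x,L(t)x\rangle$ for all $(t,x)\in\mathbb{Z}\times\mathbb{R}^n$. (A5) There is $(t_0,x_0)\in\mathbb{Z}\times\mathbb{R}^n$, $x_0\ne0$, with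 $V(t_0,x_0)-\tfrac12\langle x_0,L(t_0)x_0\rangle>0$. **Functional.** $l^2$ is the space of square-summable sequences $u:\mathbb{Z}\to\mathbb{R}^n$, with the inner product $\langle u,v\rangle_*=\sum_{t\in\mathbb{Z}}\langle\Delta u(t-1),\Delta v(t-1)\rangle+\sum_{t\in\mathbb{Z}}\langle u(t),L(t)v(t)\rangle$ and norm $\|u\|_*=\langle u,u\rangle_*^{1/2}$ (equivalent to the usual norm). $f:l^2\to\mathbb{R}$, $f(u)=\frac12\|u\|_*^2-\sum_{t\in\mathbb{Z}}V(t,u(t))$, is $C^1$; $D_*f(u)$ is its Fréchet derivative and $\|D_*f(u)\|_*$ the dual norm with respect to $\|\cdot\|_*$. $\mathcal{C}$ is the set of nonzero critical points of $f$. $D_0=\inf_{v\in\mathcal{C}}\|v\|_*>0$. Write $v(\cdot-p)$ for $t\mapsto v(t-p)$. **Sets.** $f^b=\{f\le b\}$, $f_a=\{f\ge a\}$, $f_a^b=f_a\cap f^b$, $\mathcal{C}^b=\mathcal{C}\cap f^b$, $\mathcal{C}_a^b=\mathcal{C}\cap f_a^b$, $\mathcal{C}(b)=\mathcal{C}\cap f_b^b$. For $S\subset l^2$ nonempty, $\mathcal{B}_r(S)=\{u:\mathrm{dist}(u,S)<r\}$, $\mathcal{A}_{r_1,r_2}(S)=\{u: r_1<\mathrm{dist}(u,S)<r_2\}$ (distance in $\|\cdot\|_*$), and $\mathcal{B}_r(v)=\mathcal{B}_r(\{v\})$, etc. $\mathcal{S}^b_{PS}$ is the set of sequences $\{u_k\}\subset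 l^2$ with $D_*f(u_k)\to0$ and $\limsup f(u_k)\le b$. $D^b$ is the set of $\rho\in\mathbb{R}$ such that $\|u_k-u_k'\|_*\to\rho$ for some $\{u_k\},\{u'_k\}\in\mathcal{S}^b_{PS}$. **Minimax level and (A6).** Fix $w\in l^2$ with $f(w)<0$ (it exists); $\mathcal{K}=\{\gamma\in C([0,1],l^2):\gamma(0)=0,\gamma(1)=w\}$, $\kappa=\inf_{\gamma\in\mathcal{K}}\sup_{t\in[0,1]}f(\gamma(t))$ (which is $>0$). (A6) There is $\kappa^*>\kappa$ such that $\mathcal{C}\cap\{u\in l^2: f(u)\le\kappa^*\}$ is countable. **Constants $d_r,\mu_r,h_r$.** For each $r\in(0,\infty)\setminus D^{\kappa^*}$ fix $d_r\in(0,r/3)$ with $[r-3d_r,r+3d_r]\subset[0,\infty)\setminus D^{\kappa^*}$ and $\mu_r>0$ such that $\|D_*f(u)\|_*\ge\mu_r$ for every $u\in f^{\kappa^*}$ which lies in $\mathcal{A}_{r-3d_r,r+3d_r}(\mathcal{C}^{\kappa^*})$ or satisfies $r-3d_r<\|u-z\|_*<r+3d_r$ for some $z\in\mathcal{C}^{\kappa^*}$ (such constants exist). Put $h_r=\frac14d_r\mu_r$. **Connectibility.** For $\Omega\subset l^2$ open nonempty and $c\in\mathbb{R}$, points $x,y\in\Omega$ are $c$-connectible in $\Omega$ if there is a continuous path $p:[0,1]\to\Omega$ joining them with $\max_{[0,1]}f\circ p<c$. **The point $v_\infty$.** Fix $\bar r\in(0,D_0/4)\setminus D^{\kappa^*}$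 and $\bar h\in(0,\frac12\min\{h_{\bar r},\kappa^*-\kappa\})$. Fix $\bar\gamma\in\mathcal{K}$ and finitely many $v_1,\dots,v_q\in\mathcal{C}^{\kappa+\bar h}_{\kappa-\bar h}$ such that: $\max_{[0,1]}f\circ\bar\gamma<\kappa+\bar h$; if $f(\bar\gamma(s))\ge\kappa-\bar h$ then $\bar\gamma(s)\in\bigcup_j\mathcal{B}_{\bar r}(v_j)$; if $\bar\gamma(s)\in\bigcup_j\mathcal{A}_{\bar r-d_{\bar r},\bar r+d_{\bar r}}(v_j)$ then $f(\bar\gamma(s))<\kappa-h_{\bar r}$. Fix $\bar v\in\{v_1,\dots,v_q\}$ and $[s_0,s_1]\subset[0,1]$ with $\bar\gamma((s_0,s_1))\subset\mathcal{B}_{\bar r}(\bar v)$, $\bar\gamma(s_0),\bar\gamma(s_1)\in\partial\mathcal{B}_{\bar r}(\bar v)$, and $\bar\gamma(s_0),\bar\gamma(s_1)$ not $\kappa$-connectible in $l^2$. (Such choices exist.) Let $\bar{\mathcal{K}}=\{\gamma\in C([0,1],l^2):\gamma(0)=\bar\gamma(s_0),\gamma(1)=\bar\gamma(s_1),\ \mathrm{range}\,\gamma\subset\mathcal{B}_{\bar r}(\bar v)\cup f^{\kappa-\frac12h_{\bar r}}\}$ and $\bar\kappa=\inf_{\gamma\in\bar{\mathcal{K}}}\sup_{t\in[0,1]}f(\gamma(t))$. The point $v_\infty\in\mathcal{C}(\bar\kappa)$ is such that there are $r_n\in(0,\infty)\setminus D^{\kappa^*}$ and $v_n\in\mathcal{C}(\bar\kappa)$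 with $\overline{\mathcal{B}}_{r_n}(v_n)\subset\mathcal{B}_{\bar r}(\bar v)$, $r_n\to0$, $v_n\to v_\infty$, and for every $n$ and $h>0$ there is $\gamma\in C([0,1],l^2)$ with: (d1) $\gamma(0),\gamma(1)\in\partial\mathcal{B}_{r_n}(v_n)\cap f^{\bar\kappa-h_{r_n}/2}$; (d2) $\gamma(0),\gamma(1)$ are not $\bar\kappa$-connectible in $\mathcal{B}_{\bar r}(\bar v)$; (d3) $\mathrm{range}\,\gamma\subset\overline{\mathcal{B}}_{r_n}(v_n)\cap f^{\bar\kappa+h}$; (d4) $\mathrm{range}\,\gamma\cap\mathcal{A}_{r_n-d_{r_n}/2,\,r_n}(v_n)\subset f^{\bar\kappa-h_{r_n}/2}$; (d5) for some positive integer $N_n$, the support of $\gamma(\theta)$ is contained in $[-N_n,N_n]$ for all $\theta\in[0,1]$. (Such a $v_\infty$ exists under (A1)--(A6).) **Multibump notation.** For $k,N\in\mathbb{N}$, $\mathcal{P}(k,N)$ is the set of $(p_1,\dots,p_k)\in\mathbb{Z}^k$ with each $p_i$ an integer multiple of $T$ and $p_{i+1}-p_i\ge2N^2+4N$ for $1\le i\le k-1$. With $p_0=-\infty$, $p_{k+1}=+\infty$, let $I_i=\left(\frac{p_{i-1}+p_i}{2},\frac{p_i+p_{i+1}}{2}\right]\cap\mathbb{Z}$, $1\le i\le k$. For $F\subset\mathbb{Z}$, $\|u\|_F^2=\sum_{t\in F}(|\Delta u(t-1)|^2+\langle u(t),L(t)u(t)\rangle)$. For $P=(p_1,\dots,p_k)\in\mathcal{P}(k,N)$,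 $\mathcal{B}^P_r(v)=\{u\in l^2:\|u-v(\cdot-p_i)\|_{I_i}<r,\ 1\le i\le k\}$. *)

theory Defs
  imports "HOL-Analysis.Analysis"
begin

section \<open>Square-summable two-sided sequences\<close>

text \<open>The type carries the standard \<open>l\<^sup>2\<close> inner product, so that continuity, paths, frontiers, closures
  and Frechet derivatives are those of the library.  The problem-dependent inner product
  \<open>inner_star L\<close> below induces an equivalent norm when \<open>L\<close> is periodic, symmetric and positive
  definite; hence it has the same topology and the same derivatives.  Distances and dual norms are
  always taken with respect to \<open>norm_star L\<close>.\<close>

typedef (overloaded) ('a::real_inner) l2seq =
  "{u :: int \<Rightarrow> 'a. (\<lambda>t. (norm (u t))\<^sup>2) summable_on UNIV}"
  morphisms l2_nth l2_of
  by (rule exI[of _ "\<lambda>_. 0"]) simp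

setup_lifting type_definition_l2seq

lemma l2_nth_summable: "(\<lambda>t. (norm (l2_nth u t))\<^sup>2) summable_on UNIV"
  using l2_nth[of u] by simp

lemma l2_eqI: "(\<And>t. l2_nth u t = l2_nth v t) \<Longrightarrow> u = v"
  by (metis l2_nth_inject ext)

lemma norm_add_square_le:
  fixes x y :: "'a::real_inner"
  shows "(norm (x + y))\<^sup>2 \<le> 2 * (norm x)\<^sup>2 + 2 * (norm y)\<^sup>2"
proof -
  have "0 \<le> inner (x - y) (x - y)" by simp
  then show ?thesis
    by (simp add: power2_norm_eq_inner inner_add inner_diff inner_commute)
qed

instantiation l2seq :: (real_inner) real_vector
begin

lift_definition zero_l2seq :: "'a l2seq" is "\<lambda>_. 0" by simp

lift_definition plus_l2seq :: "'a l2seq \<Rightarrow> 'a l2seq \<Rightarrow> 'a l2seq" is "\<lambda>u v t. u t + v t"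
proof -
  fix u v :: "int \<Rightarrow> 'a"
  assume "(\<lambda>t. (norm (u t))\<^sup>2) summable_on UNIV" "(\<lambda>t. (norm (v t))\<^sup>2) summable_on UNIV"
  then have "(\<lambda>t. 2 * (norm (u t))\<^sup>2 + 2 * (norm (v t))\<^sup>2) summable_on UNIV"
    by (simp only: summable_on_add summable_on_cmult_right)
  then show "(\<lambda>t. (norm (u t + v t))\<^sup>2) summable_on UNIV"
    by (rule summable_on_comparison_test) (simp_all add: norm_add_square_le)
qed

lift_definition uminus_l2seq :: "'a l2seq \<Rightarrow> 'a l2seq" is "\<lambda>u t. - u t" by simp

definition minus_l2seq :: "'a l2seq \<Rightarrow> 'a l2seq \<Rightarrow> 'a l2seq" where
  "minus_l2seq u v = u + - v"

lift_definition scaleR_l2seq :: "real \<Rightarrow> 'a l2seq \<Rightarrow> 'a l2seq" is "\<lambda>c u t. c *\<^sub>R u t"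
  by (simp add: power_mult_distrib summable_on_cmult_right)

lemma l2_nth_zero [simp]: "l2_nth 0 t = 0"
  by (simp add: zero_l2seq.rep_eq)

lemma l2_nth_add [simp]: "l2_nth (u + v) t = l2_nth u t + l2_nth v t"
  by (simp add: plus_l2seq.rep_eq)

lemma l2_nth_uminus [simp]: "l2_nth (- u) t = - l2_nth u t"
  by (simp add: uminus_l2seq.rep_eq)

lemma l2_nth_diff [simp]: "l2_nth (u - v) t = l2_nth u t - l2_nth v t"
  by (simp add: minus_l2seq_def)

lemma l2_nth_scaleR [simp]: "l2_nth (c *\<^sub>R u) t = c *\<^sub>R l2_nth u t"
  by (simp add: scaleR_l2seq.rep_eq)

instance
  by intro_classes (rule l2_eqI, simp add: algebra_simps)+

end

lemma l2_inner_summable: "(\<lambda>t. inner (l2_nth u t) (l2_nth v t)) summable_on UNIV"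
proof -
  have "(\<lambda>t. - (norm (l2_nth w t))\<^sup>2) summable_on UNIV" for w :: "'a l2seq"
    using l2_nth_summable[of w] by (simp only: summable_on_uminus)
  from summable_on_add[OF summable_on_add[OF l2_nth_summable[of "u + v"] this[of u]] this[of v]]
  have "(\<lambda>t. (norm (l2_nth (u + v) t))\<^sup>2 - (norm (l2_nth u t))\<^sup>2 - (norm (l2_nth v t))\<^sup>2)
          summable_on UNIV"
    by (simp only: add_uminus_conv_diff)
  then have "(\<lambda>t. ((norm (l2_nth (u + v) t))\<^sup>2 - (norm (l2_nth u t))\<^sup>2 - (norm (l2_nth v t))\<^sup>2)
          * (1 / 2)) summable_on UNIV"
    by (rule summable_on_cmult_left)
  moreover have "((norm (l2_nth (u + v) t))\<^sup>2 - (norm (l2_nth u t))\<^sup>2 - (norm (l2_nth v t))\<^sup>2) * (1 / 2)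
      = inner (l2_nth u t) (l2_nth v t)" for t
    unfolding power2_norm_eq_inner l2_nth_add
    by (simp add: inner_add_left inner_add_right inner_commute[of "l2_nth v t" "l2_nth u t"])
  ultimately show ?thesis
    by simp
qed

instantiation l2seq :: (real_inner) real_inner
begin

definition inner_l2seq :: "'a l2seq \<Rightarrow> 'a l2seq \<Rightarrow> real" where
  "inner_l2seq u v = (\<Sum>\<^sub>\<infinity>t. inner (l2_nth u t) (l2_nth v t))"

definition norm_l2seq :: "'a l2seq \<Rightarrow> real" where
  "norm_l2seq u = sqrt (inner u u)"

definition sgn_l2seq :: "'a l2seq \<Rightarrow> 'a l2seq" where
  "sgn_l2seq u = inverse (norm u) *\<^sub>R u"

definition dist_l2seq :: "'a l2seq \<Rightarrow> 'a l2seq \<Rightarrow> real" where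
  "dist_l2seq u v = norm (u - v)"

definition uniformity_l2seq :: "('a l2seq \<times> 'a l2seq) filter" where
  "uniformity_l2seq = (INF e\<in>{0<..}. principal {(u, v). dist u v < e})"

definition open_l2seq :: "'a l2seq set \<Rightarrow> bool" where
  "open_l2seq S \<longleftrightarrow> (\<forall>u\<in>S. \<forall>\<^sub>F (u', v) in uniformity. u' = u \<longrightarrow> v \<in> S)"

instance
proof
  fix u v w :: "'a l2seq" and r :: real
  show "inner u v = inner v u"
    by (simp add: inner_l2seq_def inner_commute)
  show "inner (u + v) w = inner u w + inner v w"
    by (simp add: inner_l2seq_def inner_add_left infsum_add l2_inner_summable)
  show "inner (r *\<^sub>R u) v = r * inner u v"
    by (simp add: inner_l2seq_def infsum_cmult_right')
  show "0 \<le> inner u u"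
    by (simp add: inner_l2seq_def infsum_nonneg)
  show "inner u u = 0 \<longleftrightarrow> u = 0"
  proof
    assume 0: "inner u u = 0"
    have "inner (l2_nth u t) (l2_nth u t) = 0" for t
      by (rule nonneg_infsum_le_0D[where A = UNIV and f = "\<lambda>t. inner (l2_nth u t) (l2_nth u t)"])
        (use 0 in \<open>auto simp: inner_l2seq_def l2_inner_summable\<close>)
    then show "u = 0"
      by (intro l2_eqI) simp
  qed (simp add: inner_l2seq_def)
qed (rule norm_l2seq_def sgn_l2seq_def dist_l2seq_def uniformity_l2seq_def open_l2seq_def)+

end

section \<open>The functional and its critical points\<close>

type_synonym 'n coeff = "int \<Rightarrow> real^'n^'n"
type_synonym 'n potential = "int \<Rightarrow> real^'n \<Rightarrow> real"
type_synonym 'n space = "(real^'n) l2seq"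

text \<open>\<open>bdiff u t\<close> is \<open>\<Delta>u(t-1) = u(t) - u(t-1)\<close>.\<close>

definition bdiff :: "(int \<Rightarrow> 'a::real_vector) \<Rightarrow> int \<Rightarrow> 'a" where
  "bdiff u t = u t - u (t - 1)"

definition inner_star :: "'n::finite coeff \<Rightarrow> 'n space \<Rightarrow> 'n space \<Rightarrow> real" where
  "inner_star L u v =
     (\<Sum>\<^sub>\<infinity>t. inner (bdiff (l2_nth u) t) (bdiff (l2_nth v) t))
     + (\<Sum>\<^sub>\<infinity>t. inner (l2_nth u t) (L t *v l2_nth v t))"

definition norm_star :: "'n::finite coeff \<Rightarrow> 'n space \<Rightarrow> real" where
  "norm_star L u = sqrt (inner_star L u u)"

definition energy :: "'n::finite coeff \<Rightarrow> 'n potential \<Rightarrow> 'n space \<Rightarrow> real" where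
  "energy L V u = (norm_star L u)\<^sup>2 / 2 - (\<Sum>\<^sub>\<infinity>t. V t (l2_nth u t))"

definition dual_norm_deriv :: "'n::finite coeff \<Rightarrow> 'n potential \<Rightarrow> 'n space \<Rightarrow> real" where
  "dual_norm_deriv L V u =
     (SUP h\<in>{h. norm_star L h \<le> 1}. \<bar>frechet_derivative (energy L V) (at u) h\<bar>)"

definition crit :: "'n::finite coeff \<Rightarrow> 'n potential \<Rightarrow> 'n space set" where
  "crit L V = {u. u \<noteq> 0 \<and> (energy L V has_derivative (\<lambda>_. 0)) (at u)}"

definition sublevel :: "'n::finite coeff \<Rightarrow> 'n potential \<Rightarrow> real \<Rightarrow> 'n space set" where
  "sublevel L V b = {u. energy L V u \<le> b}"

definition superlevel :: "'n::finite coeff \<Rightarrow> 'n potential \<Rightarrow> real \<Rightarrow> 'n space set" where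
  "superlevel L V a = {u. energy L V u \<ge> a}"

definition crit_upto :: "'n::finite coeff \<Rightarrow> 'n potential \<Rightarrow> real \<Rightarrow> 'n space set" where
  "crit_upto L V b = crit L V \<inter> sublevel L V b"

definition crit_between :: "'n::finite coeff \<Rightarrow> 'n potential \<Rightarrow> real \<Rightarrow> real \<Rightarrow> 'n space set" where
  "crit_between L V a b = crit L V \<inter> (superlevel L V a \<inter> sublevel L V b)"

definition crit_at :: "'n::finite coeff \<Rightarrow> 'n potential \<Rightarrow> real \<Rightarrow> 'n space set" where
  "crit_at L V b = crit_between L V b b"

section \<open>Neighbourhoods, annuli and Palais--Smale distances\<close>

text \<open>As in the source, these are used only for nonempty \<open>S\<close> (the infimum over the empty set is
  unspecified).\<close>

definition dist_star :: "'n::finite coeff \<Rightarrow> 'n space \<Rightarrow> 'n space set \<Rightarrow> real" where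
  "dist_star L u S = (INF v\<in>S. norm_star L (u - v))"

definition nbhd :: "'n::finite coeff \<Rightarrow> real \<Rightarrow> 'n space set \<Rightarrow> 'n space set" where
  "nbhd L r S = {u. dist_star L u S < r}"

definition annulus :: "'n::finite coeff \<Rightarrow> real \<Rightarrow> real \<Rightarrow> 'n space set \<Rightarrow> 'n space set" where
  "annulus L r1 r2 S = {u. r1 < dist_star L u S \<and> dist_star L u S < r2}"

definition ps_seqs :: "'n::finite coeff \<Rightarrow> 'n potential \<Rightarrow> real \<Rightarrow> (nat \<Rightarrow> 'n space) set" where
  "ps_seqs L V b =
     {u. (\<lambda>k. dual_norm_deriv L V (u k)) \<longlonglongrightarrow> 0 \<and>
         limsup (\<lambda>k. ereal (energy L V (u k))) \<le> ereal b}"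

definition ps_dists :: "'n::finite coeff \<Rightarrow> 'n potential \<Rightarrow> real \<Rightarrow> real set" where
  "ps_dists L V b =
     {\<rho>. \<exists>u\<in>ps_seqs L V b. \<exists>u'\<in>ps_seqs L V b. (\<lambda>k. norm_star L (u k - u' k)) \<longlonglongrightarrow> \<rho>}"

text \<open>\<open>d\<close> and \<open>\<mu>\<close> are a choice of the constants \<open>d\<^sub>r\<close>, \<open>\<mu>\<^sub>r\<close> for all admissible radii \<open>r\<close>, at the
  level \<open>b\<close>.\<close>

definition admissible_radii :: "'n::finite coeff \<Rightarrow> 'n potential \<Rightarrow> real \<Rightarrow> real set" where
  "admissible_radii L V b = {0<..} - ps_dists L V b"

definition slope_constants ::
    "'n::finite coeff \<Rightarrow> 'n potential \<Rightarrow> real \<Rightarrow> (real \<Rightarrow> real) \<Rightarrow> (real \<Rightarrow> real) \<Rightarrow> bool" where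
  "slope_constants L V b d \<mu> \<longleftrightarrow>
     (\<forall>r\<in>admissible_radii L V b.
        d r \<in> {0<..<r / 3} \<and>
        {r - 3 * d r..r + 3 * d r} \<subseteq> {0..} - ps_dists L V b \<and>
        \<mu> r > 0 \<and>
        (\<forall>u\<in>sublevel L V b.
           u \<in> annulus L (r - 3 * d r) (r + 3 * d r) (crit_upto L V b) \<or>
           (\<exists>z\<in>crit_upto L V b. r - 3 * d r < norm_star L (u - z) \<and>
                                   norm_star L (u - z) < r + 3 * d r)
           \<longrightarrow> dual_norm_deriv L V u \<ge> \<mu> r))"

definition drop_const :: "(real \<Rightarrow> real) \<Rightarrow> (real \<Rightarrow> real) \<Rightarrow> real \<Rightarrow> real" where
  "drop_const d \<mu> r = d r * \<mu> r / 4"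

section \<open>Minimax levels and connectibility\<close>

definition minimax ::
    "'n::finite coeff \<Rightarrow> 'n potential \<Rightarrow> (real \<Rightarrow> 'n space) set \<Rightarrow> real" where
  "minimax L V \<Gamma> = (INF \<gamma>\<in>\<Gamma>. SUP s\<in>{0..1}. energy L V (\<gamma> s))"

definition paths_between :: "'a::topological_space \<Rightarrow> 'a \<Rightarrow> (real \<Rightarrow> 'a) set" where
  "paths_between x y = {\<gamma>. path \<gamma> \<and> pathstart \<gamma> = x \<and> pathfinish \<gamma> = y}"

definition connectible ::
    "'n::finite coeff \<Rightarrow> 'n potential \<Rightarrow> real \<Rightarrow> 'n space set \<Rightarrow> 'n space \<Rightarrow> 'n space \<Rightarrow> bool" where
  "connectible L V c \<Omega> x y \<longleftrightarrow>
     (\<exists>p\<in>paths_between x y. path_image p \<subseteq> \<Omega> \<and> (SUP s\<in>{0..1}. energy L V (p s)) < c)"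

section \<open>Multibump neighbourhoods\<close>

text \<open>A tuple \<open>(p\<^sub>1, \<dots>, p\<^sub>k)\<close> is a list of length \<open>k\<close>, so \<open>p\<^sub>i\<close> is \<open>p ! (i - 1)\<close>; below, indices start
  at \<open>0\<close>.\<close>

definition bump_positions :: "nat \<Rightarrow> nat \<Rightarrow> nat \<Rightarrow> int list set" where
  "bump_positions T k N =
     {p. length p = k \<and> (\<forall>i<k. int T dvd p ! i) \<and>
         (\<forall>i. Suc i < k \<longrightarrow> p ! Suc i - p ! i \<ge> 2 * (int N)\<^sup>2 + 4 * int N)}"

text \<open>The midpoint conditions are absent at the two ends, where the neighbouring position is
  infinite.\<close>

definition bump_interval :: "int list \<Rightarrow> nat \<Rightarrow> int set" where
  "bump_interval p i =
     {t. (0 < i \<longrightarrow> (real_of_int (p ! (i - 1)) + real_of_int (p ! i)) / 2 < real_of_int t) \<and>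
         (Suc i < length p \<longrightarrow>
            real_of_int t \<le> (real_of_int (p ! i) + real_of_int (p ! Suc i)) / 2)}"

definition norm_on :: "'n::finite coeff \<Rightarrow> int set \<Rightarrow> (int \<Rightarrow> real^'n) \<Rightarrow> real" where
  "norm_on L F u = sqrt (\<Sum>\<^sub>\<infinity>t\<in>F. (norm (bdiff u t))\<^sup>2 + inner (u t) (L t *v u t))"

definition multibump_nbhd ::
    "'n::finite coeff \<Rightarrow> int list \<Rightarrow> real \<Rightarrow> 'n space \<Rightarrow> 'n space set" where
  "multibump_nbhd L p r v =
     {u. \<forall>i<length p. norm_on L (bump_interval p i) (\<lambda>t. l2_nth u t - l2_nth v (t - p ! i)) < r}"

end

theory Submission
  imports Defs "HOL-Library.Diagonal_Subsequence"
begin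

text \<open>The gradient of the functional in the plain \<open>l\<^sup>2\<close> inner product is a strictly local
  expression, so a sequence may be cut sharply into blocks, one per bump, at the price of an error
  that involves only the values next to the cuts.  Fix a centre \<open>v\<close> close to \<open>vinf\<close>.  Countability of
  the critical set yields level windows just below and just above the local minimax level, free of
  critical points near \<open>v\<close>.  Take the product of translates of a local path as a surface over a cube
  and iterate on it an explicit Euler step of the gradient flow in which a block stops as soon as its
  energy falls below the lower window.  An exponential barrier (a discrete maximum principle) keeps
  the sequence tiny next to the cuts, uniformly in the number of bumps; hence blocks in a window, or
  in the annulus around \<open>v\<close>, really lose energy and never leave the ball.  Without a critical point
  in the invariant set, every point of the cube would finally have a block below the minimax level,
  and a Kuhn labelling argument would produce a path in one block joining the two ends of the local
  path below that level, which is excluded.\<close>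

section \<open>Operators on square-summable sequences\<close>

text \<open>The order of the quantifiers is the obstacle: N must be fixed before the number of
  bumps, while compactness of the whole configuration degenerates as bumps are added. The constants
  are therefore split. Those that fix N (the tolerance of one block for a perturbed gradient, the
  decay factor 1 / (1 + lam / 4) of the barrier) come from a single bump; the lower gradient bound,
  the final step size and the number of steps may depend on the positions, because they serve only a
  contradiction. Since V' is merely continuous, a gradient flow need not have unique trajectories;
  the Euler map is continuous by construction, which is what the covering argument asks for. Windows
  instead of single levels leave room for discrete steps: the lower one carries a continuous ramp
  from motion to rest, the upper one is wider than the possible rise in one step, so a block whose
  gradient is smaller than the cut error cannot climb over it. Leaving the ball is charged against
  energy: \<open>slope\<close> times the excess distance is limited by the drop c4 - c1 that a
  moving block has at its disposal.\<close>

lemma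
  fixes f g :: "'a \<Rightarrow> real"
  assumes "f summable_on A" "g summable_on A"
  shows summable_on_diff_real: "(\<lambda>x. f x - g x) summable_on A"
    and infsum_diff_real: "(\<Sum>\<^sub>\<infinity>x\<in>A. f x - g x) = infsum f A - infsum g A"
proof -
  have g: "(\<lambda>x. - g x) summable_on A" using assms(2) by (simp only: summable_on_uminus)
  show "(\<lambda>x. f x - g x) summable_on A" using summable_on_add[OF assms(1) g] by simp
  show "(\<Sum>\<^sub>\<infinity>x\<in>A. f x - g x) = infsum f A - infsum g A"
    using infsum_add[OF assms(1) g] by (simp add: infsum_uminus)
qed

lemma norm_l2_power2: "(norm u)\<^sup>2 = (\<Sum>\<^sub>\<infinity>t. (norm (l2_nth u t))\<^sup>2)"
  by (simp add: power2_norm_eq_inner inner_l2seq_def)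

lemma norm_l2_nth_le: "norm (l2_nth u t) \<le> norm u"
proof -
  have "(norm (l2_nth u t))\<^sup>2 \<le> (norm u)\<^sup>2"
    using finite_sum_le_infsum[OF l2_nth_summable[of u], of "{t}"] by (simp add: norm_l2_power2)
  then show ?thesis by (rule power2_le_imp_le) simp
qed

lemma norm_l2_mono:
  assumes "\<And>t. norm (l2_nth u t) \<le> norm (l2_nth v t)"
  shows "norm u \<le> norm v"
proof -
  have "(norm u)\<^sup>2 \<le> (norm v)\<^sup>2"
    unfolding norm_l2_power2
    by (intro infsum_mono l2_nth_summable power_mono assms norm_ge_zero)
  then show ?thesis by (rule power2_le_imp_le) simp
qed

lemma summable_dominated_l2:
  assumes "\<And>t. norm (a t) \<le> norm (l2_nth u t)"
  shows "(\<lambda>t. (norm (a t))\<^sup>2) summable_on UNIV"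
  by (rule summable_on_comparison_test[OF l2_nth_summable[of u]]) (simp_all add: assms power_mono)

text \<open>\<open>l2_of\<close> is unspecified outside the square-summable functions, so each
  sequence built from a formula needs a dominating element of the space.\<close>

lemma l2_nth_l2_of:
  assumes "\<And>t. norm (a t) \<le> norm (l2_nth u t)"
  shows "l2_nth (l2_of a) = a"
  using summable_dominated_l2[OF assms] by (intro l2_of_inverse) simp

lemma l2_nth_l2_of_bounded_sums:
  assumes "\<And>F. finite F \<Longrightarrow> (\<Sum>t\<in>F. (norm (a t))\<^sup>2) \<le> B"
  shows "l2_nth (l2_of a) = a"
proof -
  have "(\<lambda>t. (norm (a t))\<^sup>2) summable_on UNIV"
    by (rule nonneg_bdd_above_summable_on) (auto intro!: bdd_aboveI2 assms)
  then show ?thesis by (intro l2_of_inverse) simp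
qed

lemma sum_norm_l2_le: "finite F \<Longrightarrow> (\<Sum>t\<in>F. (norm (l2_nth u t))\<^sup>2) \<le> (norm u)\<^sup>2"
  unfolding norm_l2_power2 by (rule finite_sum_le_infsum[OF l2_nth_summable]) auto

text \<open>Reduces estimates on pointwise norms to the order and the Cauchy-Schwarz inequality in
  the space of real sequences.\<close>

lift_definition l2_abs :: "'a::real_inner l2seq \<Rightarrow> real l2seq" is "\<lambda>u t. norm (u t)"
  by simp

lemma l2_nth_abs [simp]: "l2_nth (l2_abs u) t = norm (l2_nth u t)"
  by (simp add: l2_abs.rep_eq)

lemma norm_l2_abs [simp]: "norm (l2_abs u) = norm u"
  by (intro antisym norm_l2_mono) auto

lemma summable_norm_mult_l2:
  fixes u :: "'a::real_inner l2seq" and v :: "'b::real_inner l2seq"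
  shows "(\<lambda>t. norm (l2_nth u t) * norm (l2_nth v t)) summable_on UNIV"
  using l2_inner_summable[of "l2_abs u" "l2_abs v"] by simp

lemma infsum_norm_mult_l2_le:
  fixes u :: "'a::real_inner l2seq" and v :: "'b::real_inner l2seq"
  shows "(\<Sum>\<^sub>\<infinity>t. norm (l2_nth u t) * norm (l2_nth v t)) \<le> norm u * norm v"
  using norm_cauchy_schwarz[of "l2_abs u" "l2_abs v"] by (simp add: inner_l2seq_def)

section \<open>Sharp cut-offs and translations\<close>

lift_definition l2_restrict :: "int set \<Rightarrow> 'a::real_inner l2seq \<Rightarrow> 'a l2seq"
  is "\<lambda>A u t. if t \<in> A then u t else 0"
proof -
  fix A :: "int set" and u :: "int \<Rightarrow> 'a"
  assume "(\<lambda>t. (norm (u t))\<^sup>2) summable_on UNIV"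
  then show "(\<lambda>t. (norm (if t \<in> A then u t else 0))\<^sup>2) summable_on UNIV"
    by (rule summable_on_comparison_test) auto
qed

lemma l2_nth_restrict [simp]: "l2_nth (l2_restrict A u) t = (if t \<in> A then l2_nth u t else 0)"
  by (simp add: l2_restrict.rep_eq)

lemma bij_betw_diff_int: "bij_betw (\<lambda>t::int. t - p) UNIV UNIV"
  by (rule bij_betw_byWitness[where f' = "\<lambda>t. t + p"]) auto

lift_definition l2_shift :: "int \<Rightarrow> 'a::real_inner l2seq \<Rightarrow> 'a l2seq" is "\<lambda>p u t. u (t - p)"
  by (rule iffD2[OF summable_on_reindex_bij_betw[OF bij_betw_diff_int, where f = "\<lambda>t. (norm (_ t))\<^sup>2"]])

lemma l2_nth_shift [simp]: "l2_nth (l2_shift p u) t = l2_nth u (t - p)"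
  by (simp add: l2_shift.rep_eq)

lemma infsum_shift: "(\<Sum>\<^sub>\<infinity>t. f (t - p :: int)) = (\<Sum>\<^sub>\<infinity>t. f t)"
  by (rule infsum_reindex_bij_betw[OF bij_betw_diff_int])

lemma inner_l2_shift [simp]: "inner (l2_shift p u) (l2_shift p v) = inner u v"
  by (simp add: inner_l2seq_def infsum_shift[of "\<lambda>t. inner (l2_nth u t) (l2_nth v t)"])

lemma norm_l2_shift [simp]: "norm (l2_shift p u) = norm u"
  by (simp add: norm_eq_sqrt_inner)

lemma l2_shift_shift [simp]: "l2_shift p (l2_shift q u) = l2_shift (p + q) u"
  by (rule l2_eqI) (simp add: algebra_simps)

lemma l2_shift_0 [simp]: "l2_shift 0 u = u"
  by (rule l2_eqI) simp

lemma norm_l2_restrict_le: "norm (l2_restrict A u) \<le> norm u"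
  by (rule norm_l2_mono) simp

lemma bounded_linear_l2_restrict: "bounded_linear (l2_restrict A)"
  by (rule bounded_linear_intro[where K = 1])
    (auto intro!: l2_eqI simp: norm_l2_restrict_le)

lemma bounded_linear_l2_shift: "bounded_linear (l2_shift p)"
  by (rule bounded_linear_intro[where K = 1]) (auto intro!: l2_eqI)

lemmas l2_restrict_diff = linear_diff[OF bounded_linear.linear[OF bounded_linear_l2_restrict]]
lemmas l2_shift_diff = linear_diff[OF bounded_linear.linear[OF bounded_linear_l2_shift]]

lemma continuous_on_l2_restrict [continuous_intros]:
  "continuous_on S f \<Longrightarrow> continuous_on S (\<lambda>x. l2_restrict A (f x))"
  by (rule bounded_linear.continuous_on[OF bounded_linear_l2_restrict])

lemma continuous_on_l2_shift [continuous_intros]: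
  "continuous_on S f \<Longrightarrow> continuous_on S (\<lambda>x. l2_shift p (f x))"
  by (rule bounded_linear.continuous_on[OF bounded_linear_l2_shift])

lemma l2_nth_sum: "l2_nth (sum f A) t = (\<Sum>i\<in>A. l2_nth (f i) t)"
  by (induction A rule: infinite_finite_induct) auto

lemma norm_l2_restrict_finite:
  assumes "finite A"
  shows "(norm (l2_restrict A u))\<^sup>2 = (\<Sum>t\<in>A. (norm (l2_nth u t))\<^sup>2)"
proof -
  have "(norm (l2_restrict A u))\<^sup>2 = (\<Sum>\<^sub>\<infinity>t\<in>A. (norm (l2_nth u t))\<^sup>2)"
    unfolding norm_l2_power2 by (rule infsum_cong_neutral) auto
  with assms show ?thesis by simp
qed

text \<open>The triangle inequality over single sites gives the factor \<open>card A\<close> in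
  place of its square root; the supports to which this is applied have at most four sites.\<close>

lemma norm_l2_finite_support_le:
  assumes "finite A" "\<And>t. t \<notin> A \<Longrightarrow> l2_nth u t = 0" "\<And>t. t \<in> A \<Longrightarrow> norm (l2_nth u t) \<le> e"
  shows "norm u \<le> real (card A) * e"
proof -
  have "u = (\<Sum>s\<in>A. l2_restrict {s} u)"
    by (rule l2_eqI) (use assms in \<open>auto simp: l2_nth_sum if_distrib cong: if_cong\<close>)
  then have "norm u \<le> (\<Sum>s\<in>A. norm (l2_restrict {s} u))"
    by (metis norm_sum)
  also have "\<dots> \<le> (\<Sum>s\<in>A. e)"
  proof (rule sum_mono)
    fix s assume "s \<in> A"
    have "(norm (l2_restrict {s} u))\<^sup>2 = (norm (l2_nth u s))\<^sup>2"
      using norm_l2_restrict_finite[of "{s}" u] by simp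
    then show "norm (l2_restrict {s} u) \<le> e"
      using assms(3)[OF \<open>s \<in> A\<close>] by simp
  qed
  finally show ?thesis by simp
qed

lemma norm_l2_restrict_Un:
  "A \<inter> B = {} \<Longrightarrow> (norm (l2_restrict (A \<union> B) u))\<^sup>2 = (norm (l2_restrict A u))\<^sup>2 + (norm (l2_restrict B u))\<^sup>2"
proof -
  assume AB: "A \<inter> B = {}"
  have "(norm (l2_restrict (A \<union> B) u))\<^sup>2
      = (\<Sum>\<^sub>\<infinity>t. (norm (l2_nth (l2_restrict A u) t))\<^sup>2 + (norm (l2_nth (l2_restrict B u) t))\<^sup>2)"
    unfolding norm_l2_power2 by (rule infsum_cong) (use AB in auto)
  also have "\<dots> = (norm (l2_restrict A u))\<^sup>2 + (norm (l2_restrict B u))\<^sup>2"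
    unfolding norm_l2_power2 by (rule infsum_add) (rule l2_nth_summable)+
  finally show ?thesis .
qed

lemma l2_restrict_UNIV [simp]: "l2_restrict UNIV u = u"
  by (rule l2_eqI) simp

lemma l2_tail_small:
  assumes "e > 0"
  shows "\<exists>R::nat. \<forall>R'\<ge>R. norm (l2_restrict {t. \<bar>t\<bar> > int R'} u) < e"
proof -
  obtain F where F: "finite F" "dist (\<Sum>t\<in>F. (norm (l2_nth u t))\<^sup>2) (\<Sum>\<^sub>\<infinity>t. (norm (l2_nth u t))\<^sup>2) \<le> e\<^sup>2 / 2"
    using infsum_finite_approximation[OF l2_nth_summable[of u], of "e\<^sup>2 / 2"] assms by auto
  define R where "R = Max (insert 0 ((\<lambda>t. nat \<bar>t\<bar>) ` F))"
  have R: "\<bar>t\<bar> \<le> int R" if "t \<in> F" for t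
  proof -
    have "nat \<bar>t\<bar> \<le> R" unfolding R_def by (rule Max_ge) (use F that in auto)
    then show ?thesis by linarith
  qed
  show ?thesis
  proof (intro exI allI impI)
    fix R' :: nat assume R': "R' \<ge> R"
    let ?A = "{t. \<bar>t\<bar> > int R'}"
    have "norm (l2_nth (l2_restrict ?A u) t) \<le> norm (l2_nth (l2_restrict (- F) u) t)" for t
      using R[of t] R' by auto
    then have "(norm (l2_restrict ?A u))\<^sup>2 \<le> (norm (l2_restrict (- F) u))\<^sup>2"
      by (intro power_mono norm_l2_mono) auto
    also have "\<dots> = (norm u)\<^sup>2 - (norm (l2_restrict F u))\<^sup>2"
      using norm_l2_restrict_Un[of F "- F" u] by (simp add: Compl_partition)
    also have "\<dots> \<le> e\<^sup>2 / 2"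
      unfolding norm_l2_restrict_finite[OF F(1)] norm_l2_power2[of u]
      using F(2) unfolding dist_real_def by linarith
    also have "\<dots> < e\<^sup>2" using assms by simp
    finally show "norm (l2_restrict ?A u) < e"
      by (rule power2_less_imp_less) (use assms in auto)
  qed
qed

text \<open>Weak sequential compactness of balls in coordinates: a diagonal subsequence settles all
  sites at once, and the bound on finite partial sums survives the limit, so the limit is
  square-summable.\<close>

lemma bounded_l2_pointwise_convergent_subseq:
  fixes u :: "nat \<Rightarrow> 'a::{real_inner, heine_borel} l2seq"
  assumes "\<And>m. norm (u m) \<le> R"
  shows "\<exists>\<phi> v. strict_mono \<phi> \<and> (\<forall>t. (\<lambda>m. l2_nth (u (\<phi> m)) t) \<longlonglongrightarrow> l2_nth v t)"
proof -
  define pt :: "nat \<Rightarrow> int" where "pt = from_nat_into UNIV"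
  define P where "P n s \<longleftrightarrow> convergent (\<lambda>m. l2_nth (u (s m)) (pt n))" for n and s :: "nat \<Rightarrow> nat"
  interpret subseqs P
  proof
    fix n :: nat and s :: "nat \<Rightarrow> nat"
    have "bounded (range (\<lambda>m. l2_nth (u (s m)) (pt n)))"
      unfolding bounded_iff by (rule exI[of _ R]) (use assms norm_l2_nth_le order_trans in blast)
    from bounded_imp_convergent_subsequence[OF this]
    show "\<exists>r. strict_mono r \<and> P n (s \<circ> r)"
      unfolding P_def convergent_def comp_def by blast
  qed
  have conv: "convergent (\<lambda>m. l2_nth (u (diagseq m)) t)" for t
  proof -
    obtain n where n: "pt n = t"
      by (metis UNIV_I UNIV_not_empty countableI_type from_nat_into_surj pt_def)
    \<comment> \<open>From index \<open>Suc n\<close> on, the diagonal sequence is a subsequence of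
      the one selected for site \<open>pt n\<close>; the initial segment does not affect
      convergence.\<close>
    have "P n (diagseq \<circ> (+) (Suc n))"
    proof (rule diagseq_holds)
      fix n s and r :: "nat \<Rightarrow> nat"
      assume r: "strict_mono r" and P: "P n s"
      then show "P n (s \<circ> r)"
        using convergent_subseq_convergent[OF _ r, of "\<lambda>m. l2_nth (u (s m)) (pt n)"]
        by (simp add: P_def comp_def)
    qed
    then have "convergent (\<lambda>m. l2_nth (u (diagseq (m + Suc n))) t)"
      by (simp add: P_def n comp_def add.commute)
    then show ?thesis
      using convergent_ignore_initial_segment[of "\<lambda>m. l2_nth (u (diagseq m)) t"] by blast
  qed
  define a where "a t = lim (\<lambda>m. l2_nth (u (diagseq m)) t)" for t
  have a: "(\<lambda>m. l2_nth (u (diagseq m)) t) \<longlonglongrightarrow> a t" for t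
    using conv by (simp add: a_def convergent_LIMSEQ_iff)
  have "(\<Sum>t\<in>F. (norm (a t))\<^sup>2) \<le> R\<^sup>2" if "finite F" for F
  proof (rule LIMSEQ_le_const2)
    show "(\<lambda>m. \<Sum>t\<in>F. (norm (l2_nth (u (diagseq m)) t))\<^sup>2) \<longlonglongrightarrow> (\<Sum>t\<in>F. (norm (a t))\<^sup>2)"
      by (intro tendsto_intros a)
    have "(\<Sum>t\<in>F. (norm (l2_nth (u (diagseq m)) t))\<^sup>2) \<le> R\<^sup>2" for m
      using sum_norm_l2_le[OF that, of "u (diagseq m)"] assms[of "diagseq m"]
      by (meson norm_ge_zero order_trans power_mono)
    then show "\<exists>N. \<forall>n\<ge>N. (\<Sum>t\<in>F. (norm (l2_nth (u (diagseq n)) t))\<^sup>2) \<le> R\<^sup>2" by blast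
  qed
  from l2_nth_l2_of_bounded_sums[of a, OF this] a subseq_diagseq show ?thesis by metis
qed

text \<open>Substitute for a Lipschitz estimate, which a continuous F need not satisfy. For small x
  and y superlinearity suffices, for small y alone uniform continuity, for large y boundedness. The
  error is \<open>e * norm x\<close> rather than a constant so that it can be squared and summed
  over all sites.\<close>

lemma superlinear_modulus:
  fixes F :: "'a::euclidean_space \<Rightarrow> 'b::real_normed_vector"
  assumes cont: "continuous_on UNIV F" and F0: "F 0 = 0"
    and small: "(\<lambda>x. norm (F x)) \<in> o[at 0](\<lambda>x. norm x)" and "e > 0"
  shows "\<exists>C\<ge>0. \<forall>x y. norm x \<le> R \<longrightarrow> norm y \<le> R \<longrightarrow>
    norm (F (x + y) - F x) \<le> e * (norm x + norm y) + C * norm y"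
proof -
  have "eventually (\<lambda>x. norm (norm (F x)) \<le> e / 2 * norm (norm x)) (at 0)"
    using landau_o.smallD[OF small, of "e / 2"] \<open>e > 0\<close> by simp
  then obtain D where D: "D > 0" "\<And>x. x \<noteq> 0 \<Longrightarrow> dist x 0 < D \<Longrightarrow> norm (norm (F x)) \<le> e / 2 * norm (norm x)"
    unfolding eventually_at by auto
  have D': "norm (F x) \<le> e / 2 * norm x" if "norm x < D" for x
    using D(2)[of x] F0 that by (cases "x = 0") auto
  have "uniformly_continuous_on (cball 0 (2 * R)) F"
    by (rule compact_uniformly_continuous) (rule continuous_on_subset[OF cont subset_UNIV] compact_cball)+
  moreover have "e * D > 0" using \<open>e > 0\<close> \<open>D > 0\<close> by simp
  ultimately have "\<exists>N>0. \<forall>x\<in>cball 0 (2*R). \<forall>y\<in>cball 0 (2*R). dist y x < N \<longrightarrow> dist (F y) (F x) < e * D"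
    unfolding uniformly_continuous_on_def by blast
  then obtain N where N: "N > 0"
    "\<And>x y. x \<in> cball 0 (2*R) \<Longrightarrow> y \<in> cball 0 (2*R) \<Longrightarrow> dist y x < N \<Longrightarrow> dist (F y) (F x) < e * D"
    by blast
  have "compact (F ` cball 0 (2 * R))"
    by (rule compact_continuous_image) (rule continuous_on_subset[OF cont subset_UNIV] compact_cball)+
  then obtain M where M: "\<And>x. x \<in> cball 0 (2*R) \<Longrightarrow> norm (F x) \<le> M"
    using bounded_iff[THEN iffD1, OF compact_imp_bounded] by fast
  \<comment> \<open>At \<open>norm y = N\<close> the term \<open>C * norm y\<close> equals twice the
    bound \<open>\<bar>M\<bar>\<close> on F.\<close>
  define C where "C = 2 * \<bar>M\<bar> / N"
  show ?thesis
  proof (intro exI[of _ C] conjI allI impI)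
    show "C \<ge> 0" using N by (simp add: C_def)
    fix x y :: 'a assume xy: "norm x \<le> R" "norm y \<le> R"
    have tri: "norm (x + y) \<le> norm x + norm y" by (rule norm_triangle_ineq)
    have in_ball: "x \<in> cball 0 (2*R)" "x + y \<in> cball 0 (2*R)"
      using xy tri norm_ge_zero[of x] norm_ge_zero[of y] unfolding mem_cball_0 by linarith+
    consider "norm x + norm y < D" | "norm x + norm y \<ge> D" "norm y < N" | "norm y \<ge> N" by linarith
    then show "norm (F (x + y) - F x) \<le> e * (norm x + norm y) + C * norm y"
    proof cases
      case 1
      have "norm (F (x + y) - F x) \<le> norm (F (x + y)) + norm (F x)" by (rule norm_triangle_ineq4)
      also have "\<dots> \<le> e / 2 * norm (x + y) + e / 2 * norm x"
        using 1 tri by (intro add_mono D') (auto intro: le_less_trans[OF _ 1])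
      also have "\<dots> \<le> e / 2 * (norm x + norm y) + e / 2 * norm x"
        using tri \<open>e > 0\<close> by (intro add_mono mult_left_mono) auto
      also have "\<dots> = e * norm x + e / 2 * norm y" by (simp add: field_simps)
      also have "\<dots> \<le> e * (norm x + norm y) + C * norm y"
        using \<open>e > 0\<close> \<open>C \<ge> 0\<close> by (simp add: field_simps add_nonneg_nonneg)
      finally show ?thesis .
    next
      case 2
      have "norm (F (x + y) - F x) < e * D"
        using N(2)[OF in_ball] 2 by (simp add: dist_norm)
      also have "\<dots> \<le> e * (norm x + norm y)" using 2 \<open>e > 0\<close> by simp
      also have "\<dots> \<le> \<dots> + C * norm y" using \<open>C \<ge> 0\<close> by simp
      finally show ?thesis by simp
    next
      case 3
      have "norm (F (x + y) - F x) \<le> norm (F (x + y)) + norm (F x)" by (rule norm_triangle_ineq4)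
      also have "\<dots> \<le> 2 * \<bar>M\<bar>" using M[OF in_ball(1)] M[OF in_ball(2)] by linarith
      also have "\<dots> = C * N" using N by (simp add: C_def)
      also have "\<dots> \<le> C * norm y" using 3 \<open>C \<ge> 0\<close> by (rule mult_left_mono)
      also have "\<dots> \<le> e * (norm x + norm y) + C * norm y" using \<open>e > 0\<close> by simp
      finally show ?thesis .
    qed
  qed
qed

section \<open>The functional and its gradient\<close>

lemma periodic_dvd:
  assumes per: "\<And>t::int. f (t + int T) = f t" and "int T dvd p"
  shows "f (t + p) = f t"
proof -
  have nat: "f (t + int n * int T) = f t" for n t
  proof (induction n)
    case (Suc n)
    have "f (t + int (Suc n) * int T) = f ((t + int n * int T) + int T)" by (simp add: algebra_simps)
    then show ?case using Suc by (simp add: per)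
  qed simp
  obtain m where m: "p = int T * m" using assms by blast
  show ?thesis
  proof (cases "m \<ge> 0")
    case True
    then show ?thesis using nat[of t "nat m"] by (simp add: m mult.commute)
  next
    case False
    then show ?thesis using nat[of "t + p" "nat (- m)"] by (simp add: m mult.commute)
  qed
qed

lemma periodic_mod:
  assumes "\<And>t::int. f (t + int T) = f t"
  shows "f (t mod int T) = f t"
  using periodic_dvd[of f T "- (int T * (t div int T))" t, OF assms]
  by (simp add: minus_mult_div_eq_mod)

text \<open>One constant for all t is the maximum over a single period; monotonicity in C permits
  the enlargement.\<close>

lemma periodic_uniform:
  assumes "T > 0" and ex: "\<And>t::int. \<exists>C\<ge>0. P t C"
    and mono: "\<And>t C C'. P t C \<Longrightarrow> 0 \<le> C \<Longrightarrow> C \<le> C' \<Longrightarrow> P t C'"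
    and per: "\<And>t C. P (t + int T) C = P t C"
  shows "\<exists>C\<ge>0::real. \<forall>t. P t C"
proof -
  obtain c where c: "\<And>t. c t \<ge> 0" "\<And>t. P t (c t)" using ex by metis
  define C where "C = Max (c ` {0..<int T})"
  have le: "c t \<le> C" if "t \<in> {0..<int T}" for t
    unfolding C_def by (rule Max_ge) (use that in auto)
  have "P t C" for t
  proof -
    have t: "t mod int T \<in> {0..<int T}" using \<open>T > 0\<close> by simp
    from mono[OF c(2) c(1) le[OF t]] show ?thesis
      using periodic_mod[of "\<lambda>t. P t C" T t, OF per] by simp
  qed
  moreover have "C \<ge> 0" using le[of 0] c(1)[of 0] \<open>T > 0\<close> by force
  ultimately show ?thesis by blast
qed

locale lattice_equation =
  fixes L :: "int \<Rightarrow> real^'n^'n"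
    and V :: "int \<Rightarrow> real^'n \<Rightarrow> real"
    and V' :: "int \<Rightarrow> real^'n \<Rightarrow> real^'n"
    and T :: nat
  assumes V_deriv: "\<And>t x. GDERIV (V t) x :> V' t x"
    and V'_cont: "\<And>t. continuous_on UNIV (V' t)"
    and V'_0: "\<And>t. V' t 0 = 0"
    and T_pos: "T > 0"
    and L_per: "\<And>t. L (t + int T) = L t"
    and V_per: "\<And>t. V (t + int T) = V t"
    and L_sym: "\<And>t. transpose (L t) = L t"
    and L_pos: "\<And>t x. x \<noteq> 0 \<Longrightarrow> inner x (L t *v x) > 0"
    and V_0: "\<And>t. V t 0 = 0"
    and V'_small: "\<And>t. (\<lambda>x. norm (V' t x)) \<in> o[at 0](\<lambda>x. norm x)"
begin

abbreviation f :: "'n space \<Rightarrow> real" where "f \<equiv> energy L V"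
abbreviation nrm :: "'n space \<Rightarrow> real" where "nrm \<equiv> norm_star L"

lemma V'_per: "V' (t + int T) = V' t"
proof
  fix x
  have "inner h (V' (t + int T) x) = inner h (V' t x)" for h
    using has_derivative_unique[OF V_deriv[of "t + int T" x, unfolded gderiv_def V_per]
        V_deriv[of t x, unfolded gderiv_def]] by (rule fun_cong)
  then show "V' (t + int T) x = V' t x" using vector_eq_ldot by blast
qed

lemma inner_L_nonneg: "inner x (L t *v x) \<ge> 0"
  using L_pos[of x t] by (cases "x = 0") auto

text \<open>At each t the form has a positive minimum on the unit sphere. The constant stands on the
  right, so that enlarging it weakens the claim, as \<open>periodic_uniform\<close>
  requires.\<close>

lemma L_coercive: "\<exists>C\<ge>0. \<forall>t x. (norm x)\<^sup>2 \<le> C * inner x (L t *v x)"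
proof (rule periodic_uniform[OF T_pos])
  fix t :: int
  have "continuous_on (sphere 0 1) (\<lambda>x. inner x (L t *v x))"
    by (intro continuous_intros linear_continuous_on linear_conv_bounded_linear[THEN iffD1]
        matrix_vector_mul_linear)
  moreover have "sphere (0::real^'n) 1 \<noteq> {}" by simp
  ultimately obtain z where z: "z \<in> sphere 0 1"
    "\<And>x. x \<in> sphere 0 1 \<Longrightarrow> inner z (L t *v z) \<le> inner x (L t *v x)"
    using continuous_attains_inf[OF compact_sphere] by meson
  define m where "m = inner z (L t *v z)"
  have "m > 0" unfolding m_def by (rule L_pos) (use z in auto)
  have "(norm x)\<^sup>2 \<le> 1 / m * inner x (L t *v x)" for x
  proof (cases "x = 0")
    case False
    have "m \<le> inner (x /\<^sub>R norm x) (L t *v (x /\<^sub>R norm x))"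
      unfolding m_def by (rule z) (use False in simp)
    also have "\<dots> = inner x (L t *v x) / (norm x)\<^sup>2"
      by (simp add: matrix_vector_mult_scaleR power2_eq_square divide_simps)
    finally show ?thesis using \<open>m > 0\<close> False by (simp add: field_simps)
  qed auto
  then show "\<exists>C\<ge>0. \<forall>x. (norm x)\<^sup>2 \<le> C * inner x (L t *v x)"
    using \<open>m > 0\<close> by (intro exI[of _ "1 / m"]) auto
next
  fix t C C' assume "\<forall>x. (norm x)\<^sup>2 \<le> C * inner x (L t *v x)" "0 \<le> C" "C \<le> (C'::real)"
  then show "\<forall>x. (norm x)\<^sup>2 \<le> C' * inner x (L t *v x)"
    by (meson inner_L_nonneg mult_right_mono order_trans)
qed (simp add: L_per)

lemma L_bounded: "\<exists>C\<ge>0. \<forall>t x. norm (L t *v x) \<le> C * norm x"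
proof (rule periodic_uniform[OF T_pos])
  fix t :: int
  have "bounded_linear ((*v) (L t))" by (rule matrix_vector_mul_bounded_linear)
  from bounded_linear.nonneg_bounded[OF this] show "\<exists>C\<ge>0. \<forall>x. norm (L t *v x) \<le> C * norm x"
    by (metis mult.commute)
next
  fix t C C' assume "\<forall>x. norm (L t *v x) \<le> C * norm x" "0 \<le> C" "C \<le> (C'::real)"
  then show "\<forall>x. norm (L t *v x) \<le> C' * norm x"
    by (meson norm_ge_zero mult_right_mono order_trans)
qed (simp add: L_per)

definition lam :: real where
  "lam = (SOME l. l > 0 \<and> (\<forall>t x. l * (norm x)\<^sup>2 \<le> inner x (L t *v x)))"

lemma lam_pos: "lam > 0" and lam_le: "lam * (norm x)\<^sup>2 \<le> inner x (L t *v x)"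
proof -
  obtain C where C: "C \<ge> 0" "\<And>t x. (norm x)\<^sup>2 \<le> C * inner x (L t *v x)" using L_coercive by blast
  have "1 / (C + 1) * (norm x)\<^sup>2 \<le> inner x (L t *v x)" for t x
  proof -
    have "(norm x)\<^sup>2 \<le> (C + 1) * inner x (L t *v x)"
      using C(2)[of x t] inner_L_nonneg[of x t] by (simp add: algebra_simps)
    then show ?thesis using C(1) by (simp add: field_simps)
  qed
  then have "1 / (C + 1) > 0 \<and> (\<forall>t x. 1 / (C + 1) * (norm x)\<^sup>2 \<le> inner x (L t *v x))"
    using C(1) by simp
  from someI[of "\<lambda>l. l > 0 \<and> (\<forall>t x. l * (norm x)\<^sup>2 \<le> inner x (L t *v x))", OF this]
  show "lam > 0" "lam * (norm x)\<^sup>2 \<le> inner x (L t *v x)" unfolding lam_def by blast+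
qed

definition Lam0 :: real where
  "Lam0 = (SOME C. C \<ge> 0 \<and> (\<forall>t x. norm (L t *v x) \<le> C * norm x))"

lemma Lam0_nonneg: "Lam0 \<ge> 0" and norm_L_le: "norm (L t *v x) \<le> Lam0 * norm x"
proof -
  obtain C where "C \<ge> 0 \<and> (\<forall>t x. norm (L t *v x) \<le> C * norm x)" using L_bounded by blast
  from someI[of "\<lambda>C. C \<ge> 0 \<and> (\<forall>t x. norm (L t *v x) \<le> C * norm x)", OF this]
  show "Lam0 \<ge> 0" "norm (L t *v x) \<le> Lam0 * norm x" unfolding Lam0_def by blast+
qed

text \<open>Will bound the operator norm of \<open>lin\<close>: 4 for the second difference,
  \<open>Lam0\<close> for multiplication by L.\<close>

definition Lam :: real where "Lam = 4 + Lam0"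

lemma Lam_pos: "Lam > 0"
  using Lam0_nonneg by (simp add: Lam_def)

lemma V'_modulus:
  assumes "e > 0"
  shows "\<exists>C\<ge>0. \<forall>t x y. norm x \<le> R \<longrightarrow> norm y \<le> R \<longrightarrow>
    norm (V' t (x + y) - V' t x) \<le> e * (norm x + norm y) + C * norm y"
proof (rule periodic_uniform[OF T_pos])
  fix t show "\<exists>C\<ge>0. \<forall>x y. norm x \<le> R \<longrightarrow> norm y \<le> R \<longrightarrow>
    norm (V' t (x + y) - V' t x) \<le> e * (norm x + norm y) + C * norm y"
    by (rule superlinear_modulus[OF V'_cont V'_0 V'_small assms])
next
  fix t C C' assume *: "\<forall>x y. norm x \<le> R \<longrightarrow> norm y \<le> R \<longrightarrow>
    norm (V' t (x + y) - V' t x) \<le> e * (norm x + norm y) + C * norm y" "0 \<le> C" "C \<le> (C'::real)"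
  show "\<forall>x y. norm x \<le> R \<longrightarrow> norm y \<le> R \<longrightarrow>
    norm (V' t (x + y) - V' t x) \<le> e * (norm x + norm y) + C' * norm y"
  proof (intro allI impI)
    fix x y :: "real^'n" assume "norm x \<le> R" "norm y \<le> R"
    then have "norm (V' t (x + y) - V' t x) \<le> e * (norm x + norm y) + C * norm y" using * by blast
    also have "\<dots> \<le> e * (norm x + norm y) + C' * norm y"
      using *(3) by (intro add_left_mono mult_right_mono) auto
    finally show "norm (V' t (x + y) - V' t x) \<le> e * (norm x + norm y) + C' * norm y" .
  qed
qed (simp add: V'_per)

lemma V'_linear_bound: "\<exists>C\<ge>0. \<forall>t x. norm x \<le> R \<longrightarrow> norm (V' t x) \<le> C * norm x"
proof (cases "R \<ge> 0")
  case True
  obtain C where C: "C \<ge> 0" "\<And>t x y. norm x \<le> R \<Longrightarrow> norm y \<le> R \<Longrightarrow>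
    norm (V' t (x + y) - V' t x) \<le> 1 * (norm x + norm y) + C * norm y"
    using V'_modulus[of 1 R] by auto
  have "norm (V' t x) \<le> (1 + C) * norm x" if "norm x \<le> R" for t x
    using C(2)[of 0 x t] that True by (simp add: V'_0 algebra_simps)
  then show ?thesis using C(1) by (intro exI[of _ "1 + C"]) auto
next
  case False
  then show ?thesis by (intro exI[of _ 0]) (auto dest: order_trans[OF norm_ge_zero])
qed

lemma V'_small_uniform:
  assumes "e > 0"
  shows "\<exists>s>0. \<forall>t x. norm x \<le> s \<longrightarrow> norm (V' t x) \<le> e * norm x"
proof -
  \<comment> \<open>The radius is encoded as 1 / (C + 1), which turns shrinking radii into growing
    constants and lets \<open>periodic_uniform\<close> pick a common one.\<close>
  have "\<exists>C\<ge>0. \<forall>t x. norm x \<le> 1 / (C + 1) \<longrightarrow> norm (V' t x) \<le> e * norm x"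
  proof (rule periodic_uniform[OF T_pos])
    fix t
    have "eventually (\<lambda>x. norm (norm (V' t x)) \<le> e * norm (norm x)) (at 0)"
      using landau_o.smallD[OF V'_small assms] .
    then obtain D where D: "D > 0"
      "\<And>x. x \<noteq> 0 \<Longrightarrow> dist x 0 < D \<Longrightarrow> norm (norm (V' t x)) \<le> e * norm (norm x)"
      unfolding eventually_at by auto
    have "norm (V' t x) \<le> e * norm x" if x: "norm x \<le> 1 / (1 / D + 1)" for x
    proof -
      have "1 / (1 / D + 1) < D" using D(1) by (simp add: field_simps)
      with x have "norm x < D" by linarith
      then show ?thesis using D(2)[of x] V'_0 by (cases "x = 0") auto
    qed
    then show "\<exists>C\<ge>0. \<forall>x. norm x \<le> 1 / (C + 1) \<longrightarrow> norm (V' t x) \<le> e * norm x"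
      using D(1) by (intro exI[of _ "1 / D"]) auto
  next
    fix t C C' assume *: "\<forall>x. norm x \<le> 1 / (C + 1) \<longrightarrow> norm (V' t x) \<le> e * norm x" "0 \<le> C" "C \<le> (C'::real)"
    have "1 / (C' + 1) \<le> 1 / (C + 1)" using *(2,3) by (intro divide_left_mono) auto
    then show "\<forall>x. norm x \<le> 1 / (C' + 1) \<longrightarrow> norm (V' t x) \<le> e * norm x"
      using *(1) by auto
  qed (simp add: V'_per)
  then obtain C where "C \<ge> 0" "\<forall>t x. norm x \<le> 1 / (C + 1) \<longrightarrow> norm (V' t x) \<le> e * norm x" by blast
  then show ?thesis by (intro exI[of _ "1 / (C + 1)"]) auto
qed

lemma V_mvt: "\<exists>\<xi>\<in>{0..1}. V t (x + h) - V t x = inner h (V' t (x + \<xi> *\<^sub>R h))"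
proof -
  have D: "((\<lambda>s. V t (x + s *\<^sub>R h)) has_real_derivative inner h (V' t (x + s *\<^sub>R h))) (at s)" for s
  proof -
    have "((\<lambda>s. x + s *\<^sub>R h) has_derivative (\<lambda>s. s *\<^sub>R h)) (at s)"
      by (auto intro!: derivative_eq_intros)
    from diff_chain_at[OF this V_deriv[of t, unfolded gderiv_def]]
    have "((\<lambda>s. V t (x + s *\<^sub>R h)) has_derivative (\<lambda>r. r * inner h (V' t (x + s *\<^sub>R h)))) (at s)"
      by (simp add: comp_def)
    then show ?thesis by (simp add: has_field_derivative_def mult_commute_abs)
  qed
  from MVT2[OF zero_less_one D] obtain \<xi> where "0 < \<xi>" "\<xi> < 1"
    "V t (x + 1 *\<^sub>R h) - V t (x + 0 *\<^sub>R h) = (1 - 0) * inner h (V' t (x + \<xi> *\<^sub>R h))" by blast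
  then show ?thesis by (intro bexI[of _ \<xi>]) auto
qed

lemma V_quadratic_bound:
  shows "\<exists>C\<ge>0. \<forall>t x. norm x \<le> R \<longrightarrow> \<bar>V t x\<bar> \<le> C * (norm x)\<^sup>2"
proof -
  obtain C where C: "C \<ge> 0" "\<And>t x. norm x \<le> R \<Longrightarrow> norm (V' t x) \<le> C * norm x"
    using V'_linear_bound by blast
  have "\<bar>V t x\<bar> \<le> C * (norm x)\<^sup>2" if x: "norm x \<le> R" for t x
  proof -
    obtain \<xi> where \<xi>: "\<xi> \<in> {0..1}" "V t x = inner x (V' t (\<xi> *\<^sub>R x))"
      using V_mvt[of t 0 x] by (auto simp: V_0)
    have le: "norm (\<xi> *\<^sub>R x) \<le> norm x" using \<xi>(1) by (simp add: mult_left_le_one_le)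
    have "\<bar>V t x\<bar> \<le> norm x * norm (V' t (\<xi> *\<^sub>R x))" unfolding \<xi>(2) by (rule Cauchy_Schwarz_ineq2)
    also have "\<dots> \<le> norm x * (C * norm (\<xi> *\<^sub>R x))" using le x by (intro mult_left_mono C) auto
    also have "\<dots> \<le> norm x * (C * norm x)" using le C(1) by (intro mult_left_mono) auto
    finally show ?thesis by (simp add: power2_eq_square algebra_simps)
  qed
  then show ?thesis using C(1) by blast
qed

lemma V_summable: "(\<lambda>t. V t (l2_nth u t)) summable_on UNIV"
proof -
  obtain C where C: "C \<ge> 0" "\<And>t x. norm x \<le> norm u \<Longrightarrow> \<bar>V t x\<bar> \<le> C * (norm x)\<^sup>2"
    using V_quadratic_bound by blast
  have "(\<lambda>t. \<bar>V t (l2_nth u t)\<bar>) summable_on UNIV"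
    by (rule summable_on_comparison_test[OF summable_on_cmult_right[OF l2_nth_summable[of u], of C]])
      (auto intro: C norm_l2_nth_le)
  then show ?thesis
    using summable_on_iff_abs_summable_on_real[of "\<lambda>t. V t (l2_nth u t)" UNIV] by simp
qed

text \<open>\<open>nem\<close> is the superposition (Nemytskii) operator of V', and
  \<open>lin\<close> represents the star product with respect to the plain one. The gradient for the
  star product itself would carry the inverse of \<open>lin\<close>, which couples all
  sites.\<close>

definition Lmul :: "'n space \<Rightarrow> 'n space" where "Lmul u = l2_of (\<lambda>t. L t *v l2_nth u t)"
definition nem :: "'n space \<Rightarrow> 'n space" where "nem u = l2_of (\<lambda>t. V' t (l2_nth u t))"
definition lin :: "'n space \<Rightarrow> 'n space" where
  "lin u = 2 *\<^sub>R u - l2_shift 1 u - l2_shift (- 1) u + Lmul u"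
definition grad :: "'n space \<Rightarrow> 'n space" where "grad u = lin u - nem u"

lemma l2_nth_Lmul [simp]: "l2_nth (Lmul u) t = L t *v l2_nth u t"
proof -
  have "l2_nth (Lmul u) = (\<lambda>t. L t *v l2_nth u t)"
    unfolding Lmul_def by (rule l2_nth_l2_of[where u = "Lam0 *\<^sub>R u"]) (simp add: norm_L_le Lam0_nonneg)
  then show ?thesis by simp
qed

lemma l2_nth_nem [simp]: "l2_nth (nem u) t = V' t (l2_nth u t)"
proof -
  obtain C where C: "C \<ge> 0" "\<And>t x. norm x \<le> norm u \<Longrightarrow> norm (V' t x) \<le> C * norm x"
    using V'_linear_bound by blast
  have "l2_nth (nem u) = (\<lambda>t. V' t (l2_nth u t))"
    unfolding nem_def by (rule l2_nth_l2_of[where u = "C *\<^sub>R u"]) (use C norm_l2_nth_le in auto)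
  then show ?thesis by simp
qed

lemma l2_nth_grad: "l2_nth (grad u) t = 2 *\<^sub>R l2_nth u t - l2_nth u (t - 1) - l2_nth u (t + 1)
    + L t *v l2_nth u t - V' t (l2_nth u t)"
  by (simp add: grad_def lin_def)

lemma lin_add: "lin (u + v) = lin u + lin v"
  by (rule l2_eqI) (simp add: lin_def algebra_simps matrix_vector_right_distrib)

lemma lin_scaleR: "lin (c *\<^sub>R u) = c *\<^sub>R lin u"
  by (rule l2_eqI) (simp add: lin_def algebra_simps matrix_vector_mult_scaleR)

lemma lin_diff: "lin (u - v) = lin u - lin v"
  by (rule l2_eqI) (simp add: lin_def algebra_simps matrix_vector_mult_diff_distrib)

lemma norm_lin_le: "norm (lin u) \<le> Lam * norm u"
proof -
  have "norm (Lmul u) \<le> norm (Lam0 *\<^sub>R u)"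
    by (rule norm_l2_mono) (simp add: norm_L_le Lam0_nonneg)
  then have "norm (Lmul u) \<le> Lam0 * norm u" by (simp add: Lam0_nonneg)
  moreover have "norm (lin u) \<le> norm (2 *\<^sub>R u) + norm (l2_shift 1 u) + norm (l2_shift (-1) u) + norm (Lmul u)"
    unfolding lin_def by norm
  ultimately show ?thesis by (simp add: Lam_def algebra_simps)
qed

lemma inner_L_adjoint: "inner x (L t *v y) = inner (L t *v x) y"
  by (metis L_sym dot_lmul_matrix transpose_matrix_vector)

section \<open>The star product as a bounded coercive form\<close>

lemma inner_star_eq: "inner_star L u v = inner (lin u) v"
proof -
  have 1: "inner_star L u v = inner (u - l2_shift 1 u) (v - l2_shift 1 v) + inner u (Lmul v)"
    by (simp add: inner_star_def inner_l2seq_def bdiff_def)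
  \<comment> \<open>Summation by parts, in the form that translation is an isometry.\<close>
  have 2: "inner u (l2_shift 1 v) = inner (l2_shift (- 1) u) v"
    using inner_l2_shift[of "-1" u "l2_shift 1 v"] by simp
  have 3: "inner u (Lmul v) = inner (Lmul u) v"
    unfolding inner_l2seq_def l2_nth_Lmul
    by (rule infsum_cong) (rule inner_L_adjoint)
  show ?thesis
    unfolding 1 lin_def inner_diff_left inner_diff_right inner_add_left inner_scaleR_left inner_l2_shift 2 3
    by simp
qed

lemma inner_lin_commute: "inner (lin u) v = inner (lin v) u"
  unfolding inner_star_eq[symmetric] inner_star_def
  by (intro arg_cong2[where f = "(+)"] infsum_cong, rule inner_commute)
    (metis inner_L_adjoint inner_commute)

lemma inner_lin_ge: "lam * (norm u)\<^sup>2 \<le> inner (lin u) u"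
proof -
  have "lam * (norm u)\<^sup>2 = (\<Sum>\<^sub>\<infinity>t. lam * (norm (l2_nth u t))\<^sup>2)"
    by (simp add: norm_l2_power2 infsum_cmult_right')
  also have "\<dots> \<le> (\<Sum>\<^sub>\<infinity>t. inner (l2_nth u t) (l2_nth (Lmul u) t))"
  proof (rule infsum_mono)
    show "lam * (norm (l2_nth u t))\<^sup>2 \<le> inner (l2_nth u t) (l2_nth (Lmul u) t)" for t
      unfolding l2_nth_Lmul by (rule lam_le)
  qed (intro summable_on_cmult_right l2_nth_summable l2_inner_summable)+
  also have "\<dots> = inner (lin u) u - (norm (u - l2_shift 1 u))\<^sup>2"
    unfolding inner_star_eq[symmetric] inner_star_def norm_l2_power2 bdiff_def
    by (simp add: power2_norm_eq_inner)
  finally show ?thesis using zero_le_power2[of "norm (u - l2_shift 1 u)"] by linarith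
qed

lemma inner_lin_nonneg: "0 \<le> inner (lin u) u"
proof -
  have "0 \<le> lam * (norm u)\<^sup>2" using lam_pos by simp
  then show ?thesis using inner_lin_ge order_trans by blast
qed

lemma nrm_power2: "(nrm u)\<^sup>2 = inner (lin u) u"
  by (simp add: norm_star_def inner_star_eq inner_lin_nonneg)

lemma nrm_nonneg [simp]: "nrm u \<ge> 0"
  by (simp add: norm_star_def inner_star_eq inner_lin_nonneg)

lemma nrm_le: "nrm u \<le> sqrt Lam * norm u"
proof -
  have "(nrm u)\<^sup>2 \<le> norm (lin u) * norm u" unfolding nrm_power2 by (rule norm_cauchy_schwarz)
  also have "\<dots> \<le> Lam * norm u * norm u" by (intro mult_right_mono norm_lin_le) auto
  also have "\<dots> = (sqrt Lam * norm u)\<^sup>2" using Lam_pos by (simp add: power_mult_distrib power2_eq_square)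
  finally show ?thesis by (rule power2_le_imp_le) (use Lam_pos in auto)
qed

lemma nrm_ge: "sqrt lam * norm u \<le> nrm u"
proof (rule power2_le_imp_le)
  show "(sqrt lam * norm u)\<^sup>2 \<le> (nrm u)\<^sup>2"
    using inner_lin_ge[of u] lam_pos by (simp add: power_mult_distrib nrm_power2)
qed simp

lemma inner_lin_Cauchy_Schwarz: "inner (lin u) v \<le> nrm u * nrm v"
proof (cases "v = 0")
  case False
  define a b c where "a = inner (lin u) u" and "b = inner (lin u) v" and "c = inner (lin v) v"
  have "c > 0"
  proof -
    have "0 < lam * (norm v)\<^sup>2" using lam_pos False by simp
    then show ?thesis unfolding c_def using inner_lin_ge less_le_trans by blast
  qed
  \<comment> \<open>The vector c u - b v is c times the part of u orthogonal to v, so its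
    nonnegative square gives the discriminant inequality without a division.\<close>
  have "0 \<le> inner (lin (c *\<^sub>R u - b *\<^sub>R v)) (c *\<^sub>R u - b *\<^sub>R v)"
    unfolding nrm_power2[symmetric] by simp
  also have "\<dots> = c * (a * c - b\<^sup>2)"
    by (simp add: lin_diff lin_scaleR inner_diff inner_lin_commute[of v u] power2_eq_square algebra_simps
        flip: a_def b_def c_def)
  finally have "b\<^sup>2 \<le> a * c" using \<open>c > 0\<close> by (simp add: zero_le_mult_iff)
  also have "\<dots> = (nrm u * nrm v)\<^sup>2" by (simp add: power_mult_distrib nrm_power2 a_def c_def)
  finally show ?thesis unfolding b_def[symmetric] by (rule power2_le_imp_le) simp
qed simp

lemma nrm_triangle: "nrm (u + v) \<le> nrm u + nrm v"
proof (rule power2_le_imp_le)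
  have "(nrm (u + v))\<^sup>2 = (nrm u)\<^sup>2 + 2 * inner (lin u) v + (nrm v)\<^sup>2"
    by (simp add: nrm_power2 lin_add inner_add inner_lin_commute[of v u])
  also have "\<dots> \<le> (nrm u + nrm v)\<^sup>2"
    using inner_lin_Cauchy_Schwarz[of u v] by (simp add: power2_sum)
  finally show "(nrm (u + v))\<^sup>2 \<le> (nrm u + nrm v)\<^sup>2" .
qed simp

lemma nrm_minus: "nrm (- u) = nrm u"
  unfolding norm_star_def inner_star_eq using lin_scaleR[of "-1" u] by simp

lemma nrm_diff_commute: "nrm (u - v) = nrm (v - u)"
  using nrm_minus[of "u - v"] by simp

lemma nrm_diff_le: "nrm u - nrm v \<le> nrm (u - v)"
  using nrm_triangle[of "u - v" v] by simp

lemma continuous_on_nrm: "continuous_on S nrm"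
proof (rule continuous_on_subset[of UNIV])
  have "dist (nrm u) (nrm v) \<le> sqrt Lam * dist u v" for u v
    using nrm_diff_le[of u v] nrm_diff_le[of v u] nrm_le[of "u - v"]
    by (simp add: dist_norm nrm_diff_commute[of v u] abs_le_iff)
  then show "continuous_on UNIV nrm"
    using Lam_pos by (intro lipschitz_on_continuous_on[where L = "sqrt Lam"] lipschitz_onI) auto
qed simp

text \<open>Both terms of the pointwise modulus are multiples of the sequences themselves, so they
  sum to multiples of \<open>norm u\<close> and \<open>norm h\<close>; a constant error per site
  would not be summable.\<close>

lemma nem_modulus:
  assumes "e > 0"
  shows "\<exists>C\<ge>0. \<forall>u h. norm u \<le> R \<longrightarrow> norm h \<le> R \<longrightarrow> norm (nem (u + h) - nem u) \<le> e * norm u + C * norm h"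
proof -
  obtain C where C: "C \<ge> 0" "\<And>t x y. norm x \<le> R \<Longrightarrow> norm y \<le> R \<Longrightarrow>
    norm (V' t (x + y) - V' t x) \<le> e * (norm x + norm y) + C * norm y"
    using V'_modulus[OF assms, of R] by blast
  have "norm (nem (u + h) - nem u) \<le> e * norm u + (e + C) * norm h" if "norm u \<le> R" "norm h \<le> R" for u h
  proof -
    have *: "norm (l2_nth u t) \<le> R" "norm (l2_nth h t) \<le> R" for t
      using that norm_l2_nth_le[of u t] norm_l2_nth_le[of h t] by linarith+
    have "norm (nem (u + h) - nem u) \<le> norm (e *\<^sub>R l2_abs u + (e + C) *\<^sub>R l2_abs h)"
      using C(2)[OF *] assms C(1) by (intro norm_l2_mono) (simp add: algebra_simps)
    also have "\<dots> \<le> e * norm u + (e + C) * norm h"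
      using norm_triangle_ineq[of "e *\<^sub>R l2_abs u" "(e + C) *\<^sub>R l2_abs h"] assms C(1) by simp
    finally show ?thesis .
  qed
  then show ?thesis using C(1) assms by (intro exI[of _ "e + C"]) auto
qed

lemma grad_linear_bound: "\<exists>C\<ge>0. \<forall>u. norm u \<le> R \<longrightarrow> norm (grad u) \<le> C * norm u"
proof (cases "R \<ge> 0")
  case True
  obtain C where C: "C \<ge> 0" "\<And>u h. norm u \<le> R \<Longrightarrow> norm h \<le> R \<Longrightarrow> norm (nem (u + h) - nem u) \<le> 1 * norm u + C * norm h"
    using nem_modulus[of 1 R] by auto
  have n0: "nem 0 = 0" by (rule l2_eqI) (simp add: V'_0)
  have "norm (grad u) \<le> (Lam + C) * norm u" if "norm u \<le> R" for u
    using C(2)[of 0 u] that True norm_lin_le[of u] norm_triangle_ineq4[of "lin u" "nem u"]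
    by (simp add: n0 grad_def algebra_simps)
  then show ?thesis using C(1) Lam_pos by (intro exI[of _ "Lam + C"]) auto
next
  case False
  then show ?thesis by (intro exI[of _ 0]) (auto dest: order_trans[OF norm_ge_zero])
qed

lemma continuous_on_grad: "continuous_on S grad"
proof (rule continuous_on_subset[of UNIV])
  have lin: "continuous_on UNIV lin"
  proof (rule lipschitz_on_continuous_on[where L = Lam], rule lipschitz_onI)
    show "dist (lin u) (lin v) \<le> Lam * dist u v" for u v
      using norm_lin_le[of "u - v"] by (simp add: dist_norm lin_diff)
  qed (use Lam_pos in simp)
  have "\<exists>D>0. \<forall>v. dist v u < D \<longrightarrow> dist (nem v) (nem u) < e" if "e > 0" for u e
  proof -
    define R where "R = norm u + 1"
    have R: "R > 0" by (simp add: R_def add_nonneg_pos)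
    obtain C where C: "C \<ge> 0" "\<And>u h. norm u \<le> R \<Longrightarrow> norm h \<le> R \<Longrightarrow>
        norm (nem (u + h) - nem u) \<le> e / (2 * R) * norm u + C * norm h"
      using nem_modulus[of "e / (2 * R)" R] \<open>e > 0\<close> R by auto
    \<comment> \<open>The modulus was taken with e / (2 R), and \<open>norm u < R\<close>, which
      uses half of e; D spends the other half.\<close>
    define D where "D = min R (e / (2 * (C + 1)))"
    have "dist (nem v) (nem u) < e" if "dist v u < D" for v
    proof -
      have h: "norm (v - u) < D" using that by (simp add: dist_norm)
      have "dist (nem v) (nem u) \<le> e / (2 * R) * norm u + C * norm (v - u)"
        using C(2)[of u "v - u"] h by (simp add: R_def D_def dist_norm)
      also have "\<dots> < e / 2 + e / 2"
      proof (rule add_less_le_mono)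
        show "e / (2 * R) * norm u < e / 2" using \<open>e > 0\<close> R by (simp add: field_simps R_def)
        have "C * norm (v - u) \<le> C * (e / (2 * (C + 1)))"
          using h C(1) by (intro mult_left_mono) (auto simp: D_def)
        also have "\<dots> \<le> e / 2" using C(1) \<open>e > 0\<close> by (simp add: field_simps)
        finally show "C * norm (v - u) \<le> e / 2" .
      qed
      finally show ?thesis by simp
    qed
    moreover have "D > 0" using R C(1) \<open>e > 0\<close> by (simp add: D_def)
    ultimately show ?thesis by blast
  qed
  then have "continuous_on UNIV nem" unfolding continuous_on_iff by auto
  then show "continuous_on UNIV grad"
    unfolding grad_def[abs_def] by (intro continuous_on_diff lin)
qed simp

text \<open>Since \<open>V'\<close> is merely continuous, uniformity on bounded sets of the infinite-dimensional space
  rests on its superlinearity at the origin.\<close>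

lemma energy_taylor:
  assumes "e > 0"
  shows "\<exists>D>0. \<forall>u h. norm u \<le> R \<longrightarrow> norm h \<le> D \<longrightarrow> \<bar>f (u + h) - f u - inner (grad u) h\<bar> \<le> e * norm h"
proof -
  define R' where "R' = \<bar>R\<bar> + 1"
  have R': "R' > 0" "R \<le> R'" "1 \<le> R'" by (auto simp: R'_def)
  \<comment> \<open>The remainder will be at most (e' |u| + K |h|) |h|; e' and the radius D below
    account for half of e each.\<close>
  define e' where "e' = e / (2 * R')"
  have e': "e' > 0" using assms R' by (simp add: e'_def)
  obtain C where C: "C \<ge> 0" "\<And>t x y. norm x \<le> R' \<Longrightarrow> norm y \<le> R' \<Longrightarrow>
    norm (V' t (x + y) - V' t x) \<le> e' * (norm x + norm y) + C * norm y"
    using V'_modulus[OF e', of R'] by blast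
  define K where "K = Lam + e' + C"
  have K: "K > 0" using Lam_pos e' C by (simp add: K_def)
  define D where "D = min 1 (e / (2 * K))"
  have D: "D > 0" "D \<le> 1" "D \<le> e / (2 * K)" using assms K by (auto simp: D_def)
  show ?thesis
  proof (intro exI[of _ D] conjI allI impI D)
    fix u h :: "'n space" assume u: "norm u \<le> R" and h: "norm h \<le> D"
    define r where "r t = V t (l2_nth (u + h) t) - V t (l2_nth u t) - inner (l2_nth (nem u) t) (l2_nth h t)" for t
    have r_le: "\<bar>r t\<bar> \<le> e' * (norm (l2_nth u t) * norm (l2_nth h t))
        + (e' + C) * (norm (l2_nth h t) * norm (l2_nth h t))" for t
    proof -
      define x y where "x = l2_nth u t" and "y = l2_nth h t"
      have x: "norm x \<le> R'" and y: "norm y \<le> R'"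
        using norm_l2_nth_le[of u t] norm_l2_nth_le[of h t] u h D R' by (auto simp: x_def y_def)
      obtain \<xi> where \<xi>: "\<xi> \<in> {0..1}" "V t (x + y) - V t x = inner y (V' t (x + \<xi> *\<^sub>R y))"
        using V_mvt by blast
      have le: "norm (\<xi> *\<^sub>R y) \<le> norm y" using \<xi>(1) by (simp add: mult_left_le_one_le)
      have "r t = inner y (V' t (x + \<xi> *\<^sub>R y) - V' t x)"
        using \<xi>(2) by (simp add: r_def x_def y_def inner_diff inner_commute)
      then have "\<bar>r t\<bar> \<le> norm y * norm (V' t (x + \<xi> *\<^sub>R y) - V' t x)"
        by (simp add: Cauchy_Schwarz_ineq2)
      also have "\<dots> \<le> norm y * (e' * (norm x + norm (\<xi> *\<^sub>R y)) + C * norm (\<xi> *\<^sub>R y))"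
        using x y le by (intro mult_left_mono C) auto
      also have "\<dots> \<le> norm y * (e' * (norm x + norm y) + C * norm y)"
        using le e' C(1) by (intro mult_left_mono add_mono) auto
      finally show ?thesis by (simp add: x_def y_def algebra_simps)
    qed
    have sV: "(\<lambda>t. V t (l2_nth (u + h) t)) summable_on UNIV" "(\<lambda>t. V t (l2_nth u t)) summable_on UNIV"
      by (rule V_summable)+
    have sr: "r summable_on UNIV"
      unfolding r_def using summable_on_diff_real[OF summable_on_diff_real[OF sV] l2_inner_summable[of "nem u" h]] .
    have abs_r: "(\<lambda>t. \<bar>r t\<bar>) summable_on UNIV"
      using sr summable_on_iff_abs_summable_on_real[of r UNIV] by simp
    have r_sum: "infsum r UNIV = (\<Sum>\<^sub>\<infinity>t. V t (l2_nth (u + h) t)) - (\<Sum>\<^sub>\<infinity>t. V t (l2_nth u t)) - inner (nem u) h"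
      unfolding r_def inner_l2seq_def infsum_diff_real[OF summable_on_diff_real[OF sV] l2_inner_summable]
        infsum_diff_real[OF sV] ..
    have b_sum: "(\<lambda>t. e' * (norm (l2_nth u t) * norm (l2_nth h t))) summable_on UNIV"
      "(\<lambda>t. (e' + C) * (norm (l2_nth h t) * norm (l2_nth h t))) summable_on UNIV"
      by (intro summable_on_cmult_right summable_norm_mult_l2)+
    have "\<bar>infsum r UNIV\<bar> \<le> (\<Sum>\<^sub>\<infinity>t. \<bar>r t\<bar>)"
      using norm_infsum_bound[of r UNIV] abs_r by simp
    also have "\<dots> \<le> (\<Sum>\<^sub>\<infinity>t. e' * (norm (l2_nth u t) * norm (l2_nth h t))
        + (e' + C) * (norm (l2_nth h t) * norm (l2_nth h t)))"
      by (intro infsum_mono r_le summable_on_add b_sum abs_r)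
    also have "\<dots> = e' * (\<Sum>\<^sub>\<infinity>t. norm (l2_nth u t) * norm (l2_nth h t))
        + (e' + C) * (\<Sum>\<^sub>\<infinity>t. norm (l2_nth h t) * norm (l2_nth h t))"
      by (simp add: infsum_add[OF b_sum] infsum_cmult_right')
    also have "\<dots> \<le> e' * (norm u * norm h) + (e' + C) * (norm h * norm h)"
      using e' C(1) by (intro add_mono mult_left_mono infsum_norm_mult_l2_le) auto
    finally have rb: "\<bar>infsum r UNIV\<bar> \<le> e' * (norm u * norm h) + (e' + C) * (norm h * norm h)" .
    have "f (u + h) - f u - inner (grad u) h = (nrm h)\<^sup>2 / 2 - infsum r UNIV"
      unfolding energy_def r_sum nrm_power2 grad_def
      by (simp add: lin_add inner_add inner_diff inner_lin_commute[of h u] field_simps)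
    moreover have "(nrm h)\<^sup>2 / 2 \<le> Lam * (norm h * norm h)"
    proof -
      have "(nrm h)\<^sup>2 \<le> (sqrt Lam * norm h)\<^sup>2" by (intro power_mono nrm_le) simp
      also have "\<dots> = Lam * (norm h * norm h)" using Lam_pos by (simp add: power_mult_distrib power2_eq_square)
      finally show ?thesis using zero_le_power2[of "nrm h"] by linarith
    qed
    moreover have "(nrm h)\<^sup>2 / 2 \<ge> 0" by simp
    ultimately have "\<bar>f (u + h) - f u - inner (grad u) h\<bar>
        \<le> Lam * (norm h * norm h) + (e' * (norm u * norm h) + (e' + C) * (norm h * norm h))"
      using rb by linarith
    also have "\<dots> = (e' * norm u + K * norm h) * norm h" by (simp add: K_def algebra_simps)
    also have "\<dots> \<le> (e / 2 + e / 2) * norm h"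
    proof (intro mult_right_mono add_mono)
      have "e' * norm u \<le> e' * R'" using u R' e' by (intro mult_left_mono) auto
      then show "e' * norm u \<le> e / 2" using R' by (simp add: e'_def)
      have "K * norm h \<le> K * (e / (2 * K))" using h D K by (intro mult_left_mono) auto
      then show "K * norm h \<le> e / 2" using K by simp
    qed auto
    finally show "\<bar>f (u + h) - f u - inner (grad u) h\<bar> \<le> e * norm h" by simp
  qed
qed

lemma energy_has_derivative: "(f has_derivative (\<lambda>h. inner (grad u) h)) (at u)"
  unfolding has_derivative_at_alt
proof (intro conjI allI impI)
  show "bounded_linear (\<lambda>h. inner (grad u) h)" by (rule bounded_linear_inner_right)
  fix e :: real assume "e > 0"
  from energy_taylor[OF this, of "norm u"] obtain D where D: "D > 0"
    "\<And>h. norm h \<le> D \<Longrightarrow> \<bar>f (u + h) - f u - inner (grad u) h\<bar> \<le> e * norm h" by blast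
  have "norm (f y - f u - inner (grad u) (y - u)) \<le> e * norm (y - u)" if "norm (y - u) < D" for y
    using D(2)[of "y - u"] that by simp
  with D(1) show "\<exists>d>0. \<forall>y. norm (y - u) < d \<longrightarrow> norm (f y - f u - inner (grad u) (y - u)) \<le> e * norm (y - u)"
    by blast
qed

lemma continuous_on_energy: "continuous_on S f"
  using has_derivative_continuous[OF energy_has_derivative] by (simp add: continuous_at_imp_continuous_on)

lemma crit_iff: "u \<in> crit L V \<longleftrightarrow> u \<noteq> 0 \<and> grad u = 0"
proof -
  have "(f has_derivative (\<lambda>_. 0)) (at u) \<longleftrightarrow> grad u = 0"
  proof
    assume "(f has_derivative (\<lambda>_. 0)) (at u)"
    from has_derivative_unique[OF energy_has_derivative this]
    have "inner (grad u) (grad u) = 0" by (rule fun_cong)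
    then show "grad u = 0" by simp
  qed (use energy_has_derivative[of u] in simp)
  then show ?thesis by (simp add: crit_def)
qed

text \<open>Transfers the given lower bounds on the dual norm to \<open>norm (grad u)\<close>: the
  star unit ball lies in the plain ball of radius 1 / sqrt lam.\<close>

lemma dual_norm_deriv_le: "dual_norm_deriv L V u \<le> norm (grad u) / sqrt lam"
proof -
  have fd: "frechet_derivative f (at u) = (\<lambda>h. inner (grad u) h)"
    using frechet_derivative_at[OF energy_has_derivative] by simp
  show ?thesis
    unfolding dual_norm_deriv_def fd
  proof (rule cSUP_least)
    have "nrm 0 \<le> 1" by (simp add: norm_star_def inner_star_eq)
    then show "{h. nrm h \<le> 1} \<noteq> {}" by blast
    fix h assume "h \<in> {h. nrm h \<le> 1}"
    then have "sqrt lam * norm h \<le> 1" using nrm_ge[of h] by simp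
    then have h: "norm h \<le> 1 / sqrt lam" using lam_pos by (simp add: field_simps)
    have "\<bar>inner (grad u) h\<bar> \<le> norm (grad u) * norm h" by (rule Cauchy_Schwarz_ineq2)
    also have "\<dots> \<le> norm (grad u) * (1 / sqrt lam)" by (intro mult_left_mono h) simp
    finally show "\<bar>inner (grad u) h\<bar> \<le> norm (grad u) / sqrt lam" by simp
  qed
qed

lemma grad_shift:
  assumes "int T dvd p"
  shows "grad (l2_shift p u) = l2_shift p (grad u)"
proof (rule l2_eqI)
  fix t
  have "L t = L (t - p)" "V' t = V' (t - p)"
    using periodic_dvd[of L T p "t - p", OF L_per assms] periodic_dvd[of V' T p "t - p", OF V'_per assms]
    by simp_all
  then show "l2_nth (grad (l2_shift p u)) t = l2_nth (l2_shift p (grad u)) t"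
    by (simp add: l2_nth_grad algebra_simps)
qed

text \<open>Limits how often an iteration that stays bounded can lose a fixed amount of energy; f
  itself may be unbounded below.\<close>

lemma energy_bounded_below: "\<exists>B. \<forall>u. norm u \<le> R \<longrightarrow> B \<le> f u"
proof -
  obtain C where C: "C \<ge> 0" "\<And>t x. norm x \<le> R \<Longrightarrow> \<bar>V t x\<bar> \<le> C * (norm x)\<^sup>2"
    using V_quadratic_bound by blast
  have "- C * R\<^sup>2 \<le> f u" if u: "norm u \<le> R" for u
  proof -
    have "(\<Sum>\<^sub>\<infinity>t. V t (l2_nth u t)) \<le> (\<Sum>\<^sub>\<infinity>t. C * (norm (l2_nth u t))\<^sup>2)"
    proof (rule infsum_mono)
      show "V t (l2_nth u t) \<le> C * (norm (l2_nth u t))\<^sup>2" for t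
        using C(2)[of "l2_nth u t" t] norm_l2_nth_le[of u t] u by linarith
    qed (intro V_summable summable_on_cmult_right l2_nth_summable)+
    also have "\<dots> = C * (norm u)\<^sup>2" by (simp add: norm_l2_power2 infsum_cmult_right')
    also have "\<dots> \<le> C * R\<^sup>2" using u C(1) by (intro mult_left_mono power_mono) auto
    finally show ?thesis using zero_le_power2[of "nrm u"] unfolding energy_def by linarith
  qed
  then show ?thesis by blast
qed

end

section \<open>Palais--Smale sequences with small tails\<close>

context lattice_equation
begin

text \<open>Each site of \<open>grad\<close> involves three sites of the sequence, so pointwise
  convergence passes through it.\<close>

lemma grad_pointwise_limit:
  assumes lim: "\<And>t. (\<lambda>m. l2_nth (u m) t) \<longlonglongrightarrow> l2_nth v t"
    and g0: "(\<lambda>m. norm (grad (u m))) \<longlonglongrightarrow> 0"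
  shows "grad v = 0"
proof (rule l2_eqI)
  fix t
  have "(\<lambda>m. l2_nth (grad (u m)) t) \<longlonglongrightarrow> l2_nth (grad v) t"
    unfolding l2_nth_grad
    by (intro tendsto_intros lim tendsto_compose[OF matrix_vector_mul_bounded_linear[THEN
          bounded_linear.isCont, unfolded isCont_def]]
        continuous_on_tendsto_compose[OF V'_cont]) auto
  moreover have "(\<lambda>m. l2_nth (grad (u m)) t) \<longlonglongrightarrow> 0"
    by (rule tendsto_0_le[OF g0, of _ 1]) (simp add: norm_l2_nth_le)
  ultimately show "l2_nth (grad v) t = l2_nth 0 t"
    by (simp add: LIMSEQ_unique)
qed

text \<open>A discrete Caccioppoli inequality: pair the gradient with the sequence itself beyond |t|
  = n + 1. Young's inequality gives half of each neighbour, and 2 - 1 + lam - lam / 4 remains at the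
  site. Neighbours reach one site inwards, hence n on the right.\<close>

lemma tail_recursion:
  assumes s: "\<And>t x. norm x \<le> s \<Longrightarrow> norm (V' t x) \<le> lam / 4 * norm x"
    and small: "\<And>t. \<bar>t\<bar> \<ge> int N0 \<Longrightarrow> norm (l2_nth u t) \<le> s" and n: "n \<ge> N0"
  shows "(1 + 3 * lam / 4) * (norm (l2_restrict {t. \<bar>t\<bar> > int (Suc n)} u))\<^sup>2
    \<le> (norm (l2_restrict {t. \<bar>t\<bar> > int n} u))\<^sup>2 + norm (grad u) * norm u"
proof -
  define w where "w = l2_restrict {t. \<bar>t\<bar> > int n} u"
  define w' where "w' = l2_restrict {t. \<bar>t\<bar> > int (Suc n)} u"
  have le: "(1 + 3 * lam / 4) * (norm (l2_nth w' t))\<^sup>2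
      \<le> 1 / 2 * (norm (l2_nth (l2_shift 1 w) t))\<^sup>2 + 1 / 2 * (norm (l2_nth (l2_shift (- 1) w) t))\<^sup>2
        + norm (l2_nth (grad u) t) * norm (l2_nth u t)" for t
  proof (cases "\<bar>t\<bar> > int (Suc n)")
    case True
    define x where "x = l2_nth u t"
    define y where "y = l2_nth u (t - 1)"
    define z where "z = l2_nth u (t + 1)"
    have w: "l2_nth w' t = x" "l2_nth (l2_shift 1 w) t = y" "l2_nth (l2_shift (- 1) w) t = z"
      using True by (auto simp: w_def w'_def x_def y_def z_def)
    have V: "inner (V' t x) x \<le> lam / 4 * (norm x)\<^sup>2"
    proof -
      have "inner (V' t x) x \<le> norm (V' t x) * norm x" by (rule norm_cauchy_schwarz)
      also have "\<dots> \<le> (lam / 4 * norm x) * norm x"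
        by (intro mult_right_mono s) (use small[of t] True n in \<open>auto simp: x_def\<close>)
      finally show ?thesis by (simp add: power2_eq_square)
    qed
    have yx: "inner y x \<le> 1 / 2 * (norm y)\<^sup>2 + 1 / 2 * (norm x)\<^sup>2" for y
    proof -
      have "0 \<le> (norm (y - x))\<^sup>2" by simp
      then show ?thesis
        unfolding power2_norm_eq_inner by (simp add: inner_diff inner_commute)
    qed
    have "inner (l2_nth (grad u) t) x
        = 2 * (norm x)\<^sup>2 - inner y x - inner z x + inner x (L t *v x) - inner (V' t x) x"
      unfolding l2_nth_grad power2_norm_eq_inner
      unfolding x_def[symmetric] y_def[symmetric] z_def[symmetric] inner_add_left inner_diff_left
        inner_scaleR_left by (simp add: inner_commute[of "L t *v x" x])
    moreover have "inner (l2_nth (grad u) t) x \<le> norm (l2_nth (grad u) t) * norm x"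
      by (rule norm_cauchy_schwarz)
    ultimately show ?thesis
      unfolding w x_def[symmetric] using V yx[of y] yx[of z] lam_le[of x t]
      by (simp add: algebra_simps)
  next
    case False
    then show ?thesis by (simp add: w'_def)
  qed
  have sw: "(\<lambda>t. 1 / 2 * (norm (l2_nth (l2_shift 1 w) t))\<^sup>2) summable_on UNIV"
    "(\<lambda>t. 1 / 2 * (norm (l2_nth (l2_shift (- 1) w) t))\<^sup>2) summable_on UNIV"
    by (intro summable_on_cmult_right l2_nth_summable)+
  note sg = summable_norm_mult_l2[of "grad u" u]
  have "(1 + 3 * lam / 4) * (norm w')\<^sup>2 = (\<Sum>\<^sub>\<infinity>t. (1 + 3 * lam / 4) * (norm (l2_nth w' t))\<^sup>2)"
    by (simp add: norm_l2_power2 infsum_cmult_right')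
  also have "\<dots> \<le> (\<Sum>\<^sub>\<infinity>t. 1 / 2 * (norm (l2_nth (l2_shift 1 w) t))\<^sup>2
      + 1 / 2 * (norm (l2_nth (l2_shift (- 1) w) t))\<^sup>2 + norm (l2_nth (grad u) t) * norm (l2_nth u t))"
    by (intro infsum_mono le summable_on_add sw sg summable_on_cmult_right l2_nth_summable)
  also have "\<dots> = 1 / 2 * (norm (l2_shift 1 w))\<^sup>2 + 1 / 2 * (norm (l2_shift (- 1) w))\<^sup>2
      + (\<Sum>\<^sub>\<infinity>t. norm (l2_nth (grad u) t) * norm (l2_nth u t))"
    unfolding norm_l2_power2 infsum_add[OF summable_on_add[OF sw] sg] infsum_add[OF sw]
      infsum_cmult_right' ..
  also have "\<dots> \<le> (norm w)\<^sup>2 + norm (grad u) * norm u"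
    using infsum_norm_mult_l2_le[of "grad u" u] by simp
  finally show ?thesis by (simp add: w_def w'_def)
qed

lemma tail_decay:
  assumes s: "\<And>t x. norm x \<le> s \<Longrightarrow> norm (V' t x) \<le> lam / 4 * norm x"
    and small: "\<And>t. \<bar>t\<bar> \<ge> int N0 \<Longrightarrow> norm (l2_nth u t) \<le> s" and R: "norm u \<le> R"
  shows "(norm (l2_restrict {t. \<bar>t\<bar> > int (N0 + j)} u))\<^sup>2
    \<le> (1 / (1 + 3 * lam / 4)) ^ j * R\<^sup>2 + 4 / (3 * lam) * (norm (grad u) * R)"
proof (induction j)
  case 0
  have "(norm (l2_restrict {t. \<bar>t\<bar> > int N0} u))\<^sup>2 \<le> R\<^sup>2"
    using R norm_l2_restrict_le[of "{t. \<bar>t\<bar> > int N0}" u] by (intro power_mono) auto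
  moreover have "0 \<le> 4 / (3 * lam) * (norm (grad u) * R)"
    using lam_pos order_trans[OF norm_ge_zero R] by (intro mult_nonneg_nonneg) auto
  ultimately show ?case by simp
next
  case (Suc j)
  define q where "q = 1 + 3 * lam / 4"
  have q: "q > 1" using lam_pos by (simp add: q_def)
  have "q * (norm (l2_restrict {t. \<bar>t\<bar> > int (N0 + Suc j)} u))\<^sup>2
      \<le> (norm (l2_restrict {t. \<bar>t\<bar> > int (N0 + j)} u))\<^sup>2 + norm (grad u) * norm u"
    unfolding q_def add_Suc_right by (rule tail_recursion[where s = s and ?N0.0 = N0, OF s small le_add1])
  also have "\<dots> \<le> ((1 / q) ^ j * R\<^sup>2 + 4 / (3 * lam) * (norm (grad u) * R)) + norm (grad u) * R"
    using Suc R by (intro add_mono mult_left_mono) (auto simp: q_def)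
  \<comment> \<open>With q = 1 + 3 lam / 4 the constant 4 / (3 lam) is 1 / (q - 1), the value
    reproduced by adding 1 and dividing by q.\<close>
  also have "\<dots> = q * ((1 / q) ^ Suc j * R\<^sup>2 + 4 / (3 * lam) * (norm (grad u) * R))"
  proof -
    have "q * (1 / q) ^ Suc j = (1 / q) ^ j" using q by simp
    moreover have "q * (4 / (3 * lam)) = 4 / (3 * lam) + 1" using lam_pos by (simp add: q_def field_simps)
    ultimately show ?thesis
      unfolding distrib_left mult.assoc[symmetric, of q] by (simp only: distrib_right mult_1 add.assoc)
  qed
  finally show ?case unfolding q_def[symmetric] using q by (simp only: mult_le_cancel_left_pos)
qed

text \<open>Palais-Smale compactness where tails stay below s: no mass escapes to infinity, because
  the tail decays geometrically up to a multiple of the gradient norm. In the remaining finite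
  window pointwise convergence suffices.\<close>

lemma ps_compact:
  assumes s: "\<And>t x. norm x \<le> s \<Longrightarrow> norm (V' t x) \<le> lam / 4 * norm x"
    and small: "\<And>m t. \<bar>t\<bar> \<ge> int N0 \<Longrightarrow> norm (l2_nth (u m) t) \<le> s"
    and R: "\<And>m. norm (u m) \<le> R"
    and g0: "(\<lambda>m. norm (grad (u m))) \<longlonglongrightarrow> 0"
  shows "\<exists>\<phi> v. strict_mono \<phi> \<and> (\<lambda>m. u (\<phi> m)) \<longlonglongrightarrow> v \<and> grad v = 0"
proof -
  obtain \<phi> v where \<phi>: "strict_mono \<phi>" and lim: "\<And>t. (\<lambda>m. l2_nth (u (\<phi> m)) t) \<longlonglongrightarrow> l2_nth v t"
    using bounded_l2_pointwise_convergent_subseq[of u R, OF R] by blast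
  have g0': "(\<lambda>m. norm (grad (u (\<phi> m)))) \<longlonglongrightarrow> 0"
    using LIMSEQ_subseq_LIMSEQ[OF g0 \<phi>] by (simp add: comp_def)
  have "(\<lambda>m. (norm (u (\<phi> m) - v))\<^sup>2) \<longlonglongrightarrow> 0"
  proof (rule LIMSEQ_I)
    fix e :: real assume "e > 0"
    define q where "q = 1 / (1 + 3 * lam / 4)"
    have q: "0 \<le> q" "q < 1" using lam_pos by (simp_all add: q_def field_simps)
    have "(\<lambda>j. q ^ j * R\<^sup>2) \<longlonglongrightarrow> 0 * R\<^sup>2"
      using q by (intro tendsto_intros LIMSEQ_realpow_zero)
    then have "eventually (\<lambda>j. q ^ j * R\<^sup>2 < e / 8) sequentially"
      using order_tendstoD(2)[of _ 0 _ "e / 8"] \<open>e > 0\<close> by simp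
    then obtain j0 where j0: "\<And>j. j \<ge> j0 \<Longrightarrow> q ^ j * R\<^sup>2 < e / 8"
      unfolding eventually_sequentially by blast
    obtain n0 where n0: "\<And>n. n \<ge> n0 \<Longrightarrow> norm (l2_restrict {t. \<bar>t\<bar> > int n} v) < sqrt (e / 8)"
      using l2_tail_small[of "sqrt (e / 8)" v] \<open>e > 0\<close> by auto
    \<comment> \<open>One cut for both tails: 2 (e / 4) from the sequence, 2 (e / 8) from the limit
      and e / 8 from the finite window add up to 7 e / 8.\<close>
    define j where "j = max j0 n0"
    define A where "A = {t. \<bar>t\<bar> > int (N0 + j)}"
    have A: "- A = {- int (N0 + j)..int (N0 + j)}" by (auto simp: A_def)
    have v_tail: "(norm (l2_restrict A v))\<^sup>2 \<le> e / 8"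
    proof -
      have "(norm (l2_restrict A v))\<^sup>2 \<le> (sqrt (e / 8))\<^sup>2"
        unfolding A_def by (intro power_mono less_imp_le[OF n0] norm_ge_zero) (simp add: j_def)
      then show ?thesis using \<open>e > 0\<close> by simp
    qed
    have "(\<lambda>m. 4 / (3 * lam) * (norm (grad (u (\<phi> m))) * R)) \<longlonglongrightarrow> 4 / (3 * lam) * (0 * R)"
      by (intro tendsto_intros g0')
    then have ev1: "eventually (\<lambda>m. 4 / (3 * lam) * (norm (grad (u (\<phi> m))) * R) < e / 8) sequentially"
      by (rule order_tendstoD(2)) (use \<open>e > 0\<close> in simp)
    have "(\<lambda>m. (norm (l2_restrict (- A) (u (\<phi> m) - v)))\<^sup>2) \<longlonglongrightarrow> (\<Sum>t\<in>- A. (norm (l2_nth v t - l2_nth v t))\<^sup>2)"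
      unfolding A norm_l2_restrict_finite[OF finite_atLeastAtMost_int] l2_nth_diff
      by (intro tendsto_intros lim)
    then have ev2: "eventually (\<lambda>m. (norm (l2_restrict (- A) (u (\<phi> m) - v)))\<^sup>2 < e / 8) sequentially"
      by (rule order_tendstoD(2)) (use \<open>e > 0\<close> in simp)
    have "eventually (\<lambda>m. norm ((norm (u (\<phi> m) - v))\<^sup>2 - 0) < e) sequentially"
      using ev1 ev2
    proof eventually_elim
      case (elim m)
      have "(norm (l2_restrict A (u (\<phi> m))))\<^sup>2 \<le> q ^ j * R\<^sup>2 + 4 / (3 * lam) * (norm (grad (u (\<phi> m))) * R)"
        unfolding A_def q_def by (rule tail_decay[OF s small R])
      also have "\<dots> \<le> e / 8 + e / 8" using j0[of j] elim(1) by (simp add: j_def)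
      finally have 1: "(norm (l2_restrict A (u (\<phi> m))))\<^sup>2 \<le> e / 4" by simp
      have "(norm (u (\<phi> m) - v))\<^sup>2
          = (norm (l2_restrict A (u (\<phi> m) - v)))\<^sup>2 + (norm (l2_restrict (- A) (u (\<phi> m) - v)))\<^sup>2"
        using norm_l2_restrict_Un[of A "- A" "u (\<phi> m) - v"] by (simp add: Compl_partition)
      also have "(norm (l2_restrict A (u (\<phi> m) - v)))\<^sup>2
          \<le> 2 * (norm (l2_restrict A (u (\<phi> m))))\<^sup>2 + 2 * (norm (l2_restrict A v))\<^sup>2"
        using norm_add_square_le[of "l2_restrict A (u (\<phi> m))" "- l2_restrict A v"]
        by (simp add: l2_restrict_diff)
      finally show ?case using 1 v_tail elim(2) \<open>e > 0\<close> by simp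
    qed
    then show "\<exists>no. \<forall>m\<ge>no. norm ((norm (u (\<phi> m) - v))\<^sup>2 - 0) < e"
      unfolding eventually_sequentially .
  qed
  from tendsto_real_sqrt[OF this] have "(\<lambda>m. norm (u (\<phi> m) - v)) \<longlonglongrightarrow> 0"
    by (simp only: real_sqrt_abs abs_norm_cancel real_sqrt_zero)
  then have "(\<lambda>m. u (\<phi> m)) \<longlonglongrightarrow> v"
    by (rule LIM_zero_cancel[OF tendsto_norm_zero_cancel])
  with \<phi> grad_pointwise_limit[OF lim g0'] show ?thesis by blast
qed

lemma norm_le_of_nrm_le:
  assumes "nrm (u - v) \<le> \<rho>"
  shows "norm u \<le> norm v + \<rho> / sqrt lam"
proof -
  have "sqrt lam * norm (u - v) \<le> \<rho>" using nrm_ge assms by (rule order_trans)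
  then have "norm (u - v) \<le> \<rho> / sqrt lam" using lam_pos by (simp add: field_simps)
  then show ?thesis using norm_triangle_ineq2[of u v] by linarith
qed

text \<open>Countably many critical values leave a regular one in (a, b). If the gradient were not
  bounded below on any window around it, a Palais-Smale sequence with small tails would converge to
  a critical point on that level.\<close>

lemma noncritical_levels:
  assumes s: "\<And>t x. norm x \<le> s \<Longrightarrow> norm (V' t x) \<le> lam / 4 * norm x"
    and small: "\<And>u t. nrm (u - v) \<le> \<rho> \<Longrightarrow> \<bar>t\<bar> \<ge> int N0 \<Longrightarrow> norm (l2_nth u t) \<le> s"
    and count: "countable (crit L V \<inter> {u. f u \<le> b})" and "a < b"
  shows "\<exists>c c' \<nu>. a < c \<and> c < c' \<and> c' < b \<and> \<nu> > 0 \<and>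
    (\<forall>u. nrm (u - v) \<le> \<rho> \<longrightarrow> c \<le> f u \<longrightarrow> f u \<le> c' \<longrightarrow> \<nu> \<le> norm (grad u))"
proof (rule ccontr)
  assume contra: "\<not> ?thesis"
  \<comment> \<open>The zero sequence is a zero of the gradient that \<open>crit\<close> leaves out;
    its level has to be avoided as well.\<close>
  have "countable (insert (f 0) (f ` (crit L V \<inter> {u. f u \<le> b})))" using count by simp
  moreover have "uncountable {a<..<b}" using \<open>a < b\<close> by (simp add: uncountable_open_interval)
  ultimately obtain c where c: "a < c" "c < b" "c \<noteq> f 0" "c \<notin> f ` (crit L V \<inter> {u. f u \<le> b})"
    using countable_subset[of "{a<..<b}"] by (metis greaterThanLessThan_iff insertCI subsetI)
  define \<delta> where "\<delta> = min (c - a) (b - c) / 2"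
  have \<delta>: "\<delta> > 0" using c by (simp add: \<delta>_def)
  have \<delta>': "\<delta> < c - a" "\<delta> < b - c" using c(1,2) by (simp_all add: \<delta>_def min_def field_simps)
  have "\<exists>u. nrm (u - v) \<le> \<rho> \<and> \<bar>f u - c\<bar> \<le> \<delta> / real (Suc n) \<and> norm (grad u) \<le> 1 / real (Suc n)" for n
  proof (rule ccontr)
    assume *: "\<not> ?thesis"
    have "\<delta> / real (Suc n) \<le> \<delta>" "\<delta> / real (Suc n) > 0" using \<delta> by (simp_all add: field_simps)
    then have "a < c - \<delta> / real (Suc n)" "c - \<delta> / real (Suc n) < c + \<delta> / real (Suc n)"
      "c + \<delta> / real (Suc n) < b"
      using c(1,2) \<delta>' by linarith+
    moreover have "1 / real (Suc n) \<le> norm (grad u)"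
      if "nrm (u - v) \<le> \<rho>" "c - \<delta> / real (Suc n) \<le> f u" "f u \<le> c + \<delta> / real (Suc n)" for u
    proof (rule ccontr)
      assume "\<not> ?thesis"
      then have "norm (grad u) \<le> 1 / real (Suc n)" by linarith
      moreover have "\<bar>f u - c\<bar> \<le> \<delta> / real (Suc n)" using that(2,3) by linarith
      ultimately show False using that(1) * by blast
    qed
    moreover have "1 / real (Suc n) > 0" by simp
    ultimately show False using contra by blast
  qed
  then obtain u where u: "\<And>n. nrm (u n - v) \<le> \<rho>" "\<And>n. \<bar>f (u n) - c\<bar> \<le> \<delta> / real (Suc n)"
    "\<And>n. norm (grad (u n)) \<le> 1 / real (Suc n)" by metis
  have "(\<lambda>n. norm (grad (u n))) \<longlonglongrightarrow> 0"
    by (rule tendsto_sandwich[OF _ _ tendsto_const LIMSEQ_inverse_real_of_nat])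
      (use u(3) in \<open>auto simp: inverse_eq_divide\<close>)
  from ps_compact[OF s small[OF u(1)] norm_le_of_nrm_le[OF u(1)] this]
  obtain \<phi> z where \<phi>: "strict_mono \<phi>" and z: "(\<lambda>m. u (\<phi> m)) \<longlonglongrightarrow> z" "grad z = 0" by blast
  have "(\<lambda>n. \<delta> * inverse (real (Suc n))) \<longlonglongrightarrow> \<delta> * 0"
    by (intro tendsto_intros LIMSEQ_inverse_real_of_nat)
  then have \<delta>0: "(\<lambda>n. \<delta> / real (Suc n)) \<longlonglongrightarrow> 0" by (simp add: inverse_eq_divide)
  have "(\<lambda>n. f (u n) - c) \<longlonglongrightarrow> 0"
    by (rule tendsto_0_le[OF \<delta>0, where K = 1]) (use u(2) \<delta> in auto)
  then have "(\<lambda>n. f (u n)) \<longlonglongrightarrow> c" by (rule LIM_zero_cancel)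
  then have "(\<lambda>n. f (u (\<phi> n))) \<longlonglongrightarrow> c" using LIMSEQ_subseq_LIMSEQ[OF _ \<phi>] by (auto simp: comp_def)
  moreover have "(\<lambda>n. f (u (\<phi> n))) \<longlonglongrightarrow> f z"
    using continuous_on_tendsto_compose[OF continuous_on_energy[of UNIV] z(1)] by simp
  ultimately have fz: "f z = c" by (rule LIMSEQ_unique[symmetric])
  then have "z \<in> crit L V" using c(3) z(2) by (auto simp: crit_iff)
  with fz c show False by auto
qed

section \<open>One step of the discretised gradient flow for a single bump\<close>

text \<open>The direction y is the gradient up to \<sigma> / 4, so |y| is at least 3 \<sigma> / 4
  and its pairing with the gradient at least |y| \<sigma> / 2. The Taylor remainder takes back
  \<sigma> / 4, which leaves a loss of \<sigma> / 4 per unit length.\<close>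

lemma descent:
  assumes g: "\<sigma> \<le> norm (grad x)" and y: "norm (y - grad x) \<le> \<sigma> / 4" and "0 \<le> \<tau>"
    and taylor: "\<bar>f (x + h) - f x - inner (grad x) h\<bar> \<le> \<sigma> / 4 * norm h" and h: "h = - (\<tau> *\<^sub>R y)"
  shows "f (x + h) \<le> f x - \<sigma> / 4 * norm h"
proof -
  have "inner (grad x) y = (norm y)\<^sup>2 - inner (y - grad x) y"
    by (simp add: inner_diff_left power2_norm_eq_inner)
  also have "\<dots> \<ge> (norm y)\<^sup>2 - \<sigma> / 4 * norm y"
    using norm_cauchy_schwarz[of "y - grad x" y] mult_right_mono[OF y norm_ge_zero[of y]] by linarith
  also have "(norm y)\<^sup>2 - \<sigma> / 4 * norm y = norm y * (norm y - \<sigma> / 4)"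
    by (simp add: power2_eq_square algebra_simps)
  finally have "norm y * (norm y - \<sigma> / 4) \<le> inner (grad x) y" .
  moreover have "norm y * (\<sigma> / 2) \<le> norm y * (norm y - \<sigma> / 4)"
    using g y norm_triangle_ineq2[of "grad x" y] by (intro mult_left_mono) (auto simp: norm_minus_commute)
  ultimately have "norm y * (\<sigma> / 2) \<le> inner (grad x) y" by linarith
  then have "\<tau> * (norm y * (\<sigma> / 2)) \<le> \<tau> * inner (grad x) y" using \<open>0 \<le> \<tau>\<close> by (rule mult_left_mono)
  then have "inner (grad x) h \<le> - (\<sigma> / 2 * norm h)" using \<open>0 \<le> \<tau>\<close> by (simp add: h algebra_simps)
  then have "inner (grad x) h \<le> - (2 * (\<sigma> / 4 * norm h))" by simp
  then show ?thesis using taylor by linarith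
qed

text \<open>Invariance of a penalised sublevel set. A block above c1 has at most c4 - c1 to spend on
  the penalty, hence lies within \<rho> + d / 2, and a step of at most d / 2 cannot leave \<rho> +
  d. Beyond radius \<rho> the descent in the annulus pays for the added penalty; within it, energies
  from c3 on decrease and lower ones are a full window away from c4.\<close>

lemma block_step:
  fixes v :: "'n space"
  assumes pos: "d > 0" "\<nu> > 0" "\<mu> > 0" and c: "c1 < c2" "c3 < c4"
    and low: "\<And>x. nrm (x - v) \<le> \<rho> + d \<Longrightarrow> c1 \<le> f x \<Longrightarrow> f x \<le> c2 \<Longrightarrow> \<nu> \<le> norm (grad x)"
    and high: "\<And>x. nrm (x - v) \<le> \<rho> + d \<Longrightarrow> c3 \<le> f x \<Longrightarrow> f x \<le> c4 \<Longrightarrow> \<nu> \<le> norm (grad x)"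
    and ann: "\<And>x. \<rho> - d \<le> nrm (x - v) \<Longrightarrow> nrm (x - v) \<le> \<rho> + d \<Longrightarrow> f x \<le> c4 \<Longrightarrow> \<mu> \<le> norm (grad x)"
    and m: "m = \<mu> / (4 * sqrt Lam)" "c4 - c1 \<le> m * d / 2"
  shows "\<exists>\<epsilon>>0. \<forall>x y \<tau>. 0 \<le> \<tau> \<longrightarrow> \<tau> \<le> \<epsilon> \<longrightarrow> nrm (x - v) \<le> \<rho> + d \<longrightarrow>
      f x + m * max 0 (nrm (x - v) - \<rho>) \<le> c4 \<longrightarrow> norm (y - grad x) \<le> min \<nu> \<mu> / 4 \<longrightarrow>
      (f x \<le> c1 \<longrightarrow> \<tau> = 0) \<longrightarrow>
      nrm (x - \<tau> *\<^sub>R y - v) \<le> \<rho> + d \<and> f (x - \<tau> *\<^sub>R y) + m * max 0 (nrm (x - \<tau> *\<^sub>R y - v) - \<rho>) \<le> c4 \<and>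
      (f x \<le> c2 \<longrightarrow> f (x - \<tau> *\<^sub>R y) \<le> c2)"
proof -
  define \<sigma> where "\<sigma> = min \<nu> \<mu>"
  have \<sigma>: "\<sigma> > 0" "\<sigma> \<le> \<nu>" "\<sigma> \<le> \<mu>" using pos by (auto simp: \<sigma>_def)
  define R where "R = norm v + (\<rho> + d) / sqrt lam"
  obtain G where G: "G \<ge> 0" "\<And>u. norm u \<le> R \<Longrightarrow> norm (grad u) \<le> G * norm u"
    using grad_linear_bound by blast
  \<comment> \<open>Bounds the direction y: \<open>G * \<bar>R\<bar>\<close> for the gradient, and
    \<sigma> for the deviation from it.\<close>
  define Y where "Y = G * \<bar>R\<bar> + \<sigma>"
  have Y: "Y > 0" using G(1) \<sigma> by (simp add: Y_def add_nonneg_pos)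
  obtain D where D: "D > 0" "\<And>u h. norm u \<le> R \<Longrightarrow> norm h \<le> D \<Longrightarrow>
      \<bar>f (u + h) - f u - inner (grad u) h\<bar> \<le> \<sigma> / 4 * norm h"
    using energy_taylor[of "\<sigma> / 4" R] \<sigma> by auto
  \<comment> \<open>Three caps on the length of the step: validity of the Taylor bound, star
    displacement at most d / 2, and a rise in energy of at most c4 - c3.\<close>
  define \<epsilon> where "\<epsilon> = min D (min (d / (2 * sqrt Lam)) ((c4 - c3) / Y)) / Y"
  have \<epsilon>: "\<epsilon> > 0" using D(1) Y pos(1) Lam_pos c by (simp add: \<epsilon>_def)
  have "nrm (x + h - v) \<le> \<rho> + d \<and> f (x + h) + m * max 0 (nrm (x + h - v) - \<rho>) \<le> c4 \<and>
      (f x \<le> c2 \<longrightarrow> f (x + h) \<le> c2)"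
    if \<tau>: "0 \<le> \<tau>" "\<tau> \<le> \<epsilon>" and x: "nrm (x - v) \<le> \<rho> + d" and J: "f x + m * max 0 (nrm (x - v) - \<rho>) \<le> c4"
      and y: "norm (y - grad x) \<le> \<sigma> / 4" and fr: "f x \<le> c1 \<longrightarrow> \<tau> = 0" and h: "h = - (\<tau> *\<^sub>R y)" for x y \<tau> h
  proof (cases "f x \<le> c1")
    case True
    then show ?thesis using fr x J by (simp add: h)
  next
    case False
    have m0: "m > 0" using m(1) pos Lam_pos by simp
    have xR: "norm x \<le> R" unfolding R_def by (rule norm_le_of_nrm_le[OF x])
    have fx4: "f x \<le> c4" using J m0 by (smt (verit) max.cobounded1 mult_nonneg_nonneg)
    have gx: "norm (grad x) \<le> Y - \<sigma>"
    proof -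
      have "norm (grad x) \<le> G * norm x" by (rule G(2)[OF xR])
      also have "\<dots> \<le> G * \<bar>R\<bar>" using xR G(1) by (intro mult_left_mono) auto
      finally show ?thesis by (simp add: Y_def)
    qed
    have yY: "norm y \<le> Y" using gx y norm_triangle_ineq2[of y "grad x"] \<sigma> by linarith
    have nh: "norm h \<le> \<epsilon> * Y"
      unfolding h using \<tau> yY \<epsilon> by (simp add: mult_mono)
    have eY: "\<epsilon> * Y = min D (min (d / (2 * sqrt Lam)) ((c4 - c3) / Y))" using Y by (simp add: \<epsilon>_def)
    have h1: "norm h \<le> D" and h2: "norm h \<le> d / (2 * sqrt Lam)" and h3: "norm h \<le> (c4 - c3) / Y"
      using nh unfolding eY by auto
    have nrmh: "nrm h \<le> sqrt Lam * norm h" by (rule nrm_le)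
    also have "\<dots> \<le> sqrt Lam * (d / (2 * sqrt Lam))" using h2 Lam_pos by (intro mult_left_mono) auto
    also have "\<dots> = d / 2" using Lam_pos by simp
    finally have disp: "nrm h \<le> d / 2" .
    have step: "nrm (x + h - v) \<le> nrm (x - v) + nrm h"
      using nrm_triangle[of "x - v" h] by (simp add: algebra_simps)
    have step': "nrm (x - v) \<le> nrm (x + h - v) + nrm h"
      using nrm_triangle[of "x + h - v" "- h"] by (simp add: nrm_minus)
    note taylor = D(2)[OF xR h1]
    have desc: "f (x + h) \<le> f x - \<sigma>' / 4 * norm h" if "\<sigma>' \<le> norm (grad x)" "\<sigma> \<le> \<sigma>'" for \<sigma>'
    proof (rule descent[OF that(1) _ \<tau>(1) _ h])
      show "norm (y - grad x) \<le> \<sigma>' / 4" using y that(2) by linarith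
      have "\<sigma> / 4 * norm h \<le> \<sigma>' / 4 * norm h" using that(2) by (intro mult_right_mono) auto
      then show "\<bar>f (x + h) - f x - inner (grad x) h\<bar> \<le> \<sigma>' / 4 * norm h" using taylor by linarith
    qed
    have desc0: "f (x + h) \<le> f x" if "\<sigma> \<le> norm (grad x)"
    proof -
      have "0 \<le> \<sigma> / 4 * norm h" using \<sigma> by simp
      then show ?thesis using desc[OF that] by linarith
    qed
    have near: "nrm (x - v) \<le> \<rho> + d / 2"
    proof -
      have "m * max 0 (nrm (x - v) - \<rho>) \<le> m * (d / 2)" using J m(2) False by (simp add: mult.commute)
      then have "max 0 (nrm (x - v) - \<rho>) \<le> d / 2" using m0 by (simp only: mult_le_cancel_left_pos)
      then show ?thesis using max.cobounded2[of "nrm (x - v) - \<rho>" 0] by linarith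
    qed
    then have A: "nrm (x + h - v) \<le> \<rho> + d" using step disp by linarith
    have C: "f (x + h) \<le> c2" if "f x \<le> c2"
    proof -
      have "\<nu> \<le> norm (grad x)" using low[OF x] False that by simp
      then show ?thesis using desc0 \<sigma> that by linarith
    qed
    have B: "f (x + h) + m * max 0 (nrm (x + h - v) - \<rho>) \<le> c4"
    proof (cases "nrm (x + h - v) \<le> \<rho>")
      case True
      have "f (x + h) \<le> c4"
      proof (cases "c3 \<le> f x")
        case True
        have "\<nu> \<le> norm (grad x)" using high[OF x True fx4] .
        then show ?thesis using desc0 \<sigma> fx4 by linarith
      next
        case False
        have "f (x + h) \<le> f x + inner (grad x) h + \<sigma> / 4 * norm h" using taylor by linarith
        also have "inner (grad x) h \<le> norm (grad x) * norm h" by (rule norm_cauchy_schwarz)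
        also have "\<dots> \<le> (Y - \<sigma>) * norm h" by (intro mult_right_mono gx) simp
        also have "f x + (Y - \<sigma>) * norm h + \<sigma> / 4 * norm h \<le> f x + Y * norm h"
          using \<sigma> by (simp add: algebra_simps)
        also have "Y * norm h \<le> Y * ((c4 - c3) / Y)" using h3 Y by (intro mult_left_mono) auto
        finally show ?thesis using False Y by simp
      qed
      then show ?thesis using True by simp
    next
      case out: False
      have "\<rho> - d \<le> nrm (x - v)"
        using out step disp pos(1) by linarith
      \<comment> \<open>Descent at the full rate \<mu> of the annulus, not at the smaller \<sigma>:
        m is \<mu> / 4 divided by \<open>sqrt Lam\<close>, so this loss offsets the growth of the
        penalty.\<close>
      from ann[OF this x fx4] have "f (x + h) \<le> f x - \<mu> / 4 * norm h" using desc \<sigma> by blast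
      moreover have "m * nrm h \<le> \<mu> / 4 * norm h"
      proof -
        have "m * nrm h \<le> m * (sqrt Lam * norm h)" using nrmh m0 by (intro mult_left_mono) auto
        also have "\<dots> = \<mu> / 4 * norm h" using Lam_pos by (simp add: m(1))
        finally show ?thesis .
      qed
      moreover have "m * max 0 (nrm (x + h - v) - \<rho>) \<le> m * max 0 (nrm (x - v) - \<rho>) + m * nrm h"
        unfolding distrib_left[symmetric] using step m0 nrm_nonneg[of h] by (intro mult_left_mono) auto
      ultimately show ?thesis using J by linarith
    qed
    show ?thesis using A B C by blast
  qed
  note key = this
  show ?thesis
  proof (intro exI[of _ \<epsilon>] conjI \<epsilon> allI impI)
    fix x y \<tau>
    assume *: "0 \<le> \<tau>" "\<tau> \<le> \<epsilon>" "nrm (x - v) \<le> \<rho> + d" "f x + m * max 0 (nrm (x - v) - \<rho>) \<le> c4"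
      "norm (y - grad x) \<le> min \<nu> \<mu> / 4" "f x \<le> c1 \<longrightarrow> \<tau> = 0"
    have "x + - (\<tau> *\<^sub>R y) = x - \<tau> *\<^sub>R y" by simp
    note k = key[OF *(1-4) *(5)[folded \<sigma>_def] *(6) refl, unfolded this]
    show "nrm (x - \<tau> *\<^sub>R y - v) \<le> \<rho> + d" "f (x - \<tau> *\<^sub>R y) + m * max 0 (nrm (x - \<tau> *\<^sub>R y - v) - \<rho>) \<le> c4"
      "f x \<le> c2 \<Longrightarrow> f (x - \<tau> *\<^sub>R y) \<le> c2"
      using k by blast+
  qed
qed

end

section \<open>A chain lemma for coverings of a grid cube\<close>

definition grid_vertex :: "nat \<Rightarrow> nat \<Rightarrow> (nat \<Rightarrow> nat) \<Rightarrow> bool" where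
  "grid_vertex k n x \<longleftrightarrow> (\<forall>j<k. x j \<le> n)"

text \<open>All coordinates may move at once, so any two corners of a unit cell are adjacent;
  coordinates from k on are ignored.\<close>

definition grid_adjacent :: "nat \<Rightarrow> (nat \<Rightarrow> nat) \<Rightarrow> (nat \<Rightarrow> nat) \<Rightarrow> bool" where
  "grid_adjacent k x y \<longleftrightarrow> (\<forall>j<k. x j \<le> y j + 1 \<and> y j \<le> x j + 1)"

definition grid_edges :: "nat \<Rightarrow> nat \<Rightarrow> ((nat \<Rightarrow> nat) \<Rightarrow> bool) \<Rightarrow> ((nat \<Rightarrow> nat) \<times> (nat \<Rightarrow> nat)) set" where
  "grid_edges k n P =
     {(x, y). grid_vertex k n x \<and> grid_vertex k n y \<and> P x \<and> P y \<and> grid_adjacent k x y}"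

text \<open>Label a vertex in direction \<open>i\<close> by whether it can be reached from the face \<open>x i = 0\<close> inside
  \<open>P i\<close>; if no opposite face can be reached, Kuhn's lemma yields a cell on which every label changes.\<close>

lemma grid_chain_between_faces:
  assumes "0 < n"
    and cover: "\<And>x. grid_vertex k n x \<Longrightarrow> \<exists>i<k. \<forall>y. grid_vertex k n y \<longrightarrow> grid_adjacent k x y \<longrightarrow> P i y"
  shows "\<exists>i<k. \<exists>x y. grid_vertex k n x \<and> grid_vertex k n y \<and> x i = 0 \<and> y i = n \<and> P i x \<and>
    (x, y) \<in> (grid_edges k n (P i))\<^sup>*"
proof (rule ccontr)
  assume contra: "\<not> ?thesis"
  define reach where "reach i x \<longleftrightarrow>
    (\<exists>z. grid_vertex k n z \<and> z i = 0 \<and> P i z \<and> (z, x) \<in> (grid_edges k n (P i))\<^sup>*)" for i x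
  \<comment> \<open>Vertices on the face \<open>x i = 0\<close> get 0 even outside
    \<open>P i\<close>, as the boundary condition of Kuhn's lemma demands.\<close>
  define label where "label x i = (if x i = 0 \<or> reach i x then 0 else 1 :: nat)" for x i
  have "label x i = 1" if "\<forall>i<k. x i \<le> n" "i < k" "x i = n" for x i
  proof -
    have "grid_vertex k n x" using that(1) by (simp add: grid_vertex_def)
    then have "\<not> reach i x" using contra that(2,3) unfolding reach_def by blast
    then show ?thesis using that(3) \<open>0 < n\<close> by (simp add: label_def)
  qed
  then have l2: "\<forall>x. (\<forall>i<k. x i \<le> n) \<longrightarrow> (\<forall>i<k. x i = n \<longrightarrow> label x i = 1)" by blast
  have l0: "\<forall>x. (\<forall>i<k. x i \<le> n) \<longrightarrow> (\<forall>i<k. label x i = (0::nat) \<or> label x i = 1)"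
    and l1: "\<forall>x. (\<forall>i<k. x i \<le> n) \<longrightarrow> (\<forall>i<k. x i = 0 \<longrightarrow> label x i = 0)"
    by (auto simp: label_def)
  obtain q where q: "\<forall>i<k. q i < n" and cell: "\<forall>i<k. \<exists>r s. (\<forall>j<k. q j \<le> r j \<and> r j \<le> q j + 1) \<and>
      (\<forall>j<k. q j \<le> s j \<and> s j \<le> q j + 1) \<and> label r i \<noteq> label s i"
    by (rule kuhn_lemma[OF \<open>0 < n\<close> l0 l1 l2])
  have "grid_vertex k n q" using q by (auto simp: grid_vertex_def)
  \<comment> \<open>With the covering direction of the base corner, \<open>P i\<close> holds on the
    whole cell, so \<open>reach\<close> passes from a corner labelled 0 to one labelled 1.\<close>
  from cover[OF this] obtain i where i: "i < k"
    "\<And>y. grid_vertex k n y \<Longrightarrow> grid_adjacent k q y \<Longrightarrow> P i y" by blast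
  obtain r s where "\<forall>j<k. q j \<le> r j \<and> r j \<le> q j + 1" "\<forall>j<k. q j \<le> s j \<and> s j \<le> q j + 1"
    "label r i \<noteq> label s i" using cell i(1) by blast
  moreover have False if rs: "\<forall>j<k. q j \<le> r j \<and> r j \<le> q j + 1" "\<forall>j<k. q j \<le> s j \<and> s j \<le> q j + 1"
    "label r i = 0" "label s i \<noteq> 0" for r s
  proof -
    have v: "grid_vertex k n r" "grid_vertex k n s"
      using rs(1,2) q by (force simp: grid_vertex_def)+
    have adj: "grid_adjacent k q r" "grid_adjacent k q s" "grid_adjacent k r s"
      using rs(1,2) by (force simp: grid_adjacent_def)+
    have P: "P i r" "P i s" using i(2) v adj by blast+
    have "reach i r"
    proof (cases "reach i r")
      case False
      then have "r i = 0" using rs(3) by (simp add: label_def split: if_splits)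
      then show ?thesis using v P unfolding reach_def by blast
    qed
    moreover have "(r, s) \<in> grid_edges k n (P i)" using v P adj by (simp add: grid_edges_def)
    ultimately have "reach i s" unfolding reach_def by (meson rtrancl.rtrancl_into_rtrancl)
    then show False using rs(4) by (simp add: label_def)
  qed
  ultimately show False unfolding label_def by (metis (full_types) zero_neq_one)
qed

section \<open>Positions of the bumps\<close>

text \<open>Clears the denominators: the midpoint conditions become integer inequalities in 2 t,
  open to linear arithmetic.\<close>

lemma mem_bump_interval:
  "t \<in> bump_interval p i \<longleftrightarrow>
    (0 < i \<longrightarrow> p ! (i - 1) + p ! i < 2 * t) \<and> (Suc i < length p \<longrightarrow> 2 * t \<le> p ! i + p ! Suc i)"
proof -
  have "(real_of_int a + real_of_int b) / 2 < real_of_int t \<longleftrightarrow> real_of_int (a + b) < real_of_int (2 * t)" for a b t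
    unfolding of_int_add of_int_mult by auto
  moreover have "real_of_int t \<le> (real_of_int a + real_of_int b) / 2 \<longleftrightarrow> real_of_int (2 * t) \<le> real_of_int (a + b)" for a b t
    unfolding of_int_add of_int_mult by auto
  ultimately show ?thesis unfolding of_int_less_iff of_int_le_iff by (simp add: bump_interval_def)
qed

locale bump_train_positions =
  fixes p :: "int list" and W :: int
  assumes nonempty: "p \<noteq> []" and W_nonneg: "W \<ge> 0"
    and gap: "\<And>i. Suc i < length p \<Longrightarrow> p ! Suc i - p ! i \<ge> 2 * W + 2"
begin

abbreviation I where "I \<equiv> bump_interval p"

lemma positions_mono: "i \<le> j \<Longrightarrow> j < length p \<Longrightarrow> p ! i \<le> p ! j"
proof (induction j)
  case (Suc j)
  show ?case
  proof (cases "i = Suc j")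
    case False
    then have "p ! i \<le> p ! j" using Suc by simp
    then show ?thesis using gap[of j] Suc.prems W_nonneg by simp
  qed simp
qed simp

lemma intervals_disjoint:
  assumes "i < length p" "j < length p" "t \<in> I i" "t \<in> I j"
  shows "i = j"
proof -
  have "\<not> i < j" if "j < length p" "t \<in> I i" "t \<in> I j" for i j
  proof
    assume "i < j"
    then have "p ! i \<le> p ! (j - 1)" "p ! Suc i \<le> p ! j"
      using positions_mono that(1) by (simp_all add: Suc_leI)
    then show False using that \<open>i < j\<close> by (simp add: mem_bump_interval)
  qed
  then show ?thesis using assms by (meson linorder_neqE_nat)
qed

lemma intervals_cover: "\<exists>i<length p. t \<in> I i"
proof -
  \<comment> \<open>The least index whose right end is not yet passed is the one sought; minimality
    supplies the left condition.\<close>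
  define P where "P i \<longleftrightarrow> i < length p \<and> (Suc i < length p \<longrightarrow> 2 * t \<le> p ! i + p ! Suc i)" for i
  have "P (length p - 1)" using nonempty by (simp add: P_def)
  define i where "i = (LEAST i. P i)"
  have P: "P i" unfolding i_def by (rule LeastI) fact
  have "p ! (i - 1) + p ! i < 2 * t" if "0 < i"
  proof -
    have "\<not> P (i - 1)" using not_less_Least[of "i - 1" P] that by (simp add: i_def)
    moreover have "i - 1 < length p" "Suc (i - 1) = i" using P that by (auto simp: P_def)
    ultimately show ?thesis using P by (simp add: P_def)
  qed
  then show ?thesis using P by (auto simp: P_def mem_bump_interval)
qed

lemma interval_contains:
  assumes "i < length p" "\<bar>t - p ! i\<bar> \<le> W"
  shows "t \<in> I i"
proof -
  have "p ! i - p ! (i - 1) \<ge> 2 * W + 2" if "0 < i" using gap[of "i - 1"] that assms(1) by simp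
  then show ?thesis using gap[of i] assms(2) by (auto simp: mem_bump_interval)
qed

text \<open>The site before a cut is the floor of a midpoint, and both sites next to the cut are at
  least W away from the two adjacent bumps, hence from all. For the first and the last interval one
  entry of the set is meaningless; the set serves only as a list of at most two candidates.\<close>

lemma interval_crossing:
  assumes "i < length p" "(t \<in> I i) \<noteq> (t + 1 \<in> I i)"
  shows "t \<in> {(p ! (i - 1) + p ! i) div 2, (p ! i + p ! Suc i) div 2}"
    and "j < length p \<Longrightarrow> \<bar>t - p ! j\<bar> \<ge> W" and "j < length p \<Longrightarrow> \<bar>t + 1 - p ! j\<bar> \<ge> W"
proof -
  have far: "\<bar>t - p ! j\<bar> \<ge> W \<and> \<bar>t + 1 - p ! j\<bar> \<ge> W"
    if l: "Suc l < length p" "2 * t \<le> p ! l + p ! Suc l" "p ! l + p ! Suc l < 2 * t + 2"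
      and j: "j < length p" for l j
  proof (cases "j \<le> l")
    case True
    then have "p ! j \<le> p ! l" using positions_mono l(1) by simp
    then show ?thesis using gap[OF l(1)] l(2,3) by linarith
  next
    case False
    then have "p ! Suc l \<le> p ! j" using positions_mono j by simp
    then show ?thesis using gap[OF l(1)] l(2,3) by linarith
  qed
  consider "Suc i < length p" "2 * t \<le> p ! i + p ! Suc i" "p ! i + p ! Suc i < 2 * t + 2"
    | "0 < i" "2 * t \<le> p ! (i - 1) + p ! i" "p ! (i - 1) + p ! i < 2 * t + 2"
    using assms by (auto simp: mem_bump_interval)
  then have "t \<in> {(p ! (i - 1) + p ! i) div 2, (p ! i + p ! Suc i) div 2} \<and>
    (j < length p \<longrightarrow> \<bar>t - p ! j\<bar> \<ge> W \<and> \<bar>t + 1 - p ! j\<bar> \<ge> W)"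
  proof cases
    case 1
    have "t = (p ! i + p ! Suc i) div 2" using 1(2,3) by linarith
    with far[OF 1] show ?thesis by blast
  next
    case 2
    have "t = (p ! (i - 1) + p ! i) div 2" using 2(2,3) by linarith
    with far[of "i - 1" j] 2 assms(1) show ?thesis by simp
  qed
  then show "t \<in> {(p ! (i - 1) + p ! i) div 2, (p ! i + p ! Suc i) div 2}"
    "j < length p \<Longrightarrow> \<bar>t - p ! j\<bar> \<ge> W" "j < length p \<Longrightarrow> \<bar>t + 1 - p ! j\<bar> \<ge> W" by blast+
qed

definition pdist :: "int \<Rightarrow> int" where "pdist t = Min ((\<lambda>j. \<bar>t - p ! j\<bar>) ` {..<length p})"

lemma pdist_le: "j < length p \<Longrightarrow> pdist t \<le> \<bar>t - p ! j\<bar>"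
  unfolding pdist_def by (rule Min_le) auto

lemma pdist_geI: "(\<And>j. j < length p \<Longrightarrow> a \<le> \<bar>t - p ! j\<bar>) \<Longrightarrow> a \<le> pdist t"
  unfolding pdist_def using nonempty by (intro Min.boundedI) auto

lemma pdist_lipschitz: "\<bar>t - t'\<bar> \<le> 1 \<Longrightarrow> pdist t - 1 \<le> pdist t'"
proof (rule pdist_geI)
  fix j assume "\<bar>t - t'\<bar> \<le> 1" "j < length p"
  then show "pdist t - 1 \<le> \<bar>t' - p ! j\<bar>" using pdist_le[of j t] by linarith
qed

lemma sum_restrict_intervals: "(\<Sum>i<length p. l2_restrict (I i) u) = u"
proof (rule l2_eqI)
  fix t
  obtain i where i: "i < length p" "t \<in> I i" using intervals_cover by blast
  have "l2_nth (\<Sum>j<length p. l2_restrict (I j) u) t = (\<Sum>j<length p. if j = i then l2_nth u t else 0)"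
    unfolding l2_nth_sum by (intro sum.cong) (use i intervals_disjoint in auto)
  then show "l2_nth (\<Sum>j<length p. l2_restrict (I j) u) t = l2_nth u t" using i by simp
qed

end

text \<open>The half-width W = N^2 + 2 N - 1 solves 2 W + 2 = 2 N^2 + 4 N, the prescribed spacing;
  the 2 covers the rounding of midpoints.\<close>

lemma bump_positions_train:
  assumes "p \<in> bump_positions T k N" "k > 0" "N > 0"
  shows "bump_train_positions p ((int N)\<^sup>2 + 2 * int N - 1)" "length p = k"
    "\<And>i. i < k \<Longrightarrow> int T dvd p ! i"
proof -
  have p: "length p = k" "\<And>i. i < k \<Longrightarrow> int T dvd p ! i"
    "\<And>i. Suc i < k \<Longrightarrow> p ! Suc i - p ! i \<ge> 2 * (int N)\<^sup>2 + 4 * int N"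
    using assms(1) by (auto simp: bump_positions_def)
  show "length p = k" "\<And>i. i < k \<Longrightarrow> int T dvd p ! i" by fact+
  show "bump_train_positions p ((int N)\<^sup>2 + 2 * int N - 1)"
  proof
    show "p \<noteq> []" using p(1) assms(2) by auto
    show "0 \<le> (int N)\<^sup>2 + 2 * int N - 1"
      using assms(3) zero_less_power[of "int N" 2] by linarith
    show "2 * ((int N)\<^sup>2 + 2 * int N - 1) + 2 \<le> p ! Suc i - p ! i" if "Suc i < length p" for i
      using p(3)[of i] that p(1) by simp
  qed
qed

section \<open>Locality of the gradient\<close>

context lattice_equation
begin

text \<open>Restriction commutes with multiplication by L and, as V' vanishes at 0, with the
  superposition term. What remains are neighbour values across a cut: at most two per site, each at
  most \<delta>, on the at most four sites next to two cuts; hence 8 \<delta>.\<close>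

lemma grad_restrict_error:
  assumes C: "finite C" "card C \<le> 2" "\<And>t. (t \<in> A) \<noteq> (t + 1 \<in> A) \<Longrightarrow> t \<in> C"
    and small: "\<And>t. (t \<in> A) \<noteq> (t + 1 \<in> A) \<Longrightarrow> norm (l2_nth u t) \<le> \<delta> \<and> norm (l2_nth u (t + 1)) \<le> \<delta>"
    and "\<delta> \<ge> 0"
  shows "norm (l2_restrict A (grad u) - grad (l2_restrict A u)) \<le> 8 * \<delta>"
proof -
  define B where "B = C \<union> (\<lambda>t. t + 1) ` C"
  define z where "z = l2_restrict A (grad u) - grad (l2_restrict A u)"
  define jump where "jump t t' = (if (t \<in> A) \<noteq> (t' \<in> A) then l2_nth u t' else 0)" for t t'
  have z: "l2_nth z t = (if t \<in> A then - 1 else 1) *\<^sub>R (jump t (t - 1) + jump t (t + 1))" for t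
    by (simp add: z_def l2_nth_grad jump_def V'_0)
  have jump: "norm (jump t (t - 1)) \<le> \<delta>" "norm (jump t (t + 1)) \<le> \<delta>" for t
    using small[of t] small[of "t - 1"] \<open>\<delta> \<ge> 0\<close> by (auto simp: jump_def)
  have "card B \<le> card C + card ((\<lambda>t. t + 1) ` C)" unfolding B_def by (rule card_Un_le)
  also have "\<dots> \<le> 4" using C(2) card_image_le[OF C(1), of "\<lambda>t. t + 1"] by simp
  finally have card: "card B \<le> 4" .
  have "norm z \<le> real (card B) * (2 * \<delta>)"
  proof (rule norm_l2_finite_support_le)
    show "finite B" using C(1) by (simp add: B_def)
    show "l2_nth z t = 0" if "t \<notin> B" for t
    proof -
      have "t \<notin> C" "t - 1 \<notin> C" using that by (force simp: B_def)+
      then have "(t \<in> A) = (t + 1 \<in> A)" "(t - 1 \<in> A) = (t \<in> A)" using C(3)[of t] C(3)[of "t - 1"] by auto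
      then show ?thesis by (simp add: z jump_def)
    qed
    show "norm (l2_nth z t) \<le> 2 * \<delta>" for t
      using norm_triangle_ineq[of "jump t (t - 1)" "jump t (t + 1)"] jump[of t] by (simp add: z)
  qed
  also have "\<dots> \<le> 4 * (2 * \<delta>)" using card \<open>\<delta> \<ge> 0\<close> by (intro mult_right_mono) auto
  finally show ?thesis by (simp add: z_def)
qed

text \<open>The discrete maximum principle behind the exponential barrier.\<close>

lemma site_step:
  assumes s: "\<And>t x. norm x \<le> s \<Longrightarrow> norm (V' t x) \<le> lam / 4 * norm x"
    and x: "norm x \<le> s" "norm x \<le> \<beta>" and y: "norm y \<le> (1 + lam / 4) * \<beta>" and z: "norm z \<le> (1 + lam / 4) * \<beta>"
    and \<tau>: "0 \<le> \<tau>" "\<tau> * Lam\<^sup>2 \<le> lam / 2" "\<tau> * (2 + 3 * lam / 4) \<le> 1"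
  shows "norm (x - \<tau> *\<^sub>R (2 *\<^sub>R x - y - z + L t *v x - V' t x)) \<le> \<beta>"
proof -
  define B where "B = 2 *\<^sub>R x + L t *v x"
  have B: "norm B \<le> Lam * norm x"
    using norm_triangle_ineq[of "2 *\<^sub>R x" "L t *v x"] norm_L_le[of t x]
    by (simp add: B_def Lam_def algebra_simps) (use norm_ge_zero[of x] in linarith)
  have xB: "inner x B \<ge> (2 + lam) * (norm x)\<^sup>2"
    using lam_le[of x t] by (simp add: B_def inner_add_right power2_norm_eq_inner algebra_simps)
  \<comment> \<open>Contraction factor of the diagonal part. The second-order term of the square
    costs at most \<tau> lam / 2, so the rate 2 + lam drops to 2 + 3 lam / 4.\<close>
  define q where "q = 1 - \<tau> * (2 + 3 * lam / 4)"
  have q: "q \<ge> 0" using \<tau> by (simp add: q_def)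
  have "(norm (x - \<tau> *\<^sub>R B))\<^sup>2 = (norm x)\<^sup>2 - 2 * \<tau> * inner x B + \<tau>\<^sup>2 * (norm B)\<^sup>2"
    unfolding power2_norm_eq_inner
    by (simp add: inner_diff_left inner_diff_right inner_commute[of B x] power2_eq_square algebra_simps)
  also have "\<dots> \<le> (norm x)\<^sup>2 - 2 * \<tau> * ((2 + lam) * (norm x)\<^sup>2) + \<tau>\<^sup>2 * (Lam * norm x)\<^sup>2"
    using xB B \<tau>(1) by (intro add_mono diff_mono mult_left_mono power_mono) auto
  also have "\<dots> = (norm x)\<^sup>2 * (1 - 2 * \<tau> * (2 + lam) + \<tau> * (\<tau> * Lam\<^sup>2))"
    by (simp add: power2_eq_square algebra_simps)
  also have "\<dots> \<le> (norm x)\<^sup>2 * q\<^sup>2"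
  proof (rule mult_left_mono)
    have "\<tau> * (\<tau> * Lam\<^sup>2) \<le> \<tau> * (lam / 2)" using \<tau> by (intro mult_left_mono) auto
    moreover have "q\<^sup>2 = 1 - 2 * (\<tau> * (2 + 3 * lam / 4)) + (\<tau> * (2 + 3 * lam / 4))\<^sup>2"
      unfolding q_def power2_diff by simp
    moreover have "2 * (\<tau> * (2 + 3 * lam / 4)) = 4 * \<tau> + 3 / 2 * (\<tau> * lam)"
      "\<tau> * (lam / 2) = \<tau> * lam / 2" "2 * \<tau> * (2 + lam) = 4 * \<tau> + 2 * (\<tau> * lam)"
      by (simp_all add: algebra_simps)
    moreover have "1 - (4 * x + 2 * y) + w \<le> 1 - (4 * x + 3 / 2 * y) + z\<^sup>2" if "w \<le> y / 2" for w x y z :: real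
      using that zero_le_power2[of z] by linarith
    ultimately show "1 - 2 * \<tau> * (2 + lam) + \<tau> * (\<tau> * Lam\<^sup>2) \<le> q\<^sup>2" by metis
  qed simp
  finally have "(norm (x - \<tau> *\<^sub>R B))\<^sup>2 \<le> (q * norm x)\<^sup>2" by (simp add: power_mult_distrib mult.commute)
  then have 1: "norm (x - \<tau> *\<^sub>R B) \<le> q * norm x" by (rule power2_le_imp_le) (use q in simp)
  have 2: "norm (\<tau> *\<^sub>R (y + z + V' t x)) \<le> \<tau> * (2 * ((1 + lam / 4) * \<beta>) + lam / 4 * norm x)"
  proof -
    have "norm (y + z + V' t x) \<le> norm y + norm z + norm (V' t x)" by norm
    also have "\<dots> \<le> 2 * ((1 + lam / 4) * \<beta>) + lam / 4 * norm x" using y z s[OF x(1), of t] by linarith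
    finally show ?thesis using \<tau>(1) by (simp add: mult_left_mono)
  qed
  have "x - \<tau> *\<^sub>R (2 *\<^sub>R x - y - z + L t *v x - V' t x) = (x - \<tau> *\<^sub>R B) + \<tau> *\<^sub>R (y + z + V' t x)"
    by (simp add: B_def algebra_simps)
  also have "norm \<dots> \<le> q * norm x + \<tau> * (2 * ((1 + lam / 4) * \<beta>) + lam / 4 * norm x)"
    using norm_triangle_ineq 1 2 by (meson add_mono order_trans)
  \<comment> \<open>The balance that fixes the barrier: the two neighbours contribute 2 (1 + lam /
    4) = 2 + lam / 2, and the site still decays at 2 + 3 lam / 4 - lam / 4, the same number, after
    the nonlinear term.\<close>
  also have "\<dots> = (1 - \<tau> * (2 + lam / 2)) * norm x + \<tau> * (2 + lam / 2) * \<beta>"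
    by (simp add: q_def algebra_simps)
  also have "\<dots> \<le> (1 - \<tau> * (2 + lam / 2)) * \<beta> + \<tau> * (2 + lam / 2) * \<beta>"
  proof (intro add_right_mono mult_left_mono x)
    have "\<tau> * (2 + lam / 2) \<le> \<tau> * (2 + 3 * lam / 4)" using \<tau>(1) lam_pos by (intro mult_left_mono) auto
    then show "0 \<le> 1 - \<tau> * (2 + lam / 2)" using \<tau>(3) by linarith
  qed
  also have "\<dots> = \<beta>" by (simp add: algebra_simps)
  finally show ?thesis .
qed

end

section \<open>The Euler map and the multibump critical point\<close>

text \<open>Provides a compact set containing the whole glued surface: the parameters enter through
  independent summands, which avoids a topology on the cube of parameter functions.\<close>

lemma compact_sum_of_compacts:
  fixes A :: "nat \<Rightarrow> 'a::real_normed_vector set"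
  assumes "\<And>i. i < n \<Longrightarrow> compact (A i)"
  shows "compact {\<Sum>i<n. y i | y. \<forall>i<n. y i \<in> A i}"
  using assms
proof (induction n)
  case 0
  then show ?case by simp
next
  case (Suc n)
  let ?K = "{\<Sum>i<n. y i | y. \<forall>i<n. y i \<in> A i}"
  have "{\<Sum>i<Suc n. y i | y. \<forall>i<Suc n. y i \<in> A i} = {a + b | a b. a \<in> ?K \<and> b \<in> A n}" (is "?l = ?r")
  proof
    show "?l \<subseteq> ?r" by force
    show "?r \<subseteq> ?l"
    proof
      fix z assume "z \<in> ?r"
      then obtain y b where *: "z = (\<Sum>i<n. y i) + b" "\<forall>i<n. y i \<in> A i" "b \<in> A n" by blast
      have "z = (\<Sum>i<Suc n. (y(n := b)) i)" using *(1) by simp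
      moreover have "\<forall>i<Suc n. (y(n := b)) i \<in> A i" using * by (simp add: less_Suc_eq)
      ultimately show "z \<in> ?l" by blast
    qed
  qed
  moreover have "compact ?r"
    using Suc by (intro compact_sums) simp_all
  ultimately show ?case by (simp only:)
qed

context lattice_equation
begin

lemma nrm_power2_sum:
  shows "(\<lambda>t. (norm (bdiff (l2_nth u) t))\<^sup>2 + inner (l2_nth u t) (L t *v l2_nth u t)) summable_on UNIV"
    and "(nrm u)\<^sup>2 = (\<Sum>\<^sub>\<infinity>t. (norm (bdiff (l2_nth u) t))\<^sup>2 + inner (l2_nth u t) (L t *v l2_nth u t))"
proof -
  have 1: "(\<lambda>t. (norm (bdiff (l2_nth u) t))\<^sup>2) summable_on UNIV"
    using l2_nth_summable[of "u - l2_shift 1 u"] by (simp add: bdiff_def)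
  have 2: "(\<lambda>t. inner (l2_nth u t) (L t *v l2_nth u t)) summable_on UNIV"
    using l2_inner_summable[of u "Lmul u"] by simp
  show "(\<lambda>t. (norm (bdiff (l2_nth u) t))\<^sup>2 + inner (l2_nth u t) (L t *v l2_nth u t)) summable_on UNIV"
    by (rule summable_on_add[OF 1 2])
  show "(nrm u)\<^sup>2 = (\<Sum>\<^sub>\<infinity>t. (norm (bdiff (l2_nth u) t))\<^sup>2 + inner (l2_nth u t) (L t *v l2_nth u t))"
    unfolding nrm_power2 inner_star_eq[symmetric] inner_star_def infsum_add[OF 1 2]
    by (simp add: power2_norm_eq_inner)
qed

text \<open>Lower semicontinuity in the manner of Fatou: the squared norm is one sum of nonnegative
  terms, each involving two sites only, and finite partial sums pass to the limit.\<close>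

lemma nrm_pointwise_limit_le:
  assumes lim: "\<And>t. (\<lambda>m. l2_nth (u m) t) \<longlonglongrightarrow> l2_nth v t" and le: "\<And>m. nrm (u m) \<le> r"
  shows "nrm v \<le> r"
proof -
  have r: "r \<ge> 0" using le[of 0] nrm_nonneg order_trans by blast
  define h where "h u t = (norm (bdiff (l2_nth u) t))\<^sup>2 + inner (l2_nth u t) (L t *v l2_nth u t)"
    for u :: "'n space" and t
  have "(nrm v)\<^sup>2 = infsum (h v) UNIV" "h v summable_on UNIV"
    using nrm_power2_sum[of v] unfolding h_def by simp_all
  moreover have "infsum (h v) UNIV \<le> r\<^sup>2"
  proof (rule infsum_le_finite_sums)
    fix F :: "int set" assume F: "finite F"
    show "sum (h v) F \<le> r\<^sup>2"
    proof (rule LIMSEQ_le_const2)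
      show "(\<lambda>m. sum (h (u m)) F) \<longlonglongrightarrow> sum (h v) F"
        unfolding h_def bdiff_def
        by (intro tendsto_intros lim tendsto_compose[OF matrix_vector_mul_bounded_linear[THEN
              bounded_linear.isCont, unfolded isCont_def]])
      have "sum (h (u m)) F \<le> r\<^sup>2" for m
      proof -
        have "sum (h (u m)) F \<le> infsum (h (u m)) UNIV"
          using nrm_power2_sum(1)[of "u m"] F unfolding h_def
          by (intro finite_sum_le_infsum) (auto intro!: add_nonneg_nonneg inner_L_nonneg)
        also have "\<dots> = (nrm (u m))\<^sup>2" unfolding h_def nrm_power2_sum(2) ..
        also have "\<dots> \<le> r\<^sup>2" by (intro power_mono le) simp
        finally show ?thesis .
      qed
      then show "\<exists>N. \<forall>m\<ge>N. sum (h (u m)) F \<le> r\<^sup>2" by blast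
    qed
  qed fact
  ultimately have "(nrm v)\<^sup>2 \<le> r\<^sup>2" by simp
  then show ?thesis using r by (rule power2_le_imp_le)
qed

end

text \<open>The level windows \<open>[c1, c2]\<close> and \<open>[c3, c4]\<close> lie below and above the local minimax level.\<close>

locale bump_profile = lattice_equation L V V' T
  for L :: "int \<Rightarrow> real^'n^'n" and V V' T +
  fixes v :: "(real^'n) l2seq" and \<rho> d c1 c2 c3 c4 \<nu> \<mu> s :: real and N0 :: nat
  assumes d_pos: "d > 0" and \<nu>_pos: "\<nu> > 0" and \<mu>_pos: "\<mu> > 0"
    and levels: "c1 < c2" "c3 < c4"
    and low: "\<And>x. nrm (x - v) \<le> \<rho> + d \<Longrightarrow> c1 \<le> f x \<Longrightarrow> f x \<le> c2 \<Longrightarrow> \<nu> \<le> norm (grad x)"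
    and high: "\<And>x. nrm (x - v) \<le> \<rho> + d \<Longrightarrow> c3 \<le> f x \<Longrightarrow> f x \<le> c4 \<Longrightarrow> \<nu> \<le> norm (grad x)"
    and ann: "\<And>x. \<rho> - d \<le> nrm (x - v) \<Longrightarrow> nrm (x - v) \<le> \<rho> + d \<Longrightarrow> f x \<le> c4 \<Longrightarrow> \<mu> \<le> norm (grad x)"
    and level_gap: "c4 - c1 \<le> \<mu> / (4 * sqrt Lam) * d / 2"
    and s_pos: "s > 0" and s_small: "\<And>t x. norm x \<le> s \<Longrightarrow> norm (V' t x) \<le> lam / 4 * norm x"
    and tail: "\<And>u t. nrm (u - v) \<le> \<rho> + d \<Longrightarrow> \<bar>t\<bar> \<ge> int N0 \<Longrightarrow> norm (l2_nth u t) \<le> s"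
begin

text \<open>Energy lost per unit of star distance in the annulus: \<open>descent\<close> guarantees
  \<mu> / 4 per unit of plain distance, and \<open>sqrt Lam\<close> compares the norms.\<close>

definition slope :: real where "slope = \<mu> / (4 * sqrt Lam)"

text \<open>A sublevel set with a penalty for leaving radius \<rho>; a plain sublevel set
  intersected with a ball need not be invariant.\<close>

definition well :: "'n space \<Rightarrow> bool" where
  "well x \<longleftrightarrow> nrm (x - v) \<le> \<rho> + d \<and> f x + slope * max 0 (nrm (x - v) - \<rho>) \<le> c4"

lemma well_step:
  "\<exists>\<epsilon>>0. \<forall>x y \<tau>. 0 \<le> \<tau> \<longrightarrow> \<tau> \<le> \<epsilon> \<longrightarrow> well x \<longrightarrow> norm (y - grad x) \<le> min \<nu> \<mu> / 4 \<longrightarrow>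
    (f x \<le> c1 \<longrightarrow> \<tau> = 0) \<longrightarrow> well (x - \<tau> *\<^sub>R y) \<and> (f x \<le> c2 \<longrightarrow> f (x - \<tau> *\<^sub>R y) \<le> c2)"
  using block_step[OF d_pos \<nu>_pos \<mu>_pos levels low high ann refl level_gap]
  unfolding well_def slope_def by blast

end

text \<open>\<open>N_small\<close> is the quantitative demand on N: the cut error of
  \<open>grad_restrict_error\<close>, with the barrier value at the cuts, has to fit the tolerance
  of \<open>block_step\<close>. It does not mention p, so one N serves every train.\<close>

locale bump_train = bump_profile L V V' T v \<rho> d c1 c2 c3 c4 \<nu> \<mu> s N0
    + bump_train_positions p "(int N)\<^sup>2 + 2 * int N - 1"
  for L :: "int \<Rightarrow> real^'n^'n" and V V' T and v :: "(real^'n) l2seq" and \<rho> d c1 c2 c3 c4 \<nu> \<mu> s N0 p N +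
  assumes p_dvd: "\<And>i. i < length p \<Longrightarrow> int T dvd p ! i"
    and N_ge: "N0 \<le> N" "0 < N" and N_small: "8 * (s * (1 / (1 + lam / 4)) ^ N) \<le> min \<nu> \<mu> / 4"
begin

section \<open>Blocks, barrier and the Euler map\<close>

definition blk :: "nat \<Rightarrow> 'n space \<Rightarrow> 'n space" where
  "blk i u = l2_shift (- (p ! i)) (l2_restrict (I i) u)"

definition near :: "'n space \<Rightarrow> bool" where
  "near u \<longleftrightarrow> (\<forall>i<length p. nrm (blk i u - v) \<le> \<rho> + d)"

text \<open>\<open>nat\<close> cuts off negative exponents: up to distance N0 from the bumps the
  barrier is the constant s, and from there it decays geometrically.\<close>

definition barrier :: "int \<Rightarrow> real" where
  "barrier t = s * (1 / (1 + lam / 4)) ^ nat (pdist t - int N0)"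

definition zone :: "'n space \<Rightarrow> bool" where
  "zone u \<longleftrightarrow> (\<forall>t. pdist t > int N0 \<longrightarrow> norm (l2_nth u t) \<le> barrier t)"

text \<open>A ramp from 0 at c1 to 1 at c2. Its continuity makes the Euler map continuous, and a
  block at or below c1 rests exactly.\<close>

definition weight :: "real \<Rightarrow> real" where
  "weight x = max 0 (min 1 ((x - c1) / (c2 - c1)))"

definition euler :: "real \<Rightarrow> 'n space \<Rightarrow> 'n space" where
  "euler \<epsilon> u = u - (\<Sum>i<length p. (\<epsilon> * weight (f (blk i u))) *\<^sub>R l2_restrict (I i) (grad u))"

lemma weight_bounds: "0 \<le> weight x" "weight x \<le> 1"
  by (auto simp: weight_def)

lemma weight_low: "x \<le> c1 \<Longrightarrow> weight x = 0"
  using levels by (auto simp: weight_def divide_nonpos_pos min_def)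

lemma weight_high: "c2 \<le> x \<Longrightarrow> weight x = 1"
  using levels by (auto simp: weight_def)

lemma l2_nth_blk: "l2_nth (blk i u) t = (if t + p ! i \<in> I i then l2_nth u (t + p ! i) else 0)"
  by (simp add: blk_def)

lemma continuous_on_blk: "continuous_on S (blk i)"
  unfolding blk_def[abs_def] by (intro continuous_intros)

lemma continuous_on_euler: "continuous_on S (euler \<epsilon>)"
  unfolding euler_def[abs_def] weight_def
  by (intro continuous_intros continuous_on_grad continuous_on_compose2[OF continuous_on_energy[of UNIV]]
      continuous_on_blk) (use levels in auto)

lemma barrier_bounds: "0 \<le> barrier t" "barrier t \<le> s"
proof -
  have "(1 / (1 + lam / 4)) ^ nat (pdist t - int N0) \<le> 1" using lam_pos by (intro power_le_one) auto
  then show "0 \<le> barrier t" "barrier t \<le> s"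
    using s_pos lam_pos by (simp_all add: barrier_def mult_left_le)
qed

lemma near_site:
  assumes "near u" "int N0 \<le> pdist t"
  shows "norm (l2_nth u t) \<le> s"
proof -
  obtain i where i: "i < length p" "t \<in> I i" using intervals_cover by blast
  have "norm (l2_nth (blk i u) (t - p ! i)) \<le> s"
    using assms i pdist_le[OF i(1), of t] by (intro tail) (auto simp: near_def)
  then show ?thesis using i(2) by (simp add: l2_nth_blk)
qed

text \<open>At distance exactly N0 the barrier equals s, which \<open>near\<close> already
  guarantees; thus the maximum principle has its boundary values without a condition in
  \<open>zone\<close>.\<close>

lemma zone_site:
  assumes "near u" "zone u" "int N0 \<le> pdist t"
  shows "norm (l2_nth u t) \<le> barrier t"
proof (cases "pdist t = int N0")
  case True
  then show ?thesis using near_site[OF assms(1,3)] by (simp add: barrier_def)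
next
  case False
  then show ?thesis using assms(2,3) by (simp add: zone_def)
qed

lemma barrier_neighbour:
  assumes "pdist t > int N0" "\<bar>t - t'\<bar> \<le> 1"
  shows "barrier t' \<le> (1 + lam / 4) * barrier t"
proof -
  define q where "q = 1 / (1 + lam / 4)"
  have q: "0 < q" "q \<le> 1" "(1 + lam / 4) * q = 1" using lam_pos by (auto simp: q_def)
  have "nat (pdist t - int N0) \<noteq> 0" using assms(1) by simp
  then obtain e where e: "nat (pdist t - int N0) = Suc e" using not0_implies_Suc by blast
  have "q ^ nat (pdist t' - int N0) \<le> q ^ e"
    using pdist_lipschitz[OF assms(2)] e q by (intro power_decreasing) auto
  then have "barrier t' \<le> s * q ^ e" unfolding barrier_def q_def[symmetric] using s_pos by simp
  also have "\<dots> = s * q ^ e * ((1 + lam / 4) * q)" using q(3) by simp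
  also have "\<dots> = (1 + lam / 4) * barrier t" unfolding barrier_def q_def[symmetric] e by (simp add: algebra_simps)
  finally show ?thesis .
qed

lemma l2_nth_euler:
  assumes "i < length p" "t \<in> I i"
  shows "l2_nth (euler \<epsilon> u) t = l2_nth u t - (\<epsilon> * weight (f (blk i u))) *\<^sub>R l2_nth (grad u) t"
proof -
  have "(\<Sum>j<length p. l2_nth ((\<epsilon> * weight (f (blk j u))) *\<^sub>R l2_restrict (I j) (grad u)) t)
      = (\<Sum>j<length p. if j = i then (\<epsilon> * weight (f (blk i u))) *\<^sub>R l2_nth (grad u) t else 0)"
    by (intro sum.cong refl) (use assms intervals_disjoint in auto)
  also have "\<dots> = (\<epsilon> * weight (f (blk i u))) *\<^sub>R l2_nth (grad u) t" using assms(1) by simp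
  finally show ?thesis unfolding euler_def l2_nth_diff l2_nth_sum by simp
qed

text \<open>Each site sees only the step size of its own block, so the jump of the step size across
  a cut does not disturb the estimate at a site.\<close>

lemma zone_euler:
  assumes u: "near u" "zone u" and \<epsilon>: "0 \<le> \<epsilon>" "\<epsilon> * Lam\<^sup>2 \<le> lam / 2" "\<epsilon> * (2 + 3 * lam / 4) \<le> 1"
  shows "zone (euler \<epsilon> u)"
  unfolding zone_def
proof (intro allI impI)
  fix t assume t: "pdist t > int N0"
  obtain i where i: "i < length p" "t \<in> I i" using intervals_cover by blast
  define \<tau> where "\<tau> = \<epsilon> * weight (f (blk i u))"
  have \<tau>: "0 \<le> \<tau>" "\<tau> \<le> \<epsilon>" using \<epsilon>(1) weight_bounds[of "f (blk i u)"] by (auto simp: \<tau>_def mult_left_le)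
  have nb: "norm (l2_nth u t') \<le> (1 + lam / 4) * barrier t" if "\<bar>t - t'\<bar> \<le> 1" for t'
  proof -
    have "int N0 \<le> pdist t'" using pdist_lipschitz[OF that] t by linarith
    from zone_site[OF u this] barrier_neighbour[OF t that] show ?thesis by linarith
  qed
  show "norm (l2_nth (euler \<epsilon> u) t) \<le> barrier t"
    unfolding l2_nth_euler[OF i] l2_nth_grad \<tau>_def[symmetric]
  proof (rule site_step[OF s_small])
    show "norm (l2_nth u t) \<le> s" "norm (l2_nth u t) \<le> barrier t"
      using near_site[OF u(1)] zone_site[OF u] t by auto
    show "norm (l2_nth u (t - 1)) \<le> (1 + lam / 4) * barrier t" "norm (l2_nth u (t + 1)) \<le> (1 + lam / 4) * barrier t"
      by (intro nb; simp)+
    have "\<tau> * Lam\<^sup>2 \<le> \<epsilon> * Lam\<^sup>2" using \<tau> by (intro mult_right_mono) auto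
    then show "\<tau> * Lam\<^sup>2 \<le> lam / 2" using \<epsilon> by linarith
    have "\<tau> * (2 + 3 * lam / 4) \<le> \<epsilon> * (2 + 3 * lam / 4)" using \<tau> lam_pos by (intro mult_right_mono) auto
    then show "\<tau> * (2 + 3 * lam / 4) \<le> 1" using \<epsilon> by linarith
  qed (use \<tau> in auto)
qed

lemma blk_euler:
  assumes "i < length p"
  shows "blk i (euler \<epsilon> u) = blk i u - (\<epsilon> * weight (f (blk i u))) *\<^sub>R blk i (grad u)"
  by (rule l2_eqI) (simp add: l2_nth_blk l2_nth_euler[OF assms])

lemma crossing_small:
  assumes u: "near u" "zone u"
    and far: "\<And>j. j < length p \<Longrightarrow> (int N)\<^sup>2 + 2 * int N - 1 \<le> \<bar>t - p ! j\<bar>"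
  shows "norm (l2_nth u t) \<le> s * (1 / (1 + lam / 4)) ^ N"
proof -
  have "1 \<le> (int N)\<^sup>2" using N_ge(2) by (simp add: one_le_power)
  \<comment> \<open>As N is at least 1, N^2 + 2 N - 1 is at least 2 N and so at least N0 + N: N0
    sites before the barrier starts to decay, then N factors of decay.\<close>
  then have far': "int N0 + int N \<le> pdist t" using pdist_geI[OF far] N_ge(1) by linarith
  have "barrier t \<le> s * (1 / (1 + lam / 4)) ^ N"
    unfolding barrier_def using s_pos lam_pos far' by (intro mult_left_mono power_decreasing) auto
  then show ?thesis using zone_site[OF u, of t] far' by linarith
qed

text \<open>Positions are multiples of T, so moving a block to the origin commutes with the gradient
  and only the error of the cuts remains.\<close>

lemma blk_grad:
  assumes u: "near u" "zone u" and i: "i < length p"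
  shows "norm (blk i (grad u) - grad (blk i u)) \<le> min \<nu> \<mu> / 4"
proof -
  have "blk i (grad u) - grad (blk i u)
      = l2_shift (- (p ! i)) (l2_restrict (I i) (grad u) - grad (l2_restrict (I i) u))"
    unfolding blk_def using grad_shift[of "- (p ! i)"] p_dvd[OF i] by (simp add: l2_shift_diff)
  then have "norm (blk i (grad u) - grad (blk i u)) = norm (l2_restrict (I i) (grad u) - grad (l2_restrict (I i) u))"
    by simp
  also have "\<dots> \<le> 8 * (s * (1 / (1 + lam / 4)) ^ N)"
  proof (rule grad_restrict_error)
    let ?C = "{(p ! (i - 1) + p ! i) div 2, (p ! i + p ! Suc i) div 2}"
    show "finite ?C" "card ?C \<le> 2" by (auto simp: card_insert_if)
    fix t assume t: "(t \<in> I i) \<noteq> (t + 1 \<in> I i)"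
    show "t \<in> ?C" by (rule interval_crossing(1)[OF i t])
    show "norm (l2_nth u t) \<le> s * (1 / (1 + lam / 4)) ^ N \<and> norm (l2_nth u (t + 1)) \<le> s * (1 / (1 + lam / 4)) ^ N"
      by (intro conjI crossing_small u interval_crossing[OF i t])
  next
    show "0 \<le> s * (1 / (1 + lam / 4)) ^ N" using s_pos lam_pos by simp
  qed
  also have "\<dots> \<le> min \<nu> \<mu> / 4" by (rule N_small)
  finally show ?thesis .
qed

text \<open>The bound grows with the number of bumps; it feeds compactness and the length of the
  iteration, never the choice of N.\<close>

lemma norm_near_le:
  assumes "near u"
  shows "norm u \<le> real (length p) * (norm v + (\<rho> + d) / sqrt lam)"
proof -
  have "norm u \<le> (\<Sum>i<length p. norm (l2_restrict (I i) u))"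
    by (metis sum_restrict_intervals norm_sum)
  also have "\<dots> \<le> (\<Sum>i<length p. norm v + (\<rho> + d) / sqrt lam)"
  proof (rule sum_mono)
    fix i assume "i \<in> {..<length p}"
    then have "norm (blk i u) \<le> norm v + (\<rho> + d) / sqrt lam"
      using assms by (intro norm_le_of_nrm_le) (simp add: near_def)
    then show "norm (l2_restrict (I i) u) \<le> norm v + (\<rho> + d) / sqrt lam" by (simp add: blk_def)
  qed
  finally show ?thesis by simp
qed

definition admissible :: "'n space \<Rightarrow> bool" where
  "admissible u \<longleftrightarrow> (\<forall>i<length p. well (blk i u)) \<and> zone u"

lemma admissible_near: "admissible u \<Longrightarrow> near u"
  by (simp add: admissible_def near_def well_def)

lemma admissible_euler:
  "\<exists>\<epsilon>>0. \<forall>\<epsilon>' u. 0 \<le> \<epsilon>' \<longrightarrow> \<epsilon>' \<le> \<epsilon> \<longrightarrow> admissible u \<longrightarrow> admissible (euler \<epsilon>' u) \<and>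
    (\<forall>i<length p. f (blk i u) \<le> c2 \<longrightarrow> f (blk i (euler \<epsilon>' u)) \<le> c2)"
proof -
  obtain e where e: "e > 0" "\<And>x y \<tau>. 0 \<le> \<tau> \<Longrightarrow> \<tau> \<le> e \<Longrightarrow> well x \<Longrightarrow> norm (y - grad x) \<le> min \<nu> \<mu> / 4 \<Longrightarrow>
    (f x \<le> c1 \<longrightarrow> \<tau> = 0) \<Longrightarrow> well (x - \<tau> *\<^sub>R y) \<and> (f x \<le> c2 \<longrightarrow> f (x - \<tau> *\<^sub>R y) \<le> c2)"
    using well_step by blast
  \<comment> \<open>The bound e serves the blocks; the other two caps are the step size conditions
    of \<open>site_step\<close>.\<close>
  define \<epsilon> where "\<epsilon> = min e (min (lam / (2 * Lam\<^sup>2)) (1 / (2 + 3 * lam / 4)))"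
  have \<epsilon>: "\<epsilon> > 0" using e(1) lam_pos Lam_pos by (simp add: \<epsilon>_def add_pos_pos)
  have "admissible (euler \<epsilon>' u) \<and> (\<forall>i<length p. f (blk i u) \<le> c2 \<longrightarrow> f (blk i (euler \<epsilon>' u)) \<le> c2)"
    if *: "0 \<le> \<epsilon>'" "\<epsilon>' \<le> \<epsilon>" and u: "admissible u" for \<epsilon>' u
  proof -
    have nz: "near u" "zone u" using u admissible_near by (auto simp: admissible_def)
    have "\<epsilon>' \<le> lam / (2 * Lam\<^sup>2)" "\<epsilon>' \<le> 1 / (2 + 3 * lam / 4)" using * by (auto simp: \<epsilon>_def)
    then have "\<epsilon>' * Lam\<^sup>2 \<le> lam / 2" "\<epsilon>' * (2 + 3 * lam / 4) \<le> 1"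
      using Lam_pos lam_pos by (simp_all add: field_simps)
    then have "zone (euler \<epsilon>' u)" using zone_euler[OF nz *(1)] by blast
    moreover have "well (blk i (euler \<epsilon>' u)) \<and> (f (blk i u) \<le> c2 \<longrightarrow> f (blk i (euler \<epsilon>' u)) \<le> c2)"
      if i: "i < length p" for i
      unfolding blk_euler[OF i]
    proof (rule e(2))
      have "\<epsilon>' * weight (f (blk i u)) \<le> \<epsilon>'" using *(1) weight_bounds by (simp add: mult_left_le)
      then show "\<epsilon>' * weight (f (blk i u)) \<le> e" using *(2) by (simp add: \<epsilon>_def)
      show "0 \<le> \<epsilon>' * weight (f (blk i u))" using *(1) weight_bounds by simp
      show "well (blk i u)" using u i by (simp add: admissible_def)
      show "norm (blk i (grad u) - grad (blk i u)) \<le> min \<nu> \<mu> / 4" by (rule blk_grad[OF nz i])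
      show "f (blk i u) \<le> c1 \<longrightarrow> \<epsilon>' * weight (f (blk i u)) = 0" by (simp add: weight_low)
    qed
    ultimately show ?thesis by (simp add: admissible_def)
  qed
  with \<epsilon> show ?thesis by blast
qed

lemma blk_frozen: "i < length p \<Longrightarrow> f (blk i u) \<le> c1 \<Longrightarrow> blk i (euler \<epsilon> u) = blk i u"
  by (simp add: blk_euler weight_low)

lemma euler_above: "(\<And>i. i < length p \<Longrightarrow> c2 \<le> f (blk i u)) \<Longrightarrow> euler \<epsilon> u = u - \<epsilon> *\<^sub>R grad u"
  unfolding euler_def by (simp add: weight_high sum_restrict_intervals flip: scaleR_sum_right)

text \<open>Both \<open>near\<close> and \<open>zone\<close> are stable under pointwise limits, so
  gradients tending to 0 would produce a critical point without norm convergence. The bound may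
  depend on the positions.\<close>

lemma slope_bound:
  assumes no_crit: "\<And>u. near u \<Longrightarrow> zone u \<Longrightarrow> grad u \<noteq> 0"
  shows "\<exists>g>0. \<forall>u. near u \<longrightarrow> zone u \<longrightarrow> g \<le> norm (grad u)"
proof (rule ccontr)
  assume contra: "\<not> ?thesis"
  have "\<exists>u. near u \<and> zone u \<and> norm (grad u) < 1 / real (Suc n)" for n
    using contra by (metis not_le of_nat_0_less_iff zero_less_Suc zero_less_divide_1_iff)
  then obtain u where u: "\<And>n. near (u n)" "\<And>n. zone (u n)" "\<And>n. norm (grad (u n)) < 1 / real (Suc n)" by metis
  obtain \<phi> w where \<phi>: "strict_mono \<phi>" and lim: "\<And>t. (\<lambda>m. l2_nth (u (\<phi> m)) t) \<longlonglongrightarrow> l2_nth w t"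
    using bounded_l2_pointwise_convergent_subseq[of u, OF norm_near_le[OF u(1)]] by blast
  have "(\<lambda>n. norm (grad (u n))) \<longlonglongrightarrow> 0"
    by (rule tendsto_sandwich[OF _ _ tendsto_const LIMSEQ_inverse_real_of_nat])
      (use u(3) in \<open>auto simp: inverse_eq_divide intro!: always_eventually less_imp_le\<close>)
  then have "(\<lambda>n. norm (grad (u (\<phi> n)))) \<longlonglongrightarrow> 0"
    using LIMSEQ_subseq_LIMSEQ[OF _ \<phi>] by (simp add: comp_def)
  from grad_pointwise_limit[OF lim this] have "grad w = 0" .
  moreover have "near w"
    unfolding near_def
  proof (intro allI impI)
    fix i assume i: "i < length p"
    show "nrm (blk i w - v) \<le> \<rho> + d"
    proof (rule nrm_pointwise_limit_le)
      show "(\<lambda>m. l2_nth (blk i (u (\<phi> m)) - v) t) \<longlonglongrightarrow> l2_nth (blk i w - v) t" for t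
        by (auto simp: l2_nth_blk intro!: tendsto_intros lim)
      show "nrm (blk i (u (\<phi> m)) - v) \<le> \<rho> + d" for m using u(1) i by (simp add: near_def)
    qed
  qed
  moreover have "zone w"
    unfolding zone_def
  proof (intro allI impI)
    fix t assume t: "pdist t > int N0"
    have "(\<lambda>m. norm (l2_nth (u (\<phi> m)) t)) \<longlonglongrightarrow> norm (l2_nth w t)" by (intro tendsto_norm lim)
    moreover have "norm (l2_nth (u (\<phi> m)) t) \<le> barrier t" for m using u(2) t by (simp add: zone_def)
    ultimately show "norm (l2_nth w t) \<le> barrier t" by (meson LIMSEQ_le_const2)
  qed
  ultimately show False using no_crit by blast
qed

section \<open>Gluing translates of a path\<close>

definition glue :: "(real \<Rightarrow> 'n space) \<Rightarrow> (nat \<Rightarrow> real) \<Rightarrow> 'n space" where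
  "glue \<gamma> \<theta> = (\<Sum>i<length p. l2_shift (p ! i) (\<gamma> (\<theta> i)))"

text \<open>The translated supports have radius N0, no more than the half-width of an interval, so
  each lies inside its own interval and the summands do not overlap.\<close>

lemma l2_nth_glue:
  assumes supp: "\<And>\<theta> t. \<theta> \<in> {0..1} \<Longrightarrow> \<bar>t\<bar> > int N0 \<Longrightarrow> l2_nth (\<gamma> \<theta>) t = 0"
    and \<theta>: "\<And>i. i < length p \<Longrightarrow> \<theta> i \<in> {0..1}" and i: "i < length p" "t \<in> I i"
  shows "l2_nth (glue \<gamma> \<theta>) t = l2_nth (\<gamma> (\<theta> i)) (t - p ! i)"
proof -
  have N: "int N0 \<le> (int N)\<^sup>2 + 2 * int N - 1"
  proof -
    have "1 \<le> (int N)\<^sup>2" using N_ge(2) by (simp add: one_le_power)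
    then show ?thesis using N_ge by linarith
  qed
  have "l2_nth (\<gamma> (\<theta> j)) (t - p ! j) = 0" if "j < length p" "j \<noteq> i" for j
  proof (rule supp[OF \<theta>[OF that(1)]])
    show "int N0 < \<bar>t - p ! j\<bar>"
    proof (rule ccontr)
      assume "\<not> ?thesis"
      then have "t \<in> I j" using interval_contains[OF that(1)] N by simp
      then show False using intervals_disjoint[OF i(1) that(1) i(2)] that(2) by simp
    qed
  qed
  then have "(\<Sum>j<length p. l2_nth (\<gamma> (\<theta> j)) (t - p ! j))
      = (\<Sum>j<length p. if j = i then l2_nth (\<gamma> (\<theta> i)) (t - p ! i) else 0)"
    by (intro sum.cong) auto
  then show ?thesis using i(1) by (simp add: glue_def l2_nth_sum)
qed

lemma blk_glue:
  assumes supp: "\<And>\<theta> t. \<theta> \<in> {0..1} \<Longrightarrow> \<bar>t\<bar> > int N0 \<Longrightarrow> l2_nth (\<gamma> \<theta>) t = 0"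
    and \<theta>: "\<And>i. i < length p \<Longrightarrow> \<theta> i \<in> {0..1}" and i: "i < length p"
  shows "blk i (glue \<gamma> \<theta>) = \<gamma> (\<theta> i)"
proof (rule l2_eqI)
  fix t
  have "1 \<le> (int N)\<^sup>2" using N_ge(2) by (simp add: one_le_power)
  then have N: "int N0 \<le> (int N)\<^sup>2 + 2 * int N - 1" using N_ge by linarith
  show "l2_nth (blk i (glue \<gamma> \<theta>)) t = l2_nth (\<gamma> (\<theta> i)) t"
  proof (cases "t + p ! i \<in> I i")
    case True
    then show ?thesis using l2_nth_glue[OF supp \<theta> i True] by (simp add: l2_nth_blk)
  next
    case False
    then have "\<bar>t\<bar> > int N0" using interval_contains[OF i, of "t + p ! i"] N by force
    then show ?thesis using supp[OF \<theta>[OF i]] False by (simp add: l2_nth_blk)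
  qed
qed

lemma admissible_glue:
  assumes supp: "\<And>\<theta> t. \<theta> \<in> {0..1} \<Longrightarrow> \<bar>t\<bar> > int N0 \<Longrightarrow> l2_nth (\<gamma> \<theta>) t = 0"
    and ball: "\<And>\<theta>. \<theta> \<in> {0..1} \<Longrightarrow> nrm (\<gamma> \<theta> - v) \<le> \<rho> \<and> f (\<gamma> \<theta>) \<le> c4"
    and \<theta>: "\<And>i. i < length p \<Longrightarrow> \<theta> i \<in> {0..1}"
  shows "admissible (glue \<gamma> \<theta>)"
  unfolding admissible_def
proof (intro conjI allI impI)
  fix i assume i: "i < length p"
  have "blk i (glue \<gamma> \<theta>) = \<gamma> (\<theta> i)" by (rule blk_glue) (use supp \<theta> i in auto)
  then show "well (blk i (glue \<gamma> \<theta>))"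
    unfolding well_def using ball[OF \<theta>[OF i]] d_pos by (simp add: max_absorb1)
next
  show "zone (glue \<gamma> \<theta>)"
    unfolding zone_def
  proof (intro allI impI)
    fix t assume t: "pdist t > int N0"
    obtain i where i: "i < length p" "t \<in> I i" using intervals_cover by blast
    have "int N0 < \<bar>t - p ! i\<bar>" using t pdist_le[OF i(1), of t] by linarith
    then have "l2_nth (\<gamma> (\<theta> i)) (t - p ! i) = 0" by (rule supp[OF \<theta>[OF i(1)]])
    moreover have "l2_nth (glue \<gamma> \<theta>) t = l2_nth (\<gamma> (\<theta> i)) (t - p ! i)"
      by (rule l2_nth_glue) (use supp \<theta> i in auto)
    ultimately have "l2_nth (glue \<gamma> \<theta>) t = 0" by simp
    then show "norm (l2_nth (glue \<gamma> \<theta>) t) \<le> barrier t" using barrier_bounds by simp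
  qed
qed

text \<open>If there were no critical point, iterating the Euler map would bring, for every parameter of
  the cube, the energy of some block below \<open>c2\<close>; the chain lemma then connects \<open>\<gamma> 0\<close> to \<open>\<gamma> 1\<close> below
  level \<open>b\<close>, since blocks at these two end points are frozen.\<close>

lemma multibump_critical:
  assumes path: "path \<gamma>"
    and supp: "\<And>\<theta> t. \<theta> \<in> {0..1} \<Longrightarrow> \<bar>t\<bar> > int N0 \<Longrightarrow> l2_nth (\<gamma> \<theta>) t = 0"
    and ball: "\<And>\<theta>. \<theta> \<in> {0..1} \<Longrightarrow> nrm (\<gamma> \<theta> - v) \<le> \<rho> \<and> f (\<gamma> \<theta>) \<le> c4"
    and ends: "f (\<gamma> 0) \<le> c1" "f (\<gamma> 1) \<le> c1" and "c2 < b"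
    and not_joined: "\<not> path_component {x. nrm (x - v) \<le> \<rho> + d \<and> f x < b} (\<gamma> 0) (\<gamma> 1)"
  shows "\<exists>u. near u \<and> zone u \<and> grad u = 0"
proof (rule ccontr)
  assume "\<not> ?thesis"
  then have "\<And>u. near u \<Longrightarrow> zone u \<Longrightarrow> grad u \<noteq> 0" by blast
  from slope_bound[OF this] obtain g where g: "g > 0"
    "\<And>u. near u \<Longrightarrow> zone u \<Longrightarrow> g \<le> norm (grad u)" by blast
  define R where "R = real (length p) * (norm v + (\<rho> + d) / sqrt lam)"
  obtain G where G: "G \<ge> 0" "\<And>u. norm u \<le> R \<Longrightarrow> norm (grad u) \<le> G * norm u"
    using grad_linear_bound by blast
  obtain B where B: "\<And>u. norm u \<le> R \<Longrightarrow> B \<le> f u" using energy_bounded_below by blast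
  obtain D where D: "D > 0" "\<And>u h. norm u \<le> R \<Longrightarrow> norm h \<le> D \<Longrightarrow>
      \<bar>f (u + h) - f u - inner (grad u) h\<bar> \<le> g / 2 * norm h"
    using energy_taylor[of "g / 2" R] g by auto
  obtain e where e: "e > 0" "\<And>\<epsilon> u. 0 \<le> \<epsilon> \<Longrightarrow> \<epsilon> \<le> e \<Longrightarrow> admissible u \<Longrightarrow> admissible (euler \<epsilon> u) \<and>
    (\<forall>i<length p. f (blk i u) \<le> c2 \<longrightarrow> f (blk i (euler \<epsilon> u)) \<le> c2)" using admissible_euler by blast
  \<comment> \<open>The second cap keeps a gradient step of the whole sequence within the Taylor
    radius D.\<close>
  define \<epsilon> where "\<epsilon> = min e (D / (G * \<bar>R\<bar> + 1))"
  have GR: "G * \<bar>R\<bar> + 1 > 0" using G(1) by (simp add: add_nonneg_pos)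
  have "\<epsilon> \<le> D / (G * \<bar>R\<bar> + 1)" by (simp add: \<epsilon>_def)
  then have "\<epsilon> * (G * \<bar>R\<bar> + 1) \<le> D" unfolding pos_le_divide_eq[OF GR] .
  then have \<epsilon>: "0 < \<epsilon>" "\<epsilon> \<le> e" "\<epsilon> * (G * \<bar>R\<bar> + 1) \<le> D"
    using e(1) D(1) GR by (simp_all add: \<epsilon>_def)
  define E where "E = euler \<epsilon>"
  have adm: "admissible (E u)" if "admissible u" for u
    using e(2)[OF less_imp_le[OF \<epsilon>(1)] \<epsilon>(2) that] by (simp add: E_def)
  have stay: "f (blk i (E u)) \<le> c2" if "admissible u" "i < length p" "f (blk i u) \<le> c2" for u i
    using e(2)[OF less_imp_le[OF \<epsilon>(1)] \<epsilon>(2) that(1)] that(2,3) by (simp add: E_def)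
  \<comment> \<open>With every block at or above c2 all weights are 1 and the map is an undivided
    gradient step. The energy is that of the whole sequence, so no cut error enters.\<close>
  have decrease: "f (E u) \<le> f u - \<epsilon> * g\<^sup>2 / 2"
    if u: "admissible u" and above: "\<And>i. i < length p \<Longrightarrow> c2 \<le> f (blk i u)" for u
  proof -
    have nz: "near u" "zone u" using u admissible_near by (auto simp: admissible_def)
    have uR: "norm u \<le> R" unfolding R_def by (rule norm_near_le[OF nz(1)])
    define a where "a = norm (grad u)"
    have a: "g \<le> a" using g(2)[OF nz] by (simp add: a_def)
    have "a \<le> G * norm u" unfolding a_def by (rule G(2)[OF uR])
    also have "\<dots> \<le> G * \<bar>R\<bar> + 1" using uR G(1) by (intro add_increasing2 mult_left_mono) auto
    finally have "\<epsilon> * a \<le> D" using \<epsilon> by (smt (verit) mult_left_mono)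
    then have h: "norm (- (\<epsilon> *\<^sub>R grad u)) \<le> D" using \<epsilon>(1) by (simp add: a_def)
    have Eu: "E u = u + - (\<epsilon> *\<^sub>R grad u)" unfolding E_def using euler_above[OF above] by simp
    have "f (E u) - f u - inner (grad u) (- (\<epsilon> *\<^sub>R grad u)) \<le> g / 2 * norm (- (\<epsilon> *\<^sub>R grad u))"
      unfolding Eu using D(2)[OF uR h] by (rule abs_le_D1)
    moreover have "inner (grad u) (- (\<epsilon> *\<^sub>R grad u)) = - (\<epsilon> * a\<^sup>2)" by (simp add: a_def power2_norm_eq_inner)
    moreover have "g / 2 * norm (- (\<epsilon> *\<^sub>R grad u)) = \<epsilon> * (g * a / 2)" using \<epsilon>(1) by (simp add: a_def)
    ultimately have "f (E u) \<le> f u - \<epsilon> * (a\<^sup>2 - g * a / 2)" unfolding right_diff_distrib by linarith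
    also have "\<dots> \<le> f u - \<epsilon> * (g\<^sup>2 / 2)"
    proof -
      have "g * g \<le> g * a" "g * a \<le> a * a" using a g(1) by (auto intro: mult_left_mono mult_right_mono)
      then have "g\<^sup>2 / 2 \<le> a\<^sup>2 - g * a / 2" by (simp add: power2_eq_square)
      then show ?thesis using \<epsilon>(1) by (intro diff_left_mono mult_left_mono) auto
    qed
    finally show ?thesis by simp
  qed
  define cube where "cube \<theta> \<longleftrightarrow> (\<forall>i<length p. \<theta> i \<in> {0..1})" for \<theta> :: "nat \<Rightarrow> real"
  have adm_iter: "admissible ((E ^^ m) (glue \<gamma> \<theta>))" if "cube \<theta>" for m \<theta>
  proof (induction m)
    case 0
    show ?case using admissible_glue[where \<gamma> = \<gamma>, OF supp ball] that by (simp add: cube_def)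
  qed (simp add: adm)
  have low_iter: "f (blk i ((E ^^ (m + n)) (glue \<gamma> \<theta>))) \<le> c2"
    if "cube \<theta>" "i < length p" "f (blk i ((E ^^ m) (glue \<gamma> \<theta>))) \<le> c2" for m n \<theta> i
  proof (induction n)
    case (Suc n)
    then show ?case using stay[OF adm_iter[OF that(1)] that(2)] by simp
  qed (use that in simp)
  have frozen: "blk i ((E ^^ m) (glue \<gamma> \<theta>)) = \<gamma> (\<theta> i)"
    if "cube \<theta>" "i < length p" "f (\<gamma> (\<theta> i)) \<le> c1" for m \<theta> i
  proof (induction m)
    case 0
    show ?case using blk_glue[where \<gamma> = \<gamma>, OF supp] that by (simp add: cube_def)
  next
    case (Suc m)
    then show ?case using blk_frozen[OF that(2), of "(E ^^ m) (glue \<gamma> \<theta>)" \<epsilon>] that(3) by (simp add: E_def)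
  qed
  define K where "K = {\<Sum>i<length p. y i | y. \<forall>i<length p. y i \<in> l2_shift (p ! i) ` path_image \<gamma>}"
  have "compact K"
    unfolding K_def
    by (intro compact_sum_of_compacts compact_continuous_image compact_path_image path
        linear_continuous_on bounded_linear_l2_shift)
  have glue_K: "glue \<gamma> \<theta> \<in> K" if "cube \<theta>" for \<theta>
    using that unfolding glue_def K_def cube_def path_image_def by blast
  obtain M where M: "\<And>u. u \<in> K \<Longrightarrow> f u \<le> M"
  proof -
    have "bounded (f ` K)"
      by (intro compact_imp_bounded compact_continuous_image continuous_on_energy \<open>compact K\<close>)
    then show thesis using that unfolding bounded_iff by (metis abs_le_D1 imageI real_norm_def)
  qed
  have "0 < \<epsilon> * g\<^sup>2 / 2" using \<epsilon>(1) g(1) by simp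
  \<comment> \<open>A number of steps that serves the whole cube at once: the energy starts at M or
    less and stays at least B along the iteration.\<close>
  from reals_Archimedean3[OF this] obtain m :: nat where m: "M - B < real m * (\<epsilon> * g\<^sup>2 / 2)" by blast
  have some_low: "\<exists>i<length p. f (blk i ((E ^^ m) (glue \<gamma> \<theta>))) \<le> c2" if \<theta>: "cube \<theta>" for \<theta>
  proof (rule ccontr)
    assume contra: "\<not> ?thesis"
    \<comment> \<open>A block once at or below c2 remains there, so blocks above c2 after m steps
      were above it all the time.\<close>
    have above: "c2 \<le> f (blk i ((E ^^ j) (glue \<gamma> \<theta>)))" if "j \<le> m" "i < length p" for i j
      using low_iter[OF \<theta> that(2), of j "m - j"] contra that by force
    have "f ((E ^^ j) (glue \<gamma> \<theta>)) \<le> M - real j * (\<epsilon> * g\<^sup>2 / 2)" if "j \<le> m" for j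
      using that
    proof (induction j)
      case 0
      show ?case using M[OF glue_K[OF \<theta>]] by simp
    next
      case (Suc j)
      have "f ((E ^^ Suc j) (glue \<gamma> \<theta>)) \<le> f ((E ^^ j) (glue \<gamma> \<theta>)) - \<epsilon> * g\<^sup>2 / 2"
        using decrease[OF adm_iter[OF \<theta>, of j]] above[of j] Suc.prems by simp
      also have "\<dots> \<le> M - real j * (\<epsilon> * g\<^sup>2 / 2) - \<epsilon> * g\<^sup>2 / 2" using Suc by simp
      also have "\<dots> = M - real (Suc j) * (\<epsilon> * g\<^sup>2 / 2)" unfolding of_nat_Suc distrib_right by simp
      finally show ?case .
    qed
    from this[of m] have "f ((E ^^ m) (glue \<gamma> \<theta>)) < B" using m by simp
    moreover have "norm ((E ^^ m) (glue \<gamma> \<theta>)) \<le> R"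
      unfolding R_def by (intro norm_near_le admissible_near adm_iter \<theta>)
    ultimately show False using B by force
  qed
  define H where "H i u = f (blk i ((E ^^ m) u))" for i u
  have cont_iter: "continuous_on S (E ^^ m)" for m S
  proof (induction m)
    case (Suc m)
    then show ?case
      unfolding funpow.simps by (intro continuous_on_compose) (simp_all add: E_def continuous_on_euler)
  qed (simp add: id_def continuous_on_id)
  have contF: "continuous_on S (\<lambda>u. blk i ((E ^^ m) u))" for S i
    by (rule continuous_on_compose2[OF continuous_on_blk[of UNIV] cont_iter]) simp
  have contH: "continuous_on S (H i)" for S i
    unfolding H_def by (rule continuous_on_compose2[OF continuous_on_energy[of UNIV] contF]) simp
  \<comment> \<open>Half the gap, spent twice: from a vertex to its neighbours, and from a vertex to
    the points of an edge.\<close>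
  define \<eta> where "\<eta> = (b - c2) / 2"
  have \<eta>: "\<eta> > 0" using \<open>c2 < b\<close> by (simp add: \<eta>_def)
  have "\<exists>\<delta>>0. \<forall>i<n. \<forall>u\<in>K. \<forall>w\<in>K. dist w u < \<delta> \<longrightarrow> dist (H i w) (H i u) < \<eta>" for n
  proof (induction n)
    case 0
    show ?case by (auto intro: exI[of _ 1])
  next
    case (Suc n)
    then obtain \<delta>1 where 1: "\<delta>1 > 0" "\<And>i u w. i < n \<Longrightarrow> u \<in> K \<Longrightarrow> w \<in> K \<Longrightarrow> dist w u < \<delta>1 \<Longrightarrow> dist (H i w) (H i u) < \<eta>"
      by blast
    have "uniformly_continuous_on K (H n)"
      by (rule compact_uniformly_continuous[OF contH \<open>compact K\<close>])
    then obtain \<delta>2 where 2: "\<delta>2 > 0" "\<And>u w. u \<in> K \<Longrightarrow> w \<in> K \<Longrightarrow> dist w u < \<delta>2 \<Longrightarrow> dist (H n w) (H n u) < \<eta>"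
      using \<eta> unfolding uniformly_continuous_on_def by blast
    show ?case
      using 1 2 by (intro exI[of _ "min \<delta>1 \<delta>2"]) (auto simp: less_Suc_eq)
  qed
  then obtain \<delta> where \<delta>: "\<delta> > 0" "\<And>i u w. i < length p \<Longrightarrow> u \<in> K \<Longrightarrow> w \<in> K \<Longrightarrow> dist w u < \<delta> \<Longrightarrow>
      dist (H i w) (H i u) < \<eta>" by metis
  have k: "real (length p) > 0" using nonempty by simp
  have "uniformly_continuous_on {0..1} \<gamma>"
    using path unfolding path_def by (intro compact_uniformly_continuous) auto
  moreover have "\<delta> / real (length p) > 0" using \<delta>(1) k by simp
  ultimately obtain \<omega> where \<omega>: "\<omega> > 0" "\<And>a b. a \<in> {0..1} \<Longrightarrow> b \<in> {0..1} \<Longrightarrow> dist b a < \<omega> \<Longrightarrow>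
      dist (\<gamma> b) (\<gamma> a) < \<delta> / real (length p)"
    unfolding uniformly_continuous_on_def by blast
  have glue_close: "dist (glue \<gamma> \<theta>') (glue \<gamma> \<theta>) < \<delta>"
    if "cube \<theta>" "cube \<theta>'" "\<And>i. i < length p \<Longrightarrow> dist (\<theta>' i) (\<theta> i) < \<omega>" for \<theta> \<theta>'
  proof -
    have "glue \<gamma> \<theta>' - glue \<gamma> \<theta> = (\<Sum>i<length p. l2_shift (p ! i) (\<gamma> (\<theta>' i) - \<gamma> (\<theta> i)))"
      by (simp add: glue_def l2_shift_diff sum_subtractf)
    then have "dist (glue \<gamma> \<theta>') (glue \<gamma> \<theta>) \<le> (\<Sum>i<length p. dist (\<gamma> (\<theta>' i)) (\<gamma> (\<theta> i)))"
      unfolding dist_norm by (metis (no_types, lifting) norm_l2_shift sum.cong norm_sum)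
    also have "\<dots> < (\<Sum>i<length p. \<delta> / real (length p))"
      using that \<omega>(2) k by (intro sum_strict_mono) (auto simp: cube_def)
    also have "\<dots> = \<delta>" using k by simp
    finally show ?thesis .
  qed
  obtain n :: nat where n: "n > 0" "1 / real n < \<omega>"
    using \<omega>(1) by (metis nat_approx_posE zero_less_Suc)
  define \<theta>of where "\<theta>of x i = real (x i) / real n" for x :: "nat \<Rightarrow> nat" and i :: nat
  have cube_vertex: "cube (\<theta>of x)" if "grid_vertex (length p) n x" for x
    using that n(1) by (auto simp: cube_def \<theta>of_def grid_vertex_def divide_le_eq)
  have adjacent: "dist (\<theta>of y i) (\<theta>of x i) < \<omega>" if "grid_adjacent (length p) x y" "i < length p" for x y i
  proof -
    have "\<bar>real (y i) - real (x i)\<bar> \<le> 1" using that by (auto simp: grid_adjacent_def)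
    then have "\<bar>(real (y i) - real (x i)) / real n\<bar> \<le> 1 / real n"
      using n(1) unfolding abs_divide by (simp add: divide_right_mono)
    then show ?thesis using n(2) by (simp add: \<theta>of_def dist_real_def diff_divide_distrib)
  qed
  define P where "P i x \<longleftrightarrow> H i (glue \<gamma> (\<theta>of x)) < c2 + \<eta>" for i x
  have "\<exists>i<length p. \<forall>y. grid_vertex (length p) n y \<longrightarrow> grid_adjacent (length p) x y \<longrightarrow> P i y"
    if x: "grid_vertex (length p) n x" for x
  proof -
    obtain i where i: "i < length p" "H i (glue \<gamma> (\<theta>of x)) \<le> c2"
      using some_low[OF cube_vertex[OF x]] by (auto simp: H_def)
    have "P i y" if y: "grid_vertex (length p) n y" "grid_adjacent (length p) x y" for y
    proof -
      have "dist (H i (glue \<gamma> (\<theta>of y))) (H i (glue \<gamma> (\<theta>of x))) < \<eta>"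
        by (intro \<delta>(2) glue_K cube_vertex x y i glue_close adjacent)
      then show ?thesis using i(2) by (simp add: P_def dist_real_def abs_less_iff)
    qed
    with i(1) show ?thesis by blast
  qed
  from grid_chain_between_faces[OF n(1) this] obtain i x y where i: "i < length p"
    and xy: "grid_vertex (length p) n x" "grid_vertex (length p) n y" "x i = 0" "y i = n" "P i x"
      "(x, y) \<in> (grid_edges (length p) n (P i))\<^sup>*" by blast
  define S where "S = {x. nrm (x - v) \<le> \<rho> + d \<and> f x < b}"
  define \<Phi> where "\<Phi> \<theta> = blk i ((E ^^ m) (glue \<gamma> \<theta>))" for \<theta>
  have in_S: "\<Phi> \<theta> \<in> S" if "cube \<theta>" "grid_vertex (length p) n x" "P i x"
    "\<And>j. j < length p \<Longrightarrow> dist (\<theta> j) (\<theta>of x j) < \<omega>" for \<theta> x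
  proof -
    have "dist (H i (glue \<gamma> \<theta>)) (H i (glue \<gamma> (\<theta>of x))) < \<eta>"
      by (intro \<delta>(2) i glue_K cube_vertex that glue_close)
    then have "H i (glue \<gamma> \<theta>) < c2 + \<eta> + \<eta>" using that(3) unfolding P_def dist_real_def by linarith
    moreover have "c2 + \<eta> + \<eta> = b" by (simp add: \<eta>_def field_simps)
    ultimately have "f (\<Phi> \<theta>) < b" by (simp add: \<Phi>_def H_def)
    moreover have "nrm (\<Phi> \<theta> - v) \<le> \<rho> + d"
      using admissible_near[OF adm_iter[OF that(1)]] i by (simp add: near_def \<Phi>_def)
    ultimately show ?thesis by (simp add: S_def)
  qed
  \<comment> \<open>Interpolated parameters stay within \<omega> of the first end in every
    coordinate, so the block with index i stays below b along the edge.\<close>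
  have edge: "path_component S (\<Phi> (\<theta>of x)) (\<Phi> (\<theta>of y))" if "(x, y) \<in> grid_edges (length p) n (P i)" for x y
  proof -
    have e: "grid_vertex (length p) n x" "grid_vertex (length p) n y" "P i x" "P i y" "grid_adjacent (length p) x y"
      using that by (auto simp: grid_edges_def)
    define \<theta> where "\<theta> s j = (1 - s) * \<theta>of x j + s * \<theta>of y j" for s :: real and j
    have cube: "cube (\<theta> s)" if s: "s \<in> {0..1}" for s
      unfolding cube_def
    proof (intro allI impI)
      fix j assume "j < length p"
      then have *: "\<theta>of x j \<in> {0..1}" "\<theta>of y j \<in> {0..1}"
        using cube_vertex e(1,2) by (auto simp: cube_def)
      have "(1 - s) * \<theta>of x j + s * \<theta>of y j \<in> {0..1}"
        using convexD[OF convex_real_interval(5) *, of "1 - s" s] s by simp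
      then show "\<theta> s j \<in> {0..1}" by (simp add: \<theta>_def)
    qed
    have close: "dist (\<theta> s j) (\<theta>of x j) < \<omega>" if "s \<in> {0..1}" "j < length p" for s j
    proof -
      have "\<theta> s j - \<theta>of x j = s * (\<theta>of y j - \<theta>of x j)" by (simp add: \<theta>_def algebra_simps)
      then have "dist (\<theta> s j) (\<theta>of x j) = s * dist (\<theta>of y j) (\<theta>of x j)"
        using that(1) by (simp add: dist_real_def abs_mult)
      also have "\<dots> \<le> dist (\<theta>of y j) (\<theta>of x j)" using that(1) by (simp add: mult_left_le_one_le)
      finally show ?thesis using adjacent[OF e(5) that(2)] by linarith
    qed
    have "continuous_on {0..1} (\<lambda>s. glue \<gamma> (\<theta> s))"
      unfolding glue_def
    proof (intro continuous_on_sum continuous_on_l2_shift)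
      fix j assume "j \<in> {..<length p}"
      then have "(\<lambda>s. \<theta> s j) ` {0..1} \<subseteq> {0..1}" using cube by (auto simp: cube_def)
      moreover have "continuous_on {0..1} (\<lambda>s. \<theta> s j)" unfolding \<theta>_def by (intro continuous_intros)
      ultimately show "continuous_on {0..1} (\<lambda>s. \<gamma> (\<theta> s j))"
        using path unfolding path_def by (metis continuous_on_compose2)
    qed
    then have "continuous_on {0..1} (\<lambda>s. \<Phi> (\<theta> s))"
      unfolding \<Phi>_def by (rule continuous_on_compose2[OF contF[of UNIV]]) simp
    moreover have "\<Phi> (\<theta> s) \<in> S" if "s \<in> {0..1}" for s
      by (rule in_S[OF cube[OF that] e(1,3) close[OF that]])
    moreover have "\<theta> 0 = \<theta>of x" "\<theta> 1 = \<theta>of y" by (auto simp: \<theta>_def)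
    ultimately show ?thesis
      unfolding path_component_def
      by (intro exI[of _ "\<lambda>s. \<Phi> (\<theta> s)"]) (auto simp: path_def path_image_def pathstart_def pathfinish_def)
  qed
  have "path_component S (\<Phi> (\<theta>of x)) (\<Phi> (\<theta>of y))"
    using xy(6)
  proof (induction rule: rtrancl_induct)
    case base
    show ?case
      using in_S[OF cube_vertex[OF xy(1)] xy(1,5)] \<omega>(1) by (intro path_component_refl) simp
  next
    case (step y z)
    then show ?case using edge path_component_trans by blast
  qed
  \<comment> \<open>On the two opposite faces this block starts at an end of the path, at or below
    c1, where the map leaves it fixed.\<close>
  moreover have "\<Phi> (\<theta>of x) = \<gamma> 0"
    using frozen[OF cube_vertex[OF xy(1)] i] ends xy(3) by (simp add: \<Phi>_def \<theta>of_def)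
  moreover have "\<Phi> (\<theta>of y) = \<gamma> 1"
    using frozen[OF cube_vertex[OF xy(2)] i] ends xy(4) n(1) by (simp add: \<Phi>_def \<theta>of_def)
  ultimately show False using not_joined by (simp add: S_def)
qed

end

section \<open>Block norms, connectibility and minimax levels in concrete form\<close>

context lattice_equation
begin

text \<open>Agreement at t - 1 is included because the backward difference reaches one site to the
  left of F.\<close>

lemma norm_on_le:
  assumes "\<And>t. t \<in> F \<Longrightarrow> a t = l2_nth z t \<and> a (t - 1) = l2_nth z (t - 1)"
  shows "norm_on L F a \<le> nrm z"
proof -
  let ?h = "\<lambda>t. (norm (bdiff (l2_nth z) t))\<^sup>2 + inner (l2_nth z t) (L t *v l2_nth z t)"
  have "(\<Sum>\<^sub>\<infinity>t\<in>F. (norm (bdiff a t))\<^sup>2 + inner (a t) (L t *v a t)) = infsum ?h F"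
    by (rule infsum_cong) (use assms in \<open>auto simp: bdiff_def\<close>)
  also have "\<dots> \<le> infsum ?h UNIV"
    using nrm_power2_sum(1)[of z]
    by (intro infsum_mono2 summable_on_subset_banach[OF nrm_power2_sum(1)]) (auto simp: inner_L_nonneg add_nonneg_nonneg)
  also have "\<dots> = (nrm z)\<^sup>2" by (rule nrm_power2_sum(2)[symmetric])
  finally have "norm_on L F a \<le> sqrt ((nrm z)\<^sup>2)" unfolding norm_on_def by (rule real_sqrt_le_mono)
  then show ?thesis by simp
qed

lemma dist_star_singleton: "dist_star L u {v} = nrm (u - v)"
  by (simp add: dist_star_def)

lemma mem_nbhd: "u \<in> nbhd L r {v} \<longleftrightarrow> nrm (u - v) < r"
  by (simp add: nbhd_def dist_star_singleton)

lemma mem_annulus: "u \<in> annulus L r r' {v} \<longleftrightarrow> r < nrm (u - v) \<and> nrm (u - v) < r'"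
  by (simp add: annulus_def dist_star_singleton)

lemma continuous_on_nrm_diff: "continuous_on S (\<lambda>u. nrm (u - v))"
  by (rule continuous_on_compose2[OF continuous_on_nrm[of UNIV]]) (auto intro!: continuous_intros)

lemma closure_nbhd: "closure (nbhd L r {v}) \<subseteq> {u. nrm (u - v) \<le> r}"
proof (rule closure_minimal)
  show "closed {u. nrm (u - v) \<le> r}"
    by (intro closed_Collect_le continuous_on_nrm_diff continuous_on_const)
qed (auto simp: mem_nbhd)

lemma frontier_nbhd: "frontier (nbhd L r {v}) \<subseteq> {u. nrm (u - v) = r}"
proof -
  have "open {u. nrm (u - v) < r}"
    by (intro open_Collect_less continuous_on_nrm_diff continuous_on_const)
  moreover have "nbhd L r {v} = {u. nrm (u - v) < r}" by (auto simp: mem_nbhd)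
  ultimately have "interior (nbhd L r {v}) = {u. nrm (u - v) < r}" by (simp add: interior_open)
  then show ?thesis using closure_nbhd[of r v] unfolding frontier_def by force
qed

text \<open>The supremum is attained, so a strict pointwise bound along a path gives the strict
  bound in \<open>connectible\<close> and in minimax estimates.\<close>

lemma SUP_energy_path:
  assumes "path g"
  shows "bdd_above ((\<lambda>s. f (g s)) ` {0..1})" "\<exists>s\<in>{0..1}. (SUP s\<in>{0..1}. f (g s)) = f (g s)"
proof -
  have cont: "continuous_on {0..1} (\<lambda>s. f (g s))"
    using assms unfolding path_def by (rule continuous_on_compose2[OF continuous_on_energy[of UNIV]]) simp
  then show "bdd_above ((\<lambda>s. f (g s)) ` {0..1})"
    by (intro bounded_imp_bdd_above compact_imp_bounded compact_continuous_image) auto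
  obtain s where s: "s \<in> {0..1}" "\<And>s'. s' \<in> {0..1} \<Longrightarrow> f (g s') \<le> f (g s)"
    using continuous_attains_sup[OF _ _ cont] by auto
  then have "(SUP s\<in>{0..1}. f (g s)) = f (g s)" by (intro cSup_eq_maximum) auto
  with s(1) show "\<exists>s\<in>{0..1}. (SUP s\<in>{0..1}. f (g s)) = f (g s)" by blast
qed

lemma connectibleI:
  assumes "path_component {x. nrm (x - v) \<le> \<rho> \<and> f x < b} x y" "{x. nrm (x - v) \<le> \<rho>} \<subseteq> \<Omega>"
  shows "connectible L V b \<Omega> x y"
proof -
  obtain g where g: "path g" "path_image g \<subseteq> {x. nrm (x - v) \<le> \<rho> \<and> f x < b}" "pathstart g = x" "pathfinish g = y"
    using assms(1) unfolding path_component_def by blast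
  obtain s where s: "s \<in> {0..1}" "(SUP s\<in>{0..1}. f (g s)) = f (g s)" using SUP_energy_path(2)[OF g(1)] by blast
  have "f (g s) < b" using g(2) s(1) unfolding path_image_def by blast
  moreover have "path_image g \<subseteq> \<Omega>" using g(2) assms(2) by blast
  ultimately show ?thesis
    unfolding connectible_def paths_between_def using g s(2) by (intro bexI[of _ g]) auto
qed

text \<open>A real infimum is informative only for sets bounded below; the energy of the common
  starting point x is such a bound.\<close>

lemma minimax_lt:
  assumes "g \<in> \<Gamma>" "\<And>g. g \<in> \<Gamma> \<Longrightarrow> g \<in> paths_between x y" "\<And>s. s \<in> {0..1} \<Longrightarrow> f (g s) < c"
  shows "minimax L V \<Gamma> < c"
proof -
  have path: "path g" if "g \<in> \<Gamma>" for g using assms(2)[OF that] by (simp add: paths_between_def)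
  have "minimax L V \<Gamma> \<le> (SUP s\<in>{0..1}. f (g s))"
    unfolding minimax_def
  proof (rule cINF_lower[OF _ assms(1)])
    have "f x \<le> (SUP s\<in>{0..1}. f (h s))" if "h \<in> \<Gamma>" for h
    proof -
      have "h 0 = x" using assms(2)[OF that] by (simp add: paths_between_def pathstart_def)
      then show ?thesis using cSUP_upper[OF _ SUP_energy_path(1)[OF path[OF that]], of 0] by simp
    qed
    then show "bdd_below ((\<lambda>g. SUP s\<in>{0..1}. f (g s)) ` \<Gamma>)" by (intro bdd_belowI2)
  qed
  also have "\<dots> < c" using SUP_energy_path(2)[OF path[OF assms(1)]] assms(3) by auto
  finally show ?thesis .
qed

end

context bump_train
begin

text \<open>The backward difference at the left end of an interval sees a value of u from the
  preceding block. J adds such sites; they lie at cuts, where the barrier makes u tiny, and are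
  counted generously as two.\<close>

lemma block_distance:
  assumes u: "near u" "zone u" and i: "i < length p"
  shows "norm_on L (I i) (\<lambda>t. l2_nth u t - l2_nth w (t - p ! i))
    \<le> sqrt Lam * (norm (blk i u - w) + 2 * (s * (1 / (1 + lam / 4)) ^ N))"
proof -
  define J where "J = I i \<union> {t. t + 1 \<in> I i}"
  define z where "z = l2_restrict J (u - l2_shift (p ! i) w)"
  have "norm_on L (I i) (\<lambda>t. l2_nth u t - l2_nth w (t - p ! i)) \<le> nrm z"
    by (rule norm_on_le) (simp add: z_def J_def)
  also have "\<dots> \<le> sqrt Lam * norm z" by (rule nrm_le)
  also have "norm z \<le> norm (blk i u - w) + 2 * (s * (1 / (1 + lam / 4)) ^ N)"
  proof -
    have "z = l2_restrict J (l2_shift (p ! i) (blk i u - w)) + l2_restrict (J - I i) u"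
      by (rule l2_eqI) (auto simp: z_def J_def l2_nth_blk)
    then have "norm z \<le> norm (l2_restrict J (l2_shift (p ! i) (blk i u - w))) + norm (l2_restrict (J - I i) u)"
      by (simp add: norm_triangle_ineq)
    also have "norm (l2_restrict J (l2_shift (p ! i) (blk i u - w))) \<le> norm (blk i u - w)"
      by (metis norm_l2_restrict_le norm_l2_shift)
    also have "norm (l2_restrict (J - I i) u) \<le> 2 * (s * (1 / (1 + lam / 4)) ^ N)"
    proof -
      let ?C = "{(p ! (i - 1) + p ! i) div 2, (p ! i + p ! Suc i) div 2}"
      have nn: "0 \<le> s * (1 / (1 + lam / 4)) ^ N" using s_pos lam_pos by simp
      have "norm (l2_restrict (J - I i) u) \<le> real (card ?C) * (s * (1 / (1 + lam / 4)) ^ N)"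
      proof (rule norm_l2_finite_support_le)
        have cr: "(t \<in> I i) \<noteq> (t + 1 \<in> I i)" if "t \<in> J - I i" for t using that by (auto simp: J_def)
        show "l2_nth (l2_restrict (J - I i) u) t = 0" if "t \<notin> ?C" for t
          using interval_crossing(1)[OF i cr] that by auto
        show "norm (l2_nth (l2_restrict (J - I i) u) t) \<le> s * (1 / (1 + lam / 4)) ^ N" for t
          using crossing_small[OF u interval_crossing(2)[OF i cr]] nn by auto
      qed simp
      also have "\<dots> \<le> 2 * (s * (1 / (1 + lam / 4)) ^ N)"
        using nn by (intro mult_right_mono) (auto simp: card_insert_if)
      finally show ?thesis .
    qed
    finally show ?thesis by simp
  qed
  finally show ?thesis using Lam_pos by simp
qed

end

section \<open>Choice of the constants and conclusion\<close>

theorem theorem6p1: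
  fixes L :: "int \<Rightarrow> real^'n^'n"
    and V :: "int \<Rightarrow> real^'n \<Rightarrow> real"
    and V' :: "int \<Rightarrow> real^'n \<Rightarrow> real^'n"
    and T :: nat
    and w vbar vinf :: "(real^'n) l2seq"
    and \<kappa> \<kappa>star \<kappa>bar rbar hbar s0 s1 r :: real
    and d \<mu> :: "real \<Rightarrow> real"
    and \<gamma>bar :: "real \<Rightarrow> (real^'n) l2seq"
    and vs :: "(real^'n) l2seq set"
    and rn :: "nat \<Rightarrow> real"
    and vn :: "nat \<Rightarrow> (real^'n) l2seq"
  assumes V_C1: "\<And>t x. GDERIV (V t) x :> V' t x" "\<And>t. continuous_on UNIV (V' t)"
    and V'_0: "\<And>t. V' t 0 = 0"
    and A1: "T > 0" "\<And>t. L (t + int T) = L t" "\<And>t. V (t + int T) = V t"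
    and A2: "\<And>t. transpose (L t) = L t" "\<And>t x. x \<noteq> 0 \<Longrightarrow> inner x (L t *v x) > 0"
    and A3: "\<And>t. V t 0 = 0" "\<And>t. (\<lambda>x. norm (V' t x)) \<in> o[at 0](\<lambda>x. norm x)"
    and A4: "\<exists>\<beta> \<alpha>. \<beta> > 2 \<and> 0 < \<alpha> \<and> \<alpha> < \<beta> / 2 - 1 \<and>
               (\<forall>t x. \<beta> * V t x - inner (V' t x) x \<le> \<alpha> * inner x (L t *v x))"
    and A5: "\<exists>t0 x0. x0 \<noteq> 0 \<and> V t0 x0 - inner x0 (L t0 *v x0) / 2 > 0"
    \<comment> \<open>minimax level\<close>
    and w: "energy L V w < 0"
    and \<kappa>: "\<kappa> = minimax L V (paths_between 0 w)"
    and A6: "\<kappa>star > \<kappa>" "countable (crit L V \<inter> {u. energy L V u \<le> \<kappa>star})"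
    and d_\<mu>: "slope_constants L V \<kappa>star d \<mu>"
    \<comment> \<open>localisation of the minimax paths\<close>
    and rbar: "rbar \<in> {0<..<(INF v\<in>crit L V. norm_star L v) / 4} - ps_dists L V \<kappa>star"
    and hbar: "hbar \<in> {0<..<min (drop_const d \<mu> rbar) (\<kappa>star - \<kappa>) / 2}"
    and \<gamma>bar: "\<gamma>bar \<in> paths_between 0 w"
    and vs: "finite vs" "vs \<subseteq> crit_between L V (\<kappa> - hbar) (\<kappa> + hbar)"
    and \<gamma>bar_max: "(SUP s\<in>{0..1}. energy L V (\<gamma>bar s)) < \<kappa> + hbar"
    and \<gamma>bar_high: "\<And>s. s \<in> {0..1} \<Longrightarrow> energy L V (\<gamma>bar s) \<ge> \<kappa> - hbar \<Longrightarrow>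
               \<gamma>bar s \<in> (\<Union>v\<in>vs. nbhd L rbar {v})"
    and \<gamma>bar_annulus: "\<And>s. s \<in> {0..1} \<Longrightarrow>
               \<gamma>bar s \<in> (\<Union>v\<in>vs. annulus L (rbar - d rbar) (rbar + d rbar) {v}) \<Longrightarrow>
               energy L V (\<gamma>bar s) < \<kappa> - drop_const d \<mu> rbar"
    and vbar: "vbar \<in> vs"
    and s0_s1: "0 \<le> s0" "s0 < s1" "s1 \<le> 1"
    and \<gamma>bar_inside: "\<gamma>bar ` {s0<..<s1} \<subseteq> nbhd L rbar {vbar}"
    and \<gamma>bar_ends: "\<gamma>bar s0 \<in> frontier (nbhd L rbar {vbar})"
               "\<gamma>bar s1 \<in> frontier (nbhd L rbar {vbar})"
    and not_conn: "\<not> connectible L V \<kappa> UNIV (\<gamma>bar s0) (\<gamma>bar s1)"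
    and \<kappa>bar: "\<kappa>bar = minimax L V {\<gamma> \<in> paths_between (\<gamma>bar s0) (\<gamma>bar s1).
               path_image \<gamma> \<subseteq> nbhd L rbar {vbar} \<union> sublevel L V (\<kappa> - drop_const d \<mu> rbar / 2)}"
    \<comment> \<open>the critical point of local mountain pass type\<close>
    and vinf: "vinf \<in> crit_at L V \<kappa>bar"
    and rn: "\<And>n. rn n \<in> admissible_radii L V \<kappa>star"
    and vn: "\<And>n. vn n \<in> crit_at L V \<kappa>bar"
    and rn_vn: "\<And>n. closure (nbhd L (rn n) {vn n}) \<subseteq> nbhd L rbar {vbar}"
    and lims: "rn \<longlonglongrightarrow> 0" "vn \<longlonglongrightarrow> vinf"
    and local_paths: "\<And>n h. h > 0 \<Longrightarrow> \<exists>\<gamma>. path \<gamma> \<and>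
          {pathstart \<gamma>, pathfinish \<gamma>} \<subseteq>
            frontier (nbhd L (rn n) {vn n}) \<inter> sublevel L V (\<kappa>bar - drop_const d \<mu> (rn n) / 2) \<and>
          \<not> connectible L V \<kappa>bar (nbhd L rbar {vbar}) (pathstart \<gamma>) (pathfinish \<gamma>) \<and>
          path_image \<gamma> \<subseteq> closure (nbhd L (rn n) {vn n}) \<inter> sublevel L V (\<kappa>bar + h) \<and>
          path_image \<gamma> \<inter> annulus L (rn n - d (rn n) / 2) (rn n) {vn n} \<subseteq>
            sublevel L V (\<kappa>bar - drop_const d \<mu> (rn n) / 2) \<and>
          (\<exists>N::nat. N > 0 \<and>
             (\<forall>\<theta>\<in>{0..1}. {t. l2_nth (\<gamma> \<theta>) t \<noteq> 0} \<subseteq> {- int N..int N}))"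
    and r: "r > 0"
  shows "\<exists>N::nat. N > 0 \<and> (\<forall>k::nat. k > 0 \<longrightarrow> (\<forall>p\<in>bump_positions T k N.
           crit L V \<inter> multibump_nbhd L p r vinf \<noteq> {}))"
proof -
  interpret lattice_equation L V V' T
    by unfold_locales (fact V_C1 V'_0 A1 A2 A3)+
  have hbar': "0 < hbar" "hbar < (\<kappa>star - \<kappa>) / 2" using hbar by auto
  have rbar_adm: "rbar \<in> admissible_radii L V \<kappa>star"
    using rbar by (simp add: admissible_radii_def)
  have adm: "0 < d \<rho>" "d \<rho> < \<rho> / 3" "0 < \<mu> \<rho>"
    "\<And>u z. z \<in> crit_upto L V \<kappa>star \<Longrightarrow> f u \<le> \<kappa>star \<Longrightarrow> \<rho> - 3 * d \<rho> < nrm (u - z) \<Longrightarrow>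
      nrm (u - z) < \<rho> + 3 * d \<rho> \<Longrightarrow> \<mu> \<rho> \<le> dual_norm_deriv L V u"
    if "\<rho> \<in> admissible_radii L V \<kappa>star" for \<rho>
    using d_\<mu> that unfolding slope_constants_def sublevel_def by force+
  have vbar_crit: "vbar \<in> crit_upto L V \<kappa>star"
    using vbar vs(2) hbar' by (force simp: crit_between_def crit_upto_def sublevel_def)
  \<comment> \<open>The arc of \<open>\<gamma>bar\<close> between s0 and s1 competes for the local
    level and stays below \<kappa> + hbar. This puts the local level under
    \<open>\<kappa>star\<close>, where the slope constants and the countability hypothesis
    apply.\<close>
  have \<kappa>bar_less: "\<kappa>bar < \<kappa>star"
  proof -
    define g where "g = subpath s0 s1 \<gamma>bar"
    have path_\<gamma>bar: "path \<gamma>bar" using \<gamma>bar by (simp add: paths_between_def)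
    have s01: "s0 \<in> {0..1}" "s1 \<in> {0..1}" using s0_s1 by auto
    have inside: "\<gamma>bar s \<in> nbhd L rbar {vbar} \<union> sublevel L V (\<kappa> - drop_const d \<mu> rbar / 2)" if s: "s \<in> {s0..s1}" for s
    proof (cases "s \<in> {s0<..<s1}")
      case True
      then show ?thesis using \<gamma>bar_inside by blast
    next
      case False
      then have "s = s0 \<or> s = s1" using s by auto
      then have "nrm (\<gamma>bar s - vbar) = rbar" using \<gamma>bar_ends frontier_nbhd by blast
      then have "\<gamma>bar s \<in> (\<Union>v\<in>vs. annulus L (rbar - d rbar) (rbar + d rbar) {v})"
        using vbar adm(1)[OF rbar_adm] by (intro UN_I[of vbar]) (auto simp: mem_annulus)
      then have "f (\<gamma>bar s) < \<kappa> - drop_const d \<mu> rbar"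
        using \<gamma>bar_annulus[of s] s s0_s1 by auto
      moreover have "0 < drop_const d \<mu> rbar" using adm[OF rbar_adm] by (simp add: drop_const_def)
      ultimately show ?thesis by (simp add: sublevel_def)
    qed
    have "path_image g = \<gamma>bar ` {s0..s1}"
      using s0_s1 by (simp add: g_def path_image_subpath)
    then have "path_image g \<subseteq> nbhd L rbar {vbar} \<union> sublevel L V (\<kappa> - drop_const d \<mu> rbar / 2)"
      by (simp only: image_subsetI[OF inside])
    moreover have "g \<in> paths_between (\<gamma>bar s0) (\<gamma>bar s1)"
      using path_\<gamma>bar s01 by (simp add: g_def paths_between_def path_subpath)
    ultimately have "g \<in> {\<gamma> \<in> paths_between (\<gamma>bar s0) (\<gamma>bar s1).
               path_image \<gamma> \<subseteq> nbhd L rbar {vbar} \<union> sublevel L V (\<kappa> - drop_const d \<mu> rbar / 2)}"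
      by blast
    then have "\<kappa>bar < \<kappa> + hbar"
      unfolding \<kappa>bar
    proof (rule minimax_lt)
      fix s :: real assume "s \<in> {0..1}"
      then have "g s \<in> path_image g" by (simp add: path_image_def)
      then have "g s \<in> path_image \<gamma>bar" using path_image_subpath_subset[OF s01] g_def by blast
      then obtain s' where s': "s' \<in> {0..1}" "g s = \<gamma>bar s'" by (auto simp: path_image_def)
      have "f (\<gamma>bar s') \<le> (SUP s\<in>{0..1}. f (\<gamma>bar s))"
        by (rule cSUP_upper[OF s'(1) SUP_energy_path(1)[OF path_\<gamma>bar]])
      then show "f (g s) < \<kappa> + hbar" using \<gamma>bar_max s'(2) by simp
    qed auto
    then show ?thesis using hbar' by simp
  qed
  have vn_crit: "vn n \<in> crit_upto L V \<kappa>star" "grad (vn n) = 0" for n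
    using vn[of n] \<kappa>bar_less crit_iff[of "vn n"]
    by (auto simp: crit_at_def crit_between_def crit_upto_def sublevel_def)
  have rn_pos: "0 < rn n" for n using rn[of n] by (simp add: admissible_radii_def)
  text \<open>The annulus around \<open>vbar\<close> contains no critical point below \<open>\<kappa>star\<close>, so the centres \<open>vn n\<close> keep
    a fixed distance from the boundary of the ball of radius \<open>rbar\<close>.\<close>
  have vn_inside: "nrm (vn n - vbar) \<le> rbar - 3 * d rbar" for n
  proof (rule ccontr)
    assume *: "\<not> ?thesis"
    have "vn n \<in> closure (nbhd L (rn n) {vn n})"
      using rn_pos[of n] by (intro subsetD[OF closure_subset]) (simp add: mem_nbhd norm_star_def inner_star_eq)
    then have "nrm (vn n - vbar) < rbar" using rn_vn[of n] by (auto simp: mem_nbhd)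
    then have "\<mu> rbar \<le> dual_norm_deriv L V (vn n)"
      using * vn_crit(1)[of n] adm(1)[OF rbar_adm]
      by (intro adm(4)[OF rbar_adm vbar_crit]) (auto simp: crit_upto_def sublevel_def)
    also have "\<dots> \<le> 0" using dual_norm_deriv_le[of "vn n"] by (simp add: vn_crit)
    finally show False using adm(3)[OF rbar_adm] by simp
  qed
  obtain s where s: "s > 0" "\<And>t x. norm x \<le> s \<Longrightarrow> norm (V' t x) \<le> lam / 4 * norm x"
    using V'_small_uniform[of "lam / 4"] lam_pos by auto
  have vinf_nz: "vinf \<noteq> 0" using vinf crit_iff by (auto simp: crit_at_def crit_between_def)
  \<comment> \<open>s / 2 keeps tails below s, \<open>norm vinf / 4\<close> excludes the zero
    sequence, and r / (8 sqrt Lam) is one of four shares (two here, two in \<delta>) that, times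
    sqrt Lam, make up r / 2.\<close>
  define \<eta> where "\<eta> = min (s / 2) (min (norm vinf / 4) (r / (8 * sqrt Lam)))"
  have \<eta>: "\<eta> > 0" using s(1) vinf_nz r Lam_pos by (simp add: \<eta>_def)
  have "(\<lambda>n. 2 * rn n) \<longlonglongrightarrow> 2 * 0" by (intro tendsto_intros lims)
  then have ev1: "eventually (\<lambda>n. 2 * rn n < 3 * d rbar) sequentially"
    by (rule order_tendstoD(2)) (use adm(1)[OF rbar_adm] in simp)
  have "(\<lambda>n. 2 * rn n / sqrt lam) \<longlonglongrightarrow> 2 * 0 / sqrt lam"
    using lam_pos by (intro tendsto_intros lims) auto
  then have ev2: "eventually (\<lambda>n. 2 * rn n / sqrt lam < \<eta>) sequentially"
    by (rule order_tendstoD(2)) (use \<eta> in simp)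
  have "(\<lambda>n. norm (vn n - vinf)) \<longlonglongrightarrow> norm (vinf - vinf)" by (intro tendsto_intros lims)
  then have ev3: "eventually (\<lambda>n. norm (vn n - vinf) < \<eta>) sequentially"
    by (rule order_tendstoD(2)) (use \<eta> in simp)
  obtain n where n: "2 * rn n < 3 * d rbar" "2 * rn n / sqrt lam < \<eta>" "norm (vn n - vinf) < \<eta>"
    using eventually_happens[OF eventually_conj[OF ev1 eventually_conj[OF ev2 ev3]]] by auto
  \<comment> \<open>The centre is \<open>vn n\<close> instead of \<open>vinf\<close>, because the
    local paths are given around \<open>vn n\<close>, with the radius \<open>rn n\<close>.\<close>
  define v \<rho> where "v = vn n" and "\<rho> = rn n"
  note adm' = adm[OF rn[of n], folded \<rho>_def]
  define \<mu>' where "\<mu>' = sqrt lam * \<mu> \<rho>"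
  have \<mu>': "\<mu>' > 0" using adm'(3) lam_pos by (simp add: \<mu>'_def)
  have \<rho>: "\<rho> > 0" "2 * \<rho> < 3 * d rbar" "2 * \<rho> / sqrt lam < \<eta>" using n rn_pos by (auto simp: \<rho>_def)
  have close: "norm (x - v) < \<eta>" if "nrm (x - v) \<le> \<rho> + d \<rho>" for x
  proof -
    have "sqrt lam * norm (x - v) \<le> 2 * \<rho>" using nrm_ge[of "x - v"] that adm'(2) \<rho>(1) by linarith
    then have "norm (x - v) \<le> 2 * \<rho> / sqrt lam" using lam_pos by (simp add: field_simps)
    then show ?thesis using \<rho>(3) by linarith
  qed
  have ann: "\<mu>' \<le> norm (grad x)"
    if "\<rho> - d \<rho> \<le> nrm (x - v)" "nrm (x - v) \<le> \<rho> + d \<rho>" "f x \<le> \<kappa>star" for x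
  proof -
    have "\<mu> \<rho> \<le> dual_norm_deriv L V x"
      using vn_crit(1)[of n, folded v_def] that adm'(1) by (intro adm'(4)[of v]) auto
    also have "\<dots> \<le> norm (grad x) / sqrt lam" by (rule dual_norm_deriv_le)
    finally show ?thesis using lam_pos by (simp add: \<mu>'_def field_simps)
  qed
  obtain N1 :: nat where N1: "\<And>t. \<bar>t\<bar> \<ge> int N1 \<Longrightarrow> norm (l2_nth v t) \<le> s / 2"
  proof -
    obtain R :: nat where R: "norm (l2_restrict {t. \<bar>t\<bar> > int R} v) < s / 2"
      using l2_tail_small[of "s / 2" v] s(1) by auto
    have "norm (l2_nth v t) \<le> s / 2" if "\<bar>t\<bar> \<ge> int (Suc R)" for t
      using norm_l2_nth_le[of "l2_restrict {t. \<bar>t\<bar> > int R} v" t] R that by simp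
    then show thesis by (rule that)
  qed
  have tail: "norm (l2_nth u t) \<le> s" if "nrm (u - v) \<le> \<rho> + d \<rho>" "\<bar>t\<bar> \<ge> int N1" for u t
  proof -
    have "norm (l2_nth u t) \<le> norm (l2_nth v t) + norm (l2_nth (u - v) t)"
      using norm_triangle_ineq[of "l2_nth v t" "l2_nth (u - v) t"] by simp
    also have "\<dots> \<le> s / 2 + \<eta>"
      using N1[OF that(2)] norm_l2_nth_le[of "u - v" t] close[OF that(1)] by linarith
    finally show ?thesis by (simp add: \<eta>_def)
  qed
  \<comment> \<open>Since c4 - c1 is less than 2 e, the first entry gives the level gap of the
    profile; the second puts the ends of the local path at or below c1.\<close>
  define e where "e = min (\<mu>' / (4 * sqrt Lam) * d \<rho> / 4) (drop_const d \<mu> \<rho> / 2)"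
  have e: "e > 0" using \<mu>' adm' Lam_pos by (simp add: e_def drop_const_def)
  have count: "countable (crit L V \<inter> {u. f u \<le> a})" if "a \<le> \<kappa>star" for a
    by (rule countable_subset[OF _ A6(2)]) (use that in auto)
  obtain c1 c2 \<nu>1 where c12: "\<kappa>bar - e < c1" "c1 < c2" "c2 < \<kappa>bar" "\<nu>1 > 0"
    "\<And>u. nrm (u - v) \<le> \<rho> + d \<rho> \<Longrightarrow> c1 \<le> f u \<Longrightarrow> f u \<le> c2 \<Longrightarrow> \<nu>1 \<le> norm (grad u)"
    using noncritical_levels[where b = \<kappa>bar and a = "\<kappa>bar - e" and v = v and \<rho> = "\<rho> + d \<rho>" and ?N0.0 = N1,
        OF s(2) tail count] e \<kappa>bar_less by auto
  \<comment> \<open>The cap \<open>\<kappa>star\<close> keeps the annulus estimate and the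
    countability hypothesis valid up to c4.\<close>
  obtain c3 c4 \<nu>2 where c34: "\<kappa>bar < c3" "c3 < c4" "c4 < min (\<kappa>bar + e) \<kappa>star" "\<nu>2 > 0"
    "\<And>u. nrm (u - v) \<le> \<rho> + d \<rho> \<Longrightarrow> c3 \<le> f u \<Longrightarrow> f u \<le> c4 \<Longrightarrow> \<nu>2 \<le> norm (grad u)"
    using noncritical_levels[where b = "min (\<kappa>bar + e) \<kappa>star" and a = \<kappa>bar and v = v and \<rho> = "\<rho> + d \<rho>" and ?N0.0 = N1,
        OF s(2) tail count] e \<kappa>bar_less by auto
  \<comment> \<open>The overshoot h of the local path is chosen only after the windows, so that the
    path lies at or below c4.\<close>
  have "c4 - \<kappa>bar > 0" using c34 by simp
  moreover have "\<kappa>bar + (c4 - \<kappa>bar) = c4" by simp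
  ultimately obtain \<gamma> where \<gamma>: "path \<gamma>"
    "{pathstart \<gamma>, pathfinish \<gamma>} \<subseteq> sublevel L V (\<kappa>bar - drop_const d \<mu> \<rho> / 2)"
    "\<not> connectible L V \<kappa>bar (nbhd L rbar {vbar}) (pathstart \<gamma>) (pathfinish \<gamma>)"
    "path_image \<gamma> \<subseteq> closure (nbhd L \<rho> {v}) \<inter> sublevel L V c4"
    and "\<exists>N::nat. N > 0 \<and> (\<forall>\<theta>\<in>{0..1}. {t. l2_nth (\<gamma> \<theta>) t \<noteq> 0} \<subseteq> {- int N..int N})"
    using local_paths[of "c4 - \<kappa>bar" n, folded v_def \<rho>_def] by (metis le_inf_iff)
  then obtain N2 :: nat where
    N2: "\<And>\<theta>. \<theta> \<in> {0..1} \<Longrightarrow> {t. l2_nth (\<gamma> \<theta>) t \<noteq> 0} \<subseteq> {- int N2..int N2}" by blast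
  define N0 where "N0 = max N1 N2"
  define \<nu> where "\<nu> = min \<nu>1 \<nu>2"
  interpret profile: bump_profile L V V' T v \<rho> "d \<rho>" c1 c2 c3 c4 \<nu> \<mu>' s N0
  proof
    show "d \<rho> > 0" "\<nu> > 0" "\<mu>' > 0" "c1 < c2" "c3 < c4" "s > 0"
      using adm' c12 c34 \<mu>' s by (auto simp: \<nu>_def)
    show "\<nu> \<le> norm (grad x)" if "nrm (x - v) \<le> \<rho> + d \<rho>" "c1 \<le> f x" "f x \<le> c2" for x
      using c12(5)[OF that] by (simp add: \<nu>_def)
    show "\<nu> \<le> norm (grad x)" if "nrm (x - v) \<le> \<rho> + d \<rho>" "c3 \<le> f x" "f x \<le> c4" for x
      using c34(5)[OF that] by (simp add: \<nu>_def)
    show "\<mu>' \<le> norm (grad x)" if "\<rho> - d \<rho> \<le> nrm (x - v)" "nrm (x - v) \<le> \<rho> + d \<rho>" "f x \<le> c4" for x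
      using ann[OF that(1,2)] that(3) c34(3) by simp
    have "c4 - c1 \<le> 2 * e" using c12 c34 by simp
    also have "\<dots> \<le> 2 * (\<mu>' / (4 * sqrt Lam) * d \<rho> / 4)" unfolding e_def by (intro mult_left_mono) auto
    finally show "c4 - c1 \<le> \<mu>' / (4 * sqrt Lam) * d \<rho> / 2" by simp
    show "norm (V' t x) \<le> lam / 4 * norm x" if "norm x \<le> s" for t x using s(2)[OF that] .
    show "norm (l2_nth u t) \<le> s" if "nrm (u - v) \<le> \<rho> + d \<rho>" "\<bar>t\<bar> \<ge> int N0" for u t
      using tail[OF that(1), of t] that(2) by (simp add: N0_def)
  qed
  define q where "q = 1 / (1 + lam / 4)"
  \<comment> \<open>The denominator 32 is the 8 of the cut error times the 4 in the tolerance of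
    \<open>block_step\<close>.\<close>
  define \<delta> where "\<delta> = min (min \<nu> \<mu>' / 32) (r / (8 * sqrt Lam))"
  have \<delta>: "\<delta> > 0" using \<mu>' c12 c34 r Lam_pos by (simp add: \<delta>_def \<nu>_def)
  have "(\<lambda>j. s * q ^ j) \<longlonglongrightarrow> s * 0"
    using lam_pos by (intro tendsto_intros LIMSEQ_realpow_zero) (auto simp: q_def)
  then have ev: "eventually (\<lambda>j. s * q ^ j < \<delta>) sequentially" by (rule order_tendstoD(2)) (use \<delta> in simp)
  obtain N where N: "s * q ^ N < \<delta>" "max 1 N0 \<le> N"
    using eventually_happens[OF eventually_conj[OF ev eventually_ge_at_top[of "max 1 N0"]]] by auto
  have "crit L V \<inter> multibump_nbhd L p r vinf \<noteq> {}" if k: "k > 0" and p: "p \<in> bump_positions T k N" for k p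
  proof -
    have "N > 0" using N(2) by simp
    note pos = bump_positions_train[OF p k this]
    interpret train: bump_train L V V' T v \<rho> "d \<rho>" c1 c2 c3 c4 \<nu> \<mu>' s N0 p N
    proof (intro bump_train.intro bump_train_axioms.intro)
      show "bump_profile L V V' T v \<rho> (d \<rho>) c1 c2 c3 c4 \<nu> \<mu>' s N0" by (rule profile.bump_profile_axioms)
      show "bump_train_positions p ((int N)\<^sup>2 + 2 * int N - 1)" by (rule pos(1))
      show "int T dvd p ! i" if "i < length p" for i using pos that by simp
      show "N0 \<le> N" "0 < N" using N(2) by auto
      show "8 * (s * (1 / (1 + lam / 4)) ^ N) \<le> min \<nu> \<mu>' / 4" using N(1) by (simp add: \<delta>_def q_def)
    qed
    have "\<exists>u. train.near u \<and> train.zone u \<and> grad u = 0"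
    proof (rule train.multibump_critical)
      show "path \<gamma>" by (rule \<gamma>(1))
      show "l2_nth (\<gamma> \<theta>) t = 0" if "\<theta> \<in> {0..1}" "\<bar>t\<bar> > int N0" for \<theta> t
        using N2[OF that(1)] that(2) by (force simp: N0_def)
      show "nrm (\<gamma> \<theta> - v) \<le> \<rho> \<and> f (\<gamma> \<theta>) \<le> c4" if "\<theta> \<in> {0..1}" for \<theta>
        using \<gamma>(4) closure_nbhd[of \<rho> v] that unfolding path_image_def sublevel_def by blast
      have "\<kappa>bar - drop_const d \<mu> \<rho> / 2 \<le> c1" using c12(1) by (simp add: e_def)
      then show "f (\<gamma> 0) \<le> c1" "f (\<gamma> 1) \<le> c1"
        using \<gamma>(2) by (auto simp: sublevel_def pathstart_def pathfinish_def)
      show "c2 < \<kappa>bar" by (rule c12(3))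
      \<comment> \<open>As 2 \<rho> is less than the margin 3 d(rbar) that \<open>vn_inside\<close>
        leaves, a path in the ball of a block is one in the larger ball, where connectibility is
        excluded.\<close>
      have "{x. nrm (x - v) \<le> \<rho> + d \<rho>} \<subseteq> nbhd L rbar {vbar}"
      proof
        fix x assume "x \<in> {x. nrm (x - v) \<le> \<rho> + d \<rho>}"
        then have "nrm (x - v) < 2 * \<rho>" using adm'(2) \<rho>(1) by simp
        moreover have "nrm (x - vbar) \<le> nrm (x - v) + nrm (v - vbar)"
          using nrm_triangle[of "x - v" "v - vbar"] by simp
        ultimately show "x \<in> nbhd L rbar {vbar}"
          using vn_inside[of n] \<rho>(2) unfolding mem_nbhd v_def by linarith
      qed
      from connectibleI[OF _ this] \<gamma>(3)
      show "\<not> path_component {x. nrm (x - v) \<le> \<rho> + d \<rho> \<and> f x < \<kappa>bar} (\<gamma> 0) (\<gamma> 1)"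
        unfolding pathstart_def pathfinish_def by blast
    qed
    then obtain u where u: "train.near u" "train.zone u" "grad u = 0" by blast
    have blk: "norm (train.blk i u - v) < \<eta>" if "i < length p" for i
      by (rule close) (use u(1) that in \<open>simp add: train.near_def\<close>)
    \<comment> \<open>All blocks of the zero sequence vanish, which would put v within \<eta> of 0;
      but \<open>vinf\<close> has norm at least 4 \<eta>, and v is within \<eta> of it.\<close>
    have "u \<noteq> 0"
    proof
      assume "u = 0"
      then have "train.blk 0 u = 0" by (intro l2_eqI) (simp add: train.l2_nth_blk)
      then have "norm v < \<eta>" using blk[of 0] train.nonempty by simp
      moreover have "norm vinf \<le> norm v + norm (v - vinf)"
        using norm_triangle_ineq4[of v "v - vinf"] by simp
      moreover have "\<eta> \<le> norm vinf / 4" by (simp add: \<eta>_def)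
      ultimately show False using n(3)[folded v_def] vinf_nz zero_less_norm_iff[of vinf] by linarith
    qed
    then have "u \<in> crit L V" using u(3) by (simp add: crit_iff)
    moreover have "u \<in> multibump_nbhd L p r vinf"
      unfolding multibump_nbhd_def
    proof (intro CollectI allI impI)
      fix i assume i: "i < length p"
      have "norm (train.blk i u - vinf) \<le> norm (train.blk i u - v) + norm (v - vinf)"
        using norm_triangle_ineq[of "train.blk i u - v" "v - vinf"] by simp
      then have "norm (train.blk i u - vinf) + 2 * (s * q ^ N) < 2 * \<eta> + 2 * \<delta>"
        using blk[OF i] n(3)[folded v_def] N(1) by linarith
      also have "\<dots> \<le> 2 * (r / (8 * sqrt Lam)) + 2 * (r / (8 * sqrt Lam))"
        by (intro add_mono mult_left_mono) (auto simp: \<eta>_def \<delta>_def)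
      finally have "sqrt Lam * (norm (train.blk i u - vinf) + 2 * (s * q ^ N))
          < sqrt Lam * (2 * (r / (8 * sqrt Lam)) + 2 * (r / (8 * sqrt Lam)))"
        using Lam_pos by (intro mult_strict_left_mono) auto
      also have "\<dots> = r / 2" using Lam_pos by (simp add: field_simps)
      finally have "norm_on L (bump_interval p i) (\<lambda>t. l2_nth u t - l2_nth vinf (t - p ! i)) < r / 2"
        using train.block_distance[OF u(1,2) i, of vinf, folded q_def] by linarith
      then show "norm_on L (bump_interval p i) (\<lambda>t. l2_nth u t - l2_nth vinf (t - p ! i)) < r"
        using r by simp
    qed
    ultimately show ?thesis by blast
  qed
  then show ?thesis using N(2) by (intro exI[of _ N]) auto
qed

end
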